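(* Let $r>0$ and let $\varphi$ be a toric plurisubharmonic function defined on the polydisk $D(0,r)\subset\mathbf{C}^n$. Then the following are equivalent. (1) $\varphi$ admits a nice toric approximation, i.e. there is a decreasing sequence $(\varphi_m)_{m\ge1}$ of toric plurisubharmonic functions with analytic singularities (defined near the origin) converging pointwise to $\varphi$ and satisfying $\mathcal{J}(\varphi_m)=\mathcal{J}(\varphi)$ for every $m\ge 1$. (2) There exists a polyhedron $P\subseteq\mathbf{R}^n_{\ge0}$ satisfying the following three conditions: (i) $(2/c)P$ is a rational polyhedron for some $c>0$; (ii) $P(\varphi)\subseteq P$ and $P+\mathbf{R}^n_{\ge0}\subseteq P$; (iii) $(\operatorname{int}P)\cap\mathbf{Z}^n_{\ge0}=(\operatorname{int}P(\varphi))\cap\mathbf{Z}^n_{\ge0}$.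
   Context: $D(0,r)$ denotes the polydisk in $\mathbf{C}^n$ with polyradius $(r,\dots,r)$. A plurisubharmonic (psh) function $\varphi$ on $D(0,r)$ is toric if $\varphi(z_1,\dots,z_n)=\varphi(e^{i\theta_1}z_1,\dots,e^{i\theta_n}z_n)$ for all real $\theta_1,\dots,\theta_n$. For such $\varphi$ there is a convex function $g$ on $U=(-\infty,\log r)^n$, increasing in each variable, with $\varphi(z)=g(\log|z_1|,\dots,\log|z_n|)$ (the convex function associated to $\varphi$). The Newton convex body of $\varphi$ is $P(\varphi)=\{x\in\mathbf{R}^n:\sup_{y\in U}(\langle x,y\rangle-g(y))<+\infty\}$. A psh function has analytic singularities if locally it is of the form $c\log(|g_1|^2+\cdots+|g_m|^2)+O(1)$ with $c\ge0$ and $g_j$ holomorphic. $\mathcal{J}(\varphi)$ is the multiplier ideal sheaf: its stalk at $x$ consists of holomorphic germs $f$ with $|f|^2e^{-2\varphi}$ locally Lebesgue integrable near $x$. A polyhedron is a finite intersection of closed half-spaces $\{x\in\mathbf{R}^n:\langle a_i,x\rangle\le b_i\}$; it is rational if the $a_i$ and $b_i$ can all be chosen with rational entries. $\operatorname{int}$ denotes interior in $\mathbf{R}^n$; $\mathbf{R}^n_{\ge0}$, $\mathbf{Z}^n_{\ge0}$ are the $n$-tuples of nonnegative reals, resp. integers. *)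

theory Defs
  imports "HOL-Analysis.Analysis"
begin

definition polydisk :: "real \<Rightarrow> (complex ^ 'n) set" where
  "polydisk r = {z. \<forall>i. norm (z $ i) < r}"

definition holo_on :: "(complex ^ 'n) set \<Rightarrow> (complex ^ 'n \<Rightarrow> complex) \<Rightarrow> bool" where
  "holo_on V f \<longleftrightarrow> (\<forall>z\<in>V. \<exists>L. (f has_derivative L) (at z) \<and>
                         (\<forall>c v. L (c *s v) = c * L v))"

definition ereal_int_circle :: "(real \<Rightarrow> ereal) \<Rightarrow> ereal" where
  "ereal_int_circle u =
     enn2ereal (\<integral>\<^sup>+ t. e2ennreal (u t) * indicator {0..2*pi} t \<partial>lborel)
   - enn2ereal (\<integral>\<^sup>+ t. e2ennreal (- u t) * indicator {0..2*pi} t \<partial>lborel)"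

definition psh_on :: "(complex ^ 'n) set \<Rightarrow> (complex ^ 'n \<Rightarrow> ereal) \<Rightarrow> bool" where
  "psh_on \<Omega> \<phi> \<longleftrightarrow>
     (\<forall>z\<in>\<Omega>. \<phi> z < \<infinity>) \<and>
     (\<exists>z\<in>\<Omega>. \<phi> z \<noteq> -\<infinity>) \<and>
     (\<forall>z\<in>\<Omega>. \<forall>c. \<phi> z < c \<longrightarrow> eventually (\<lambda>w. \<phi> w < c) (at z within \<Omega>)) \<and>
     (\<forall>a b. (\<forall>\<zeta>::complex. norm \<zeta> \<le> 1 \<longrightarrow> a + \<zeta> *s b \<in> \<Omega>) \<longrightarrow>
        \<phi> a \<le> ereal (1 / (2*pi)) *
           ereal_int_circle (\<lambda>t. \<phi> (a + cis t *s b)))"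

definition toric_on :: "real \<Rightarrow> (complex ^ 'n \<Rightarrow> ereal) \<Rightarrow> bool" where
  "toric_on r \<phi> \<longleftrightarrow> (\<forall>z\<in>polydisk r. \<forall>\<theta>::real^'n.
        \<phi> (\<chi> i. cis (\<theta> $ i) * z $ i) = \<phi> z)"

definition toric_psh :: "real \<Rightarrow> (complex ^ 'n \<Rightarrow> ereal) \<Rightarrow> bool" where
  "toric_psh r \<phi> \<longleftrightarrow> psh_on (polydisk r) \<phi> \<and> toric_on r \<phi>"

definition assoc_convex :: "(complex ^ 'n \<Rightarrow> ereal) \<Rightarrow> real ^ 'n \<Rightarrow> ereal" where
  "assoc_convex \<phi> y = \<phi> (\<chi> i. complex_of_real (exp (y $ i)))"

definition newton_body :: "real \<Rightarrow> (complex ^ 'n \<Rightarrow> ereal) \<Rightarrow> (real ^ 'n) set" where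
  "newton_body r \<phi> = {x. \<exists>C::real. \<forall>y::real^'n. (\<forall>i. y $ i < ln r) \<longrightarrow>
        ereal (x \<bullet> y) - assoc_convex \<phi> y \<le> ereal C}"

definition eln :: "real \<Rightarrow> ereal" where
  "eln t = (if t \<le> 0 then -\<infinity> else ereal (ln t))"

definition analytic_sing_on :: "(complex ^ 'n) set \<Rightarrow> (complex ^ 'n \<Rightarrow> ereal) \<Rightarrow> bool" where
  "analytic_sing_on \<Omega> \<phi> \<longleftrightarrow> (\<forall>x\<in>\<Omega>. \<exists>V c gs h B.
      open V \<and> x \<in> V \<and> V \<subseteq> \<Omega> \<and> c \<ge> (0::real) \<and>
      (\<forall>g\<in>set gs. holo_on V g) \<and> (\<forall>z\<in>V. \<bar>h z\<bar> \<le> (B::real)) \<and>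
      (\<forall>z\<in>V. \<phi> z = ereal c * eln (\<Sum>g\<leftarrow>gs. (cmod (g z))\<^sup>2) + ereal (h z)))"

definition weight :: "ereal \<Rightarrow> ennreal" where
  "weight v = (if v = \<infinity> then 0 else if v = -\<infinity> then \<infinity>
                else ennreal (exp (-2 * real_of_ereal v)))"

text \<open>Membership of (a germ represented by) f in the stalk at x of the multiplier ideal
  sheaf of \<phi> defined on \<Omega>.\<close>
definition in_mult_ideal :: "(complex ^ 'n) set \<Rightarrow> (complex ^ 'n \<Rightarrow> ereal) \<Rightarrow> complex ^ 'n
      \<Rightarrow> (complex ^ 'n \<Rightarrow> complex) \<Rightarrow> bool" where
  "in_mult_ideal \<Omega> \<phi> x f \<longleftrightarrow> (\<exists>V. open V \<and> x \<in> V \<and> V \<subseteq> \<Omega> \<and> holo_on V f \<and>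
      (\<integral>\<^sup>+ z. ennreal ((cmod (f z))\<^sup>2) * weight (\<phi> z) * indicator V z \<partial>lborel) < \<infinity>)"

definition nonneg_orthant :: "(real ^ 'n) set" where
  "nonneg_orthant = {x. \<forall>i. 0 \<le> x $ i}"

definition nonneg_lattice :: "(real ^ 'n) set" where
  "nonneg_lattice = {x. \<forall>i. x $ i \<in> \<nat>}"

definition rational_polyhedron :: "(real ^ 'n) set \<Rightarrow> bool" where
  "rational_polyhedron S \<longleftrightarrow>
     (\<exists>F. finite F \<and> S = \<Inter> F \<and>
        (\<forall>h\<in>F. \<exists>a b. a \<noteq> 0 \<and> (\<forall>i. a $ i \<in> \<rat>) \<and> b \<in> \<rat> \<and> h = {x. a \<bullet> x \<le> b}))"

end

theory Submission
  imports Defs "HOL-Complex_Analysis.Cauchy_Integral_Formula"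
begin

text \<open>Write \<open>G\<close> for the convex function associated to \<open>\<phi>\<close>. Near a point \<open>x\<close> a monomial \<open>z\<^sup>a\<close> is
  square integrable against \<open>exp (- 2 \<phi>)\<close> iff \<open>a + 1\<close>, increased by a suitable \<open>k\<close> in the coordinates
  where \<open>x\<close> does not vanish, lies in the interior of the Newton convex body: inside, a slightly smaller
  exponent still bounds \<open>G\<close> from below; outside, a separating hyperplane gives a direction along which \<open>G\<close>
  decays too fast. Decomposing a holomorphic germ into homogeneous parts by averages over roots of
  unity, and using Dickson's lemma, the germ is bounded by finitely many of the monomials that
  occur in it. Hence multiplier ideals of toric functions are determined by lattice points in
  Newton bodies.

  (1) implies (2): take for \<open>P\<close> the Newton body of \<open>\<phi>\<^sub>0\<close>. Applied to the functions \<open>g\<^sub>j\<close> in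
  \<open>\<phi>\<^sub>0 = c log (\<Sum> |g\<^sub>j|\<^sup>2) + O(1)\<close>, the same decomposition gives \<open>P = 2 c (conv B + nonneg_orthant)\<close> for a finite
  set \<open>B\<close> of exponents, which is rational after scaling.

  (2) implies (1): write \<open>P = \<kappa> (conv B + nonneg_orthant)\<close> with \<open>B\<close> a finite set of exponents and put
  \<open>H(z) = \<kappa> log max {|z\<^sup>b| : b \<in> B}\<close>. Since \<open>\<phi> \<le> H + O(1)\<close> on a smaller polydisk, the functions
  \<open>max \<phi> (H - m)\<close> differ from \<open>H\<close> by bounded functions and decrease to \<open>\<phi>\<close>, and their multiplier
  ideals are those of \<open>H\<close>, hence of \<open>\<phi>\<close> by the condition on lattice points.\<close>

subsection \<open>Newton polyhedra\<close>

text \<open>The Newton body need not be closed: for \<open>G y = - sqrt (- y)\<close> on the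
  negative axis it is an open half-line. So interior points carry the integrability criterion, and
  subgradients, which always belong to the body, take the place of a conjugation formula. Condition
  (iii) speaks of integer points only, while the ideals must agree at every point of a polydisk,
  also where some coordinates do not vanish. This is why the shift of exponents is by a natural
  number: the shifted exponent stays a lattice point and the hypothesis applies to it. Convexity of
  \<open>G\<close> has to come from the sub-mean value inequality on discs alone, for a function
  that is only upper semicontinuous and may a priori be -\<infinity>; hence maximum principles with
  penalty terms in place of derivatives. Homogeneous parts are obtained from finite averages because
  these visibly preserve continuity and torus invariant bounds, contract weighted square integrals
  by Cauchy-Schwarz, and pass to limits by Fatou.\<close>

definition rvec :: "('n \<Rightarrow> nat) \<Rightarrow> real ^ 'n" where
  "rvec a = (\<chi> i. real (a i))"

lemma rvec_nth [simp]: "rvec a $ i = real (a i)"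
  by (simp add: rvec_def)

definition newton_poly :: "('n \<Rightarrow> nat) set \<Rightarrow> (real ^ 'n) set" where
  "newton_poly B = {x. \<exists>p \<in> convex hull (rvec ` B). \<forall>i. p $ i \<le> x $ i}"

text \<open>\<real> is a vector space over \<rat> in which \<open>{1}\<close> is independent, so
  sending 1 to 1 extends to a linear functional. Applied coordinatewise it produces rational
  solutions of rational systems without elimination.\<close>

lemma real_rat_retraction:
  obtains f :: "real \<Rightarrow> rat"
  where "\<And>x y. f (x + y) = f x + f y" and "\<And>q x. f (of_rat q * x) = q * f x" and "f 1 = 1"
proof -
  interpret vector_space_pair "\<lambda>q (x::real). of_rat q * x" "\<lambda>q x :: rat. q * x"
    by unfold_locales (auto simp: algebra_simps of_rat_add of_rat_mult)
  have "vs1.independent {1::real}"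
    by simp
  from linear_independent_extend[OF this, of "\<lambda>_. 1"] obtain g where
    g: "Vector_Spaces.linear (\<lambda>q (x::real). of_rat q * x) (\<lambda>q x :: rat. q * x) g" "g 1 = 1"
    by auto
  interpret g: Vector_Spaces.linear "\<lambda>q (x::real). of_rat q * x" "\<lambda>q x :: rat. q * x" g
    by (rule g)
  show ?thesis
    using that[of g] g.add g.scale g(2) by simp
qed

text \<open>A \<open>\<rat>\<close>-linear retraction \<open>\<real> \<rightarrow> \<rat>\<close>, applied to the coordinates of \<open>x\<close>, gives another solution of the
  equations that are active at \<open>x\<close>; at an extreme point this solution is unique.\<close>

lemma extreme_point_rational:
  fixes x :: "'a::euclidean_space"
  assumes fin: "finite F"
    and S: "S = {x. \<forall>(a, b)\<in>F. a \<bullet> x \<le> b}"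
    and rat: "\<And>a b. (a, b) \<in> F \<Longrightarrow> (\<forall>i\<in>Basis. a \<bullet> i \<in> \<rat>) \<and> b \<in> \<rat>"
    and x: "x extreme_point_of S"
    and i: "i \<in> Basis"
  shows "x \<bullet> i \<in> \<rat>"
proof -
  obtain f :: "real \<Rightarrow> rat" where f: "\<And>x y. f (x + y) = f x + f y"
      "\<And>q x. f (of_rat q * x) = q * f x" "f 1 = 1"
    using real_rat_retraction by blast
  have f_rat: "f (of_rat q) = q" for q
    using f(2)[of q 1] f(3) by simp
  have f0: "f 0 = 0" using f_rat[of 0] by simp
  have f_sum: "f (sum h I) = (\<Sum>i\<in>I. f (h i))" if "finite I" for h and I :: "'a set"
    using that by (induction I) (auto simp: f f0)
  define y where "y = (\<Sum>i\<in>Basis. of_rat (f (x \<bullet> i)) *\<^sub>R i)"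
  have yi: "y \<bullet> j = of_rat (f (x \<bullet> j))" if "j \<in> Basis" for j
    using that by (simp add: y_def inner_sum_left inner_Basis if_distrib cong: if_cong)
  have active: "a \<bullet> y = b" if "(a, b) \<in> F" "a \<bullet> x = b" for a b
  proof -
    from rat[OF that(1)] have ra: "\<forall>i\<in>Basis. \<exists>q. a \<bullet> i = of_rat q"
      and "\<exists>q. b = of_rat q" by (auto elim: Rats_cases)
    then obtain q where q: "b = of_rat q" by blast
    from ra obtain p where p: "\<And>i. i \<in> Basis \<Longrightarrow> a \<bullet> i = of_rat (p i)"
      by metis
    have "a \<bullet> y = (\<Sum>i\<in>Basis. (a \<bullet> i) * (y \<bullet> i))" by (simp add: euclidean_inner[of a y])
    also have "\<dots> = (\<Sum>i\<in>Basis. of_rat (p i * f (x \<bullet> i)))"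
      by (intro sum.cong) (auto simp: p yi of_rat_mult)
    also have "\<dots> = of_rat (\<Sum>i\<in>Basis. f (of_rat (p i) * (x \<bullet> i)))"
      by (simp add: f(2) of_rat_sum)
    also have "(\<Sum>i\<in>Basis. f (of_rat (p i) * (x \<bullet> i))) = f (\<Sum>i\<in>Basis. (a \<bullet> i) * (x \<bullet> i))"
      by (simp add: f_sum p)
    also have "(\<Sum>i\<in>Basis. (a \<bullet> i) * (x \<bullet> i)) = b"
      using that(2) by (simp add: euclidean_inner[of a x])
    finally show ?thesis by (simp add: q f_rat)
  qed
  have xS: "x \<in> S" using x by (simp add: extreme_point_of_def)
  \<comment> \<open>Active constraints are constant along the line through \<open>x\<close> and
    \<open>y\<close>, and the others have slack at \<open>x\<close>; so small moves in both
    directions stay feasible.\<close>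
  have ev: "eventually (\<lambda>t. \<forall>p\<in>F. fst p \<bullet> (x + t *\<^sub>R (y - x)) \<le> snd p) (nhds (0::real))"
  proof (rule eventually_ball_finite[OF fin], rule ballI)
    fix p assume p: "p \<in> F"
    obtain a b where ab: "p = (a, b)" by (cases p)
    have le: "a \<bullet> x \<le> b" using p ab xS S by auto
    show "\<forall>\<^sub>F t in nhds (0::real). fst p \<bullet> (x + t *\<^sub>R (y - x)) \<le> snd p"
    proof (cases "a \<bullet> x = b")
      case True
      with active p ab have "a \<bullet> y = b" by blast
      then have "fst p \<bullet> (x + t *\<^sub>R (y - x)) \<le> snd p" for t
        using True ab by (simp add: inner_right_distrib inner_diff_right)
      then show ?thesis by simp
    next
      case False
      then have lt: "a \<bullet> x < b" using le by simp
      have "((\<lambda>t::real. a \<bullet> (x + t *\<^sub>R (y - x))) \<longlongrightarrow> a \<bullet> (x + 0 *\<^sub>R (y - x))) (nhds 0)"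
        by (intro tendsto_intros filterlim_ident)
      then have "\<forall>\<^sub>F t in nhds (0::real). a \<bullet> (x + t *\<^sub>R (y - x)) < b"
        using lt by (intro order_tendstoD(2)) auto
      then show ?thesis by (rule eventually_mono) (auto simp: ab)
    qed
  qed
  then obtain d where d: "d > 0" "\<And>t. dist t 0 < d \<Longrightarrow> \<forall>p\<in>F. fst p \<bullet> (x + t *\<^sub>R (y - x)) \<le> snd p"
    unfolding eventually_nhds_metric by blast
  define u where "u = x + (d/2) *\<^sub>R (y - x)"
  define v where "v = x + (-d/2) *\<^sub>R (y - x)"
  have uv: "u \<in> S" "v \<in> S" using d(2)[of "d/2"] d(2)[of "-d/2"] d(1) by (auto simp: u_def v_def S)
  have "y = x"
  proof (rule ccontr)
    assume "y \<noteq> x"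
    moreover have "u - v = 2 *\<^sub>R ((d/2) *\<^sub>R (y - x))"
      unfolding scaleR_2 by (simp add: u_def v_def)
    ultimately have "u \<noteq> v" using d(1) by auto
    moreover have "u + v = 2 *\<^sub>R x" by (simp add: u_def v_def scaleR_2)
    then have "x = midpoint u v" by (simp add: midpoint_def)
    ultimately have "x \<in> open_segment u v" by simp
    then show False using x uv by (auto simp: extreme_point_of_def)
  qed
  then show ?thesis using yi[OF i] by (metis Rats_of_rat)
qed

lemma closed_nonneg_orthant: "closed (nonneg_orthant :: (real ^ 'n) set)"
proof -
  have "nonneg_orthant = (\<Inter>i. {x :: real ^ 'n. 0 \<le> x $ i})"
    by (auto simp: nonneg_orthant_def)
  moreover have "closed {x :: real ^ 'n. 0 \<le> x $ i}" for i
    by (intro closed_Collect_le continuous_intros)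
  ultimately show ?thesis by (metis (no_types, lifting) closed_INT UNIV_I)
qed

text \<open>The Minkowski sum yields closedness, as compact plus closed; the definition by
  domination yields upward closure at once.\<close>

lemma newton_poly_alt:
  "newton_poly B = (\<Union>x\<in>convex hull (rvec ` B). \<Union>y\<in>nonneg_orthant. {x + y})"
proof (intro set_eqI iffI)
  fix x assume "x \<in> newton_poly B"
  then obtain p where "p \<in> convex hull (rvec ` B)" "\<forall>i. p $ i \<le> x $ i"
    by (auto simp: newton_poly_def)
  then show "x \<in> (\<Union>x\<in>convex hull (rvec ` B). \<Union>y\<in>nonneg_orthant. {x + y})"
    by (auto simp: nonneg_orthant_def intro!: bexI[of _ p] exI[of _ "x - p"])
next
  fix x assume "x \<in> (\<Union>x\<in>convex hull (rvec ` B). \<Union>y\<in>nonneg_orthant. {x + y})"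
  then show "x \<in> newton_poly B"
    by (force simp: newton_poly_def nonneg_orthant_def)
qed

lemma closed_newton_poly: assumes "finite B" shows "closed (newton_poly B)"
  unfolding newton_poly_alt
  by (intro compact_closed_sums closed_nonneg_orthant) (simp add: assms finite_imp_compact_convex_hull)

lemma convex_newton_poly: "convex (newton_poly B)"
proof (rule convexI)
  fix x y :: "real ^ 'a" and u v :: real
  assume xy: "x \<in> newton_poly B" "y \<in> newton_poly B" and uv: "0 \<le> u" "0 \<le> v" "u + v = 1"
  then obtain p q where "p \<in> convex hull (rvec ` B)" "\<forall>i. p $ i \<le> x $ i"
     "q \<in> convex hull (rvec ` B)" "\<forall>i. q $ i \<le> y $ i" by (auto simp: newton_poly_def)
  then show "u *\<^sub>R x + v *\<^sub>R y \<in> newton_poly B" using uv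
    unfolding newton_poly_def
    by (auto intro!: bexI[of _ "u *\<^sub>R p + v *\<^sub>R q"] add_mono mult_left_mono convexD)
qed

lemma newton_poly_up:
  "x \<in> newton_poly B \<Longrightarrow> (\<And>i. x $ i \<le> y $ i) \<Longrightarrow> y \<in> newton_poly B"
  unfolding newton_poly_def by (auto intro: order_trans)

lemma rvec_in_newton_poly: "b \<in> B \<Longrightarrow> rvec b \<in> newton_poly B"
  unfolding newton_poly_def by (auto intro!: bexI[of _ "rvec b"] hull_inc)

lemma inner_le_nonneg:
  fixes w x y :: "real ^ 'n"
  assumes "\<And>i. 0 \<le> w $ i" "\<And>i. x $ i \<le> y $ i"
  shows "w \<bullet> x \<le> w \<bullet> y"
  unfolding inner_vec_def by (intro sum_mono) (auto intro: mult_left_mono assms)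

text \<open>With a negative entry \<open>w $ i\<close>, moving \<open>x\<close> far along the
  \<open>i\<close>-th axis would stay in \<open>S\<close> and push \<open>w \<bullet> x\<close>
  below \<open>b\<close>.\<close>

lemma upclosed_normal_nonneg:
  fixes w :: "real ^ 'n"
  assumes "x \<in> S" "\<And>x y. x \<in> S \<Longrightarrow> (\<And>i. x $ i \<le> y $ i) \<Longrightarrow> y \<in> S" "\<And>y. y \<in> S \<Longrightarrow> b \<le> w \<bullet> y"
  shows "0 \<le> w $ i"
proof (rule ccontr)
  assume neg: "\<not> 0 \<le> w $ i"
  define t where "t = (\<bar>w \<bullet> x - b\<bar> + 1) / (- (w $ i))"
  have "t > 0" using neg by (auto simp: t_def divide_simps)
  then have "x + t *\<^sub>R axis i 1 \<in> S"
    by (intro assms(2)[OF assms(1)]) (auto simp: axis_def)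
  from assms(3)[OF this] have "b \<le> w \<bullet> x + t * (w $ i)"
    by (simp add: inner_right_distrib inner_axis)
  moreover have "t * (w $ i) = - (\<bar>w \<bullet> x - b\<bar> + 1)" using neg by (simp add: t_def)
  ultimately show False by linarith
qed

lemma newton_poly_separate:
  assumes "finite B" "B \<noteq> {}" "x \<notin> newton_poly B"
  obtains w b where "w \<noteq> 0" "\<And>i. 0 \<le> w $ i" "w \<bullet> x < b" "\<And>y. y \<in> newton_poly B \<Longrightarrow> b < w \<bullet> y"
proof -
  from separating_hyperplane_closed_point[OF convex_newton_poly closed_newton_poly[OF assms(1)] assms(3)]
  obtain w b where wb: "w \<bullet> x < b" "\<And>y. y \<in> newton_poly B \<Longrightarrow> w \<bullet> y > b" by blast
  obtain c where c: "c \<in> B" using assms(2) by blast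
  have "w \<noteq> 0" using wb(1) wb(2)[OF rvec_in_newton_poly[OF c]] by auto
  moreover have "0 \<le> w $ i" for i
  proof (rule upclosed_normal_nonneg[OF rvec_in_newton_poly[OF c], of b])
    show "\<And>y. y \<in> newton_poly B \<Longrightarrow> b \<le> w \<bullet> y"
      using wb(2) less_imp_le by blast
  qed (rule newton_poly_up)
  ultimately show ?thesis using that wb by blast
qed

lemma newton_poly_support:
  assumes "x \<in> newton_poly B" "\<And>i. 0 \<le> w $ i" "\<And>b. b \<in> B \<Longrightarrow> \<beta> \<le> w \<bullet> rvec b"
  shows "\<beta> \<le> w \<bullet> x"
proof -
  obtain p where p: "p \<in> convex hull (rvec ` B)" "\<forall>i. p $ i \<le> x $ i"
    using assms(1) by (auto simp: newton_poly_def)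
  have "convex hull (rvec ` B) \<subseteq> {p. w \<bullet> p \<ge> \<beta>}"
    by (rule hull_minimal) (auto simp: assms(3) convex_halfspace_ge)
  then have "\<beta> \<le> w \<bullet> p" using p by auto
  also have "\<dots> \<le> w \<bullet> x" using p assms(2) by (intro inner_le_nonneg) auto
  finally show ?thesis .
qed

lemma rational_polyhedron_imp_polyhedron: "rational_polyhedron S \<Longrightarrow> polyhedron S"
  unfolding rational_polyhedron_def polyhedron_def by metis

text \<open>The half-spaces come from the extreme points of the polytope \<open>T\<close> of normalised pairs
  (normal, lower bound), which is itself cut out by rational inequalities.\<close>

lemma rational_polyhedron_newton_poly:
  fixes B :: "('n::finite \<Rightarrow> nat) set"
  assumes "finite B" "B \<noteq> {}"
  shows "rational_polyhedron (newton_poly B)"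
proof -
  define one :: "real ^ 'n" where "one = (\<chi> i. 1)"
  have one: "w \<bullet> one = (\<Sum>i\<in>UNIV. w $ i)" for w :: "real ^ 'n"
    by (simp add: one_def inner_vec_def)
  \<comment> \<open>Normals of total mass 1 and \<open>0 \<le> \<beta>\<close> are the
    normalisations that make \<open>T\<close> bounded. The second one keeps every support value,
    since exponents are nonnegative.\<close>
  define F :: "(((real ^ 'n) \<times> real) \<times> real) set" where
    "F = (\<lambda>i. ((- axis i 1, 0), 0)) ` UNIV \<union> {((one, 0), 1), ((- one, 0), -1), ((0, -1), 0)} \<union>
         (\<lambda>b. ((- rvec b, 1), 0)) ` B"
  define T where "T = {x. \<forall>(a, b)\<in>F. a \<bullet> x \<le> b}"
  have finF: "finite F" using assms by (simp add: F_def)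
  have T_iff: "(w, \<beta>) \<in> T \<longleftrightarrow> (\<forall>i. 0 \<le> w $ i) \<and> (\<Sum>i\<in>UNIV. w $ i) = 1 \<and> 0 \<le> \<beta> \<and> (\<forall>b\<in>B. \<beta> \<le> w \<bullet> rvec b)" for w \<beta>
    by (auto simp: T_def F_def ball_Un inner_commute[of _ w] inner_axis one)
  have T_Int: "T = \<Inter> ((\<lambda>(a, b). {x. a \<bullet> x \<le> b}) ` F)" by (auto simp: T_def)
  have polyT: "polyhedron T"
    unfolding T_Int using finF by (auto intro!: polyhedron_Inter polyhedron_halfspace_le)
  obtain c where c: "c \<in> B" using assms by blast
  have bdd: "bounded T"
  proof -
    have "T \<subseteq> cbox 0 (one, \<Sum>i\<in>UNIV. real (c i))"
    proof
      fix z assume z: "z \<in> T"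
      obtain w \<beta> where wb: "z = (w, \<beta>)" by (cases z)
      have t: "\<forall>i. 0 \<le> w $ i" "(\<Sum>i\<in>UNIV. w $ i) = 1" "0 \<le> \<beta>" "\<beta> \<le> w \<bullet> rvec c"
        using z c unfolding wb T_iff by auto
      have le1: "w $ i \<le> 1" for i
        using member_le_sum[of i UNIV "\<lambda>i. w $ i"] t(1,2) by auto
      have "w \<bullet> rvec c \<le> (\<Sum>i\<in>UNIV. real (c i))"
        unfolding inner_vec_def using le1 t(1) by (intro sum_mono) (auto intro: mult_left_le_one_le)
      then show "z \<in> cbox 0 (one, \<Sum>i\<in>UNIV. real (c i))"
        using t le1 by (auto simp: wb cbox_Pair_eq zero_prod_def mem_box_cart one_def)
    qed
    then show ?thesis using bounded_cbox bounded_subset by blast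
  qed
  define E where "E = {x. x extreme_point_of T}"
  have finE: "finite E" unfolding E_def by (rule finite_polyhedron_extreme_points[OF polyT])
  have TE: "T = convex hull E"
    unfolding E_def using polyT bdd
    by (intro Krein_Milman_Minkowski)
       (auto simp: polyhedron_imp_convex polyhedron_imp_closed compact_eq_bounded_closed)
  have ET: "E \<subseteq> T" by (auto simp: E_def extreme_point_of_def)
  have ratE: "(\<forall>i. w $ i \<in> \<rat>) \<and> \<beta> \<in> \<rat>" if "(w, \<beta>) \<in> E" for w \<beta>
  proof -
    have *: "(w, \<beta>) \<bullet> i \<in> \<rat>" if "i \<in> Basis" for i
    proof (rule extreme_point_rational[OF finF T_def _ _ that])
      fix a b assume ab: "(a, b) \<in> F"
      have "(x :: real ^ 'n) \<bullet> j \<in> \<rat>" if "\<And>i. x $ i \<in> \<rat>" "j \<in> Basis" for x j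
        using that by (auto simp: Basis_vec_def inner_axis)
      moreover have "axis j (1::real) $ i \<in> \<rat>" for i j :: 'n
        by (simp add: axis_def)
      ultimately show "(\<forall>i\<in>Basis. a \<bullet> i \<in> \<rat>) \<and> b \<in> \<rat>"
        using ab by (auto simp: F_def Basis_prod_def one_def)
    qed (use \<open>(w, \<beta>) \<in> E\<close> E_def in auto)
    have "w $ i \<in> \<rat>" for i
      using *[of "(axis i 1, 0)"] by (simp add: Basis_prod_def inner_axis)
    moreover have "\<beta> \<in> \<rat>" using *[of "(0, 1)"] by (auto simp: Basis_prod_def)
    ultimately show ?thesis by blast
  qed
  define H where "H = (\<lambda>(w, \<beta>). {x :: real ^ 'n. (- w) \<bullet> x \<le> - \<beta>}) ` E"
  have "newton_poly B = \<Inter> H"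
  proof (intro set_eqI iffI)
    fix x assume x: "x \<in> newton_poly B"
    have "\<beta> \<le> w \<bullet> x" if "(w, \<beta>) \<in> E" for w \<beta>
    proof -
      have "(w, \<beta>) \<in> T" using that ET by blast
      then show ?thesis unfolding T_iff by (intro newton_poly_support[OF x]) auto
    qed
    then show "x \<in> \<Inter> H" by (auto simp: H_def)
  next
    fix x assume x: "x \<in> \<Inter> H"
    show "x \<in> newton_poly B"
    proof (rule ccontr)
      assume "x \<notin> newton_poly B"
      from newton_poly_separate[OF assms this] obtain w b where
        w: "w \<noteq> 0" "\<And>i. 0 \<le> w $ i" "w \<bullet> x < b" "\<And>y. y \<in> newton_poly B \<Longrightarrow> b < w \<bullet> y" by blast
      define s where "s = (\<Sum>i\<in>UNIV. w $ i)"
      have s: "s > 0"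
      proof -
        from w(1) obtain i where "w $ i \<noteq> 0" by (auto simp: vec_eq_iff)
        with w(2)[of i] have "w $ i > 0" by linarith
        then show ?thesis unfolding s_def using w(2) by (intro sum_pos2[of _ i]) auto
      qed
      \<comment> \<open>The best lower bound in the direction \<open>w / s\<close>, so that the
        rescaled pair still belongs to \<open>T\<close>.\<close>
      define \<beta> where "\<beta> = Min ((\<lambda>c. (w \<bullet> rvec c) / s) ` B)"
      have \<beta>: "\<beta> \<in> (\<lambda>c. (w \<bullet> rvec c) / s) ` B" unfolding \<beta>_def using assms by (intro Min_in) auto
      have nn: "0 \<le> w \<bullet> rvec c" for c using w(2) by (auto simp: inner_vec_def intro!: sum_nonneg)
      have "((1/s) *\<^sub>R w, \<beta>) \<in> T"
        unfolding T_iff using \<beta> nn w(2) s assms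
        by (auto simp: s_def[symmetric] sum_divide_distrib[symmetric] \<beta>_def intro!: Min_le divide_nonneg_pos)
      \<comment> \<open>The condition on \<open>x\<close> is linear in the pair, hence passes from
        the extreme points to all of \<open>T\<close>.\<close>
      moreover have "T \<subseteq> {z. (x, -1) \<bullet> z \<ge> 0}"
        unfolding TE using x
        by (intro hull_minimal convex_halfspace_ge) (auto simp: H_def inner_commute)
      ultimately have "\<beta> \<le> x \<bullet> ((1/s) *\<^sub>R w)" by auto
      then have le: "\<beta> * s \<le> w \<bullet> x" using s by (simp add: inner_commute field_simps)
      from \<beta> obtain c where "c \<in> B" "\<beta> = (w \<bullet> rvec c) / s" by auto
      then have "b < \<beta> * s" using w(4)[OF rvec_in_newton_poly] s by auto
      with le w(3) show False by linarith
    qed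
  qed
  moreover have "finite H" by (simp add: H_def finE)
  moreover have "\<exists>a b. a \<noteq> 0 \<and> (\<forall>i. a $ i \<in> \<rat>) \<and> b \<in> \<rat> \<and> h = {x. a \<bullet> x \<le> b}" if "h \<in> H" for h
  proof -
    from that obtain w \<beta> where h: "(w, \<beta>) \<in> E" "h = {x. (- w) \<bullet> x \<le> - \<beta>}" by (auto simp: H_def)
    have "(w, \<beta>) \<in> T" using h ET by blast
    then have "w \<noteq> 0" unfolding T_iff by auto
    with h ratE[OF h(1)] show ?thesis by (intro exI[of _ "- w"] exI[of _ "- \<beta>"]) auto
  qed
  ultimately show ?thesis unfolding rational_polyhedron_def by (intro exI[of _ H]) simp
qed

text \<open>If the point were outside, let \<open>y\<close> recede along \<open>- w\<close> for a
  separating normal \<open>w\<close>: both sides of the bound are then controlled by affine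
  functions of \<open>t\<close> whose slopes are in the wrong order. This is how upper bounds on a
  function confine its Newton body to a polyhedron.\<close>

lemma newton_poly_dominated:
  fixes x :: "real ^ 'n"
  assumes B: "finite B" "B \<noteq> {}" and k: "\<kappa> > 0"
    and le: "\<And>y :: real ^ 'n. (\<And>i. y $ i < L) \<Longrightarrow> x \<bullet> y \<le> \<kappa> * Max ((\<lambda>b. rvec b \<bullet> y) ` B) + C"
  shows "(1 / \<kappa>) *\<^sub>R x \<in> newton_poly B"
proof (rule ccontr)
  assume "(1 / \<kappa>) *\<^sub>R x \<notin> newton_poly B"
  from newton_poly_separate[OF B this] obtain w b where
    w: "w \<noteq> 0" "\<And>i. 0 \<le> w $ i" "w \<bullet> ((1 / \<kappa>) *\<^sub>R x) < b" "\<And>y. y \<in> newton_poly B \<Longrightarrow> b < w \<bullet> y"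
    by blast
  \<comment> \<open>The point with all coordinates \<open>- M\<close> lies below \<open>L\<close>,
    and subtracting a nonnegative multiple of \<open>w\<close> keeps it there.\<close>
  define M where "M = \<bar>L\<bar> + 1"
  define one :: "real ^ 'n" where "one = (\<chi> i. 1)"
  have ineq: "t * (\<kappa> * b - w \<bullet> x) \<le> C + M * (x \<bullet> one)" if t: "t \<ge> 0" for t
  proof -
    define y where "y = - (M *\<^sub>R one) - t *\<^sub>R w"
    have "y $ i < L" for i
    proof -
      have "0 \<le> t * w $ i" using t w(2) by simp
      then show ?thesis by (simp add: y_def M_def one_def)
    qed
    from le[OF this] have "x \<bullet> y \<le> \<kappa> * Max ((\<lambda>b. rvec b \<bullet> y) ` B) + C" .
    moreover have "Max ((\<lambda>b. rvec b \<bullet> y) ` B) \<le> - (t * b)"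
    proof (rule Max.boundedI)
      fix a assume "a \<in> (\<lambda>b. rvec b \<bullet> y) ` B"
      then obtain c where c: "c \<in> B" "a = rvec c \<bullet> y" by auto
      have "0 \<le> rvec c \<bullet> one" by (auto simp: inner_vec_def one_def intro!: sum_nonneg)
      then have "0 \<le> M * (rvec c \<bullet> one)" by (simp add: M_def)
      moreover have "t * b \<le> t * (w \<bullet> rvec c)"
        using w(4)[OF rvec_in_newton_poly[OF c(1)]] t by (intro mult_left_mono) auto
      ultimately show "a \<le> - (t * b)"
        by (simp add: c y_def inner_diff_right inner_commute)
    qed (use B in auto)
    then have "\<kappa> * Max ((\<lambda>b. rvec b \<bullet> y) ` B) \<le> \<kappa> * (- (t * b))" using k by (intro mult_left_mono) auto
    ultimately have "x \<bullet> y \<le> \<kappa> * (- (t * b)) + C" by linarith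
    then show ?thesis by (simp add: y_def inner_diff_right inner_commute algebra_simps)
  qed
  have pos: "\<kappa> * b - w \<bullet> x > 0" using w(3) k by (simp add: field_simps)
  define D where "D = C + M * (x \<bullet> one)"
  have "(\<bar>D\<bar> + 1) / (\<kappa> * b - w \<bullet> x) * (\<kappa> * b - w \<bullet> x) \<le> D"
    by (rule ineq[folded D_def]) (use pos in auto)
  then show False using pos by simp
qed

lemma common_denominator:
  assumes "finite S" "S \<subseteq> \<rat>"
  shows "\<exists>d::nat. d > 0 \<and> (\<forall>x\<in>S. real d * x \<in> \<int>)"
  using assms
proof (induction S)
  case empty
  then show ?case by (auto intro: exI[of _ 1])
next
  case (insert x S)
  then obtain d where d: "d > 0" "\<forall>x\<in>S. real d * x \<in> \<int>" by auto
  from insert.prems have "x \<in> \<rat>" by auto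
  then obtain p q where q: "q > 0" "x = of_int p / of_int q" by (auto elim: Rats_cases')
  define e where "e = nat q"
  have e: "e > 0" "real e * x = of_int p" using q by (auto simp: e_def)
  have "real (d * e) * y \<in> \<int>" if "y \<in> insert x S" for y
  proof (cases "y = x")
    case True
    have "real (d * e) * y = of_int (int d * p)" using e True by (simp add: mult.assoc)
    then show ?thesis using Ints_of_int by metis
  next
    case False
    then have "real d * y \<in> \<int>" using that d by auto
    then have "of_nat e * (real d * y) \<in> \<int>" using Ints_mult[OF Ints_of_nat] by blast
    moreover have "real (d * e) * y = of_nat e * (real d * y)" by simp
    ultimately show ?thesis by (simp only:)
  qed
  then show ?case using d e by (intro exI[of _ "d * e"]) auto
qed

text \<open>All normals of \<open>Q\<close> have nonpositive entries, hence truncating the coordinates of a point of \<open>Q\<close>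
  at a large \<open>N\<close> stays in \<open>Q\<close>; this reduces \<open>Q\<close> to the rational polytope \<open>Q \<inter> [0, N]\<^sup>n\<close>.\<close>

lemma rational_polyhedron_eq_newton_poly:
  fixes Q :: "(real ^ 'n) set"
  assumes rat: "rational_polyhedron Q" and nn: "Q \<subseteq> nonneg_orthant" and ne: "Q \<noteq> {}"
    and up: "\<And>x y. x \<in> Q \<Longrightarrow> (\<And>i. x $ i \<le> y $ i) \<Longrightarrow> y \<in> Q"
  obtains d :: real and B where "0 < d" "finite B" "B \<noteq> {}" "Q = (\<lambda>x. (1 / d) *\<^sub>R x) ` newton_poly B"
proof -
  from rat obtain H where H: "finite H" "Q = \<Inter> H"
    "\<forall>h\<in>H. \<exists>a b. a \<noteq> 0 \<and> (\<forall>i. a $ i \<in> \<rat>) \<and> b \<in> \<rat> \<and> h = {x. a \<bullet> x \<le> b}"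
    unfolding rational_polyhedron_def by blast
  then obtain a b where ab: "\<And>h. h \<in> H \<Longrightarrow> (\<forall>i. a h $ i \<in> \<rat>) \<and> b h \<in> \<rat> \<and> h = {x. a h \<bullet> x \<le> b h}"
    by metis
  have Q_iff: "x \<in> Q \<longleftrightarrow> (\<forall>h\<in>H. a h \<bullet> x \<le> b h)" for x
    using ab H(2) by blast
  obtain q where q: "q \<in> Q" using ne by blast
  have neg: "a h $ i \<le> 0" if h: "h \<in> H" for h i
  proof -
    have "0 \<le> (- a h) $ i"
      by (rule upclosed_normal_nonneg[where S = Q and b = "- b h"]) (use q up h Q_iff in auto)
    then show ?thesis by simp
  qed
  \<comment> \<open>A coordinate beyond \<open>\<bar>b h\<bar> / \<bar>a h $ i\<bar>\<close>, where
    \<open>a h $ i\<close> is nonzero, satisfies the constraint \<open>h\<close> by itself, as the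
    other terms are nonpositive. Vanishing entries contribute 0 by division by zero.\<close>
  define N where "N = Max (insert 1 ((\<lambda>(h, i). \<bar>b h\<bar> / \<bar>a h $ i\<bar>) ` (H \<times> UNIV)))"
  obtain N' :: nat where N': "N \<le> real N'" using real_arch_simple by blast
  have finS: "finite (insert 1 ((\<lambda>(h, i). \<bar>b h\<bar> / \<bar>a h $ i\<bar>) ` (H \<times> (UNIV::'n set))))" using H(1) by simp
  have N'_ge: "\<bar>b h\<bar> / \<bar>a h $ i\<bar> \<le> real N'" if "h \<in> H" for h i
  proof -
    have "\<bar>b h\<bar> / \<bar>a h $ i\<bar> \<le> N" unfolding N_def
      using that by (intro Max_ge[OF finS]) force
    then show ?thesis using N' by linarith
  qed
  have trunc: "(\<chi> i. min (x $ i) (real N')) \<in> Q" if x: "x \<in> Q" for x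
    unfolding Q_iff
  proof
    fix h assume h: "h \<in> H"
    show "a h \<bullet> (\<chi> i. min (x $ i) (real N')) \<le> b h"
    proof (cases "\<exists>i. a h $ i \<noteq> 0 \<and> real N' < x $ i")
      case False
      then have "a h $ i * min (x $ i) (real N') = a h $ i * x $ i" for i
        by (cases "a h $ i = 0") (auto simp: min_def not_less)
      then have "a h \<bullet> (\<chi> i. min (x $ i) (real N')) = a h \<bullet> x"
        unfolding inner_vec_def by (intro sum.cong) auto
      then show ?thesis using x h Q_iff by auto
    next
      case True
      then obtain i where i: "a h $ i \<noteq> 0" "real N' < x $ i" by blast
      have xn: "0 \<le> x $ j" for j using x nn by (auto simp: nonneg_orthant_def)
      have "a h \<bullet> (\<chi> i. min (x $ i) (real N')) = a h $ i * real N' + (\<Sum>j\<in>UNIV - {i}. a h $ j * min (x $ j) (real N'))"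
        unfolding inner_vec_def using i by (simp add: sum.remove[of UNIV i])
      also have "(\<Sum>j\<in>UNIV - {i}. a h $ j * min (x $ j) (real N')) \<le> 0"
        using neg[OF h] xn by (intro sum_nonpos mult_nonpos_nonneg) auto
      also have "a h $ i * real N' \<le> - \<bar>b h\<bar>"
        using N'_ge[OF h, of i] neg[OF h, of i] i(1) by (simp add: field_simps)
      finally show ?thesis by linarith
    qed
  qed
  define F :: "((real ^ 'n) \<times> real) set" where
    "F = (\<lambda>h. (a h, b h)) ` H \<union> (\<lambda>i. (axis i 1, real N')) ` UNIV"
  have finF: "finite F" using H(1) by (simp add: F_def)
  define T where "T = {x. \<forall>(a, b)\<in>F. a \<bullet> x \<le> b}"
  have T_iff: "x \<in> T \<longleftrightarrow> x \<in> Q \<and> (\<forall>i. x $ i \<le> real N')" for x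
    by (auto simp: T_def F_def ball_Un Q_iff inner_commute[of _ x] inner_axis)
  have polyT: "polyhedron T"
  proof -
    have "T = \<Inter> ((\<lambda>(a, b). {x. a \<bullet> x \<le> b}) ` F)" by (auto simp: T_def)
    then show ?thesis using finF by (auto intro!: polyhedron_Inter polyhedron_halfspace_le)
  qed
  have bdd: "bounded T"
  proof (rule bounded_subset)
    show "T \<subseteq> cbox 0 (\<chi> i. real N')"
      using nn by (auto simp: T_iff mem_box_cart nonneg_orthant_def)
  qed (rule bounded_cbox)
  define E where "E = {x. x extreme_point_of T}"
  have finE: "finite E" unfolding E_def by (rule finite_polyhedron_extreme_points[OF polyT])
  have TE: "T = convex hull E"
    unfolding E_def using polyT bdd
    by (intro Krein_Milman_Minkowski)
       (auto simp: polyhedron_imp_convex polyhedron_imp_closed compact_eq_bounded_closed)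
  have ET: "E \<subseteq> T" by (auto simp: E_def extreme_point_of_def)
  have ratE: "w $ i \<in> \<rat>" if "w \<in> E" for w i
  proof -
    have "w \<bullet> axis i 1 \<in> \<rat>"
    proof (rule extreme_point_rational[OF finF T_def])
      fix u v assume "(u, v) \<in> F"
      moreover have "axis j 1 $ i \<in> \<rat>" for i j :: 'n
        by (simp add: axis_def)
      ultimately show "(\<forall>i\<in>Basis. u \<bullet> i \<in> \<rat>) \<and> v \<in> \<rat>"
        using ab by (auto simp: F_def Basis_vec_def inner_axis)
    qed (use that E_def in auto)
    then show ?thesis by (simp add: inner_axis)
  qed
  have "E \<noteq> {}"
  proof
    assume "E = {}"
    then have "T = {}" using TE by simp
    moreover have "(\<chi> i. min (q $ i) (real N')) \<in> T" using trunc[OF q] unfolding T_iff by simp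
    ultimately show False by simp
  qed
  obtain d where d: "d > 0" "\<forall>x\<in>(\<lambda>(w, i). w $ i) ` (E \<times> UNIV). real d * x \<in> \<int>"
  proof -
    have "finite ((\<lambda>(w, i). w $ i) ` (E \<times> (UNIV :: 'n set)))" "(\<lambda>(w, i). w $ i) ` (E \<times> UNIV) \<subseteq> \<rat>"
      using finE ratE by auto
    from common_denominator[OF this] show thesis using that by blast
  qed
  \<comment> \<open>\<open>d\<close> clears the denominators of all vertices of \<open>T\<close>, so
    the floor is exact and \<open>B\<close> is the vertex set scaled by \<open>d\<close>.\<close>
  define B where "B = (\<lambda>w i. nat \<lfloor>real d * w $ i\<rfloor>) ` E"
  have rv: "rvec (\<lambda>i. nat \<lfloor>real d * w $ i\<rfloor>) = real d *\<^sub>R w" if w: "w \<in> E" for w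
  proof -
    have "real (nat \<lfloor>real d * w $ i\<rfloor>) = real d * w $ i" for i
    proof -
      have "w \<in> Q" using w ET T_iff by blast
      then have "0 \<le> w $ i" using nn by (auto simp: nonneg_orthant_def)
      moreover have "real d * w $ i \<in> \<int>" using d(2) w by force
      ultimately show ?thesis by (auto elim!: Ints_cases)
    qed
    then show ?thesis by (simp add: vec_eq_iff)
  qed
  have rvB: "rvec ` B = (\<lambda>x. real d *\<^sub>R x) ` E"
    unfolding B_def image_image by (intro image_cong) (auto simp: rv)
  have hull: "convex hull (rvec ` B) = (\<lambda>x. real d *\<^sub>R x) ` T"
    unfolding rvB TE by (rule convex_hull_scaling)
  have "Q = (\<lambda>x. (1 / real d) *\<^sub>R x) ` newton_poly B"
  proof (intro set_eqI iffI)
    fix x assume x: "x \<in> Q"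
    have "real d *\<^sub>R x \<in> newton_poly B"
      unfolding newton_poly_def hull using trunc[OF x] d(1)
      by (auto simp: T_iff intro!: bexI[of _ "\<chi> i. min (x $ i) (real N')"])
    then show "x \<in> (\<lambda>x. (1 / real d) *\<^sub>R x) ` newton_poly B"
      using d(1) by (intro image_eqI[of _ _ "real d *\<^sub>R x"]) auto
  next
    fix x assume "x \<in> (\<lambda>x. (1 / real d) *\<^sub>R x) ` newton_poly B"
    then obtain p t where p: "x = (1 / real d) *\<^sub>R p" "t \<in> T" "\<forall>i. real d * t $ i \<le> p $ i"
      unfolding newton_poly_def hull by auto
    have "t \<in> Q" using p T_iff by blast
    then show "x \<in> Q" using p(3) d(1) by (rule_tac up[of t]) (auto simp: p(1) field_simps)
  qed
  moreover have "finite B" "B \<noteq> {}" using finE \<open>E \<noteq> {}\<close> by (auto simp: B_def)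
  ultimately show ?thesis using that[of "real d" B] d(1) by auto
qed

section \<open>Well-quasi-ordering of exponents\<close>

lemma nat_seq_incseq_subseq:
  fixes f :: "nat \<Rightarrow> nat"
  obtains r where "strict_mono r" "incseq (f \<circ> r)"
proof -
  obtain r where r: "strict_mono r" "monoseq (f \<circ> r)"
    using seq_monosub[of f] by (auto simp: comp_def)
  show ?thesis
  proof (cases "incseq (f \<circ> r)")
    case True
    then show ?thesis using that r by blast
  next
    case False
    \<comment> \<open>A decreasing sequence of naturals is constant from the index of its least
      value on.\<close>
    then have dec: "decseq (f \<circ> r)" using r(2) monoseq_iff by blast
    obtain k where k: "\<And>j. f (r k) \<le> f (r j)"
      using ex_has_least_nat[of "\<lambda>_. True" 0 "\<lambda>k. f (r k)"] by auto
    have "f (r (k + j)) = f (r k)" for j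
      using k[of "k + j"] decseqD[OF dec, of k "k + j"] by simp
    then have "incseq (f \<circ> (\<lambda>j. r (k + j)))" by (simp add: incseq_def)
    moreover have "strict_mono (\<lambda>j. r (k + j))"
      using r(1) by (auto simp: strict_mono_def)
    ultimately show ?thesis using that by blast
  qed
qed

lemma multi_nat_seq_incseq_subseq:
  fixes s :: "nat \<Rightarrow> 'n \<Rightarrow> nat"
  assumes "finite S"
  shows "\<exists>r. strict_mono r \<and> (\<forall>i\<in>S. incseq (\<lambda>k. s (r k) i))"
  using assms
proof (induction S)
  case empty
  then show ?case by (auto intro!: exI[of _ id] simp: strict_mono_def)
next
  case (insert x S)
  then obtain r where r: "strict_mono r" "\<forall>i\<in>S. incseq (\<lambda>k. s (r k) i)" by auto
  obtain r' where r': "strict_mono r'" "incseq ((\<lambda>k. s (r k) x) \<circ> r')"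
    using nat_seq_incseq_subseq by blast
  have "incseq (\<lambda>k. s (r (r' k)) i)" if "i \<in> S" for i
    using r(2) that r'(1) by (auto simp: incseq_def strict_mono_less_eq)
  moreover have "incseq (\<lambda>k. s (r (r' k)) x)" using r'(2) by (simp add: comp_def)
  ultimately show ?case using r r'
    by (intro exI[of _ "r \<circ> r'"]) (auto simp: strict_mono_def)
qed

text \<open>A form of Dickson's lemma.\<close>

lemma upclosed_truncation:
  fixes A :: "('n::finite \<Rightarrow> nat) set"
  assumes up: "\<And>a b. a \<in> A \<Longrightarrow> a \<le> b \<Longrightarrow> b \<in> A"
  obtains N where "\<And>a. a \<in> A \<Longrightarrow> (\<lambda>i. min (a i) N) \<in> A"
proof (rule ccontr)
  assume "\<not> thesis"
  then have "\<forall>N. \<exists>a. a \<in> A \<and> (\<lambda>i. min (a i) N) \<notin> A" using that by blast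
  then obtain a where a: "\<And>N. a N \<in> A" "\<And>N. (\<lambda>i. min (a N i) N) \<notin> A" by metis
  \<comment> \<open>Each threshold bounds the coordinates of the previous counterexample. Along an
    increasing subsequence an earlier counterexample then lies below the truncation of a later one,
    which forces that truncation into \<open>A\<close>.\<close>
  define M where "M = rec_nat 0 (\<lambda>_ m. Max (insert m (range (a m))))"
  have M_Suc: "M (Suc k) = Max (insert (M k) (range (a (M k))))" for k by (simp add: M_def)
  have M1: "M k \<le> M (Suc k)" "a (M k) i \<le> M (Suc k)" for k i
    unfolding M_Suc by (rule Max_ge; simp)+
  have "incseq M" using M1(1) by (rule incseq_SucI)
  obtain r where r: "strict_mono r" "\<forall>i. incseq (\<lambda>k. a (M (r k)) i)"
    using multi_nat_seq_incseq_subseq[of UNIV "\<lambda>k. a (M k)"] by auto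
  have "a (M (r 0)) i \<le> min (a (M (r 1)) i) (M (r 1))" for i
  proof -
    have "a (M (r 0)) i \<le> a (M (r 1)) i" using r(2) by (auto simp: incseq_def)
    moreover have "Suc (r 0) \<le> r 1" using r(1) by (simp add: strict_mono_def Suc_leI)
    then have "M (Suc (r 0)) \<le> M (r 1)" using \<open>incseq M\<close> by (simp add: incseqD)
    then have "a (M (r 0)) i \<le> M (r 1)" using M1(2) order_trans by blast
    ultimately show ?thesis by simp
  qed
  then have "a (M (r 0)) \<le> (\<lambda>i. min (a (M (r 1)) i) (M (r 1)))" by (simp add: le_fun_def)
  from up[OF a(1) this] a(2) show False by blast
qed

subsection \<open>Mean values on circles\<close>

abbreviation circle_int :: "(real \<Rightarrow> real) \<Rightarrow> real" where
  "circle_int f \<equiv> (LINT t:{0..2*pi}|lborel. f t)"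

abbreviation circle_integrable :: "(real \<Rightarrow> real) \<Rightarrow> bool" where
  "circle_integrable f \<equiv> set_integrable lborel {0..2*pi} f"

lemma ereal_circle_int:
  assumes "circle_integrable f"
  shows "ereal_int_circle (\<lambda>t. ereal (f t)) = ereal (circle_int f)"
    and "(\<integral>\<^sup>+ t. ennreal (f t) * indicator {0..2*pi} t \<partial>lborel) < \<infinity>"
    and "(\<integral>\<^sup>+ t. ennreal (- f t) * indicator {0..2*pi} t \<partial>lborel) < \<infinity>"
proof -
  let ?g = "\<lambda>t. indicator {0..2*pi} t *\<^sub>R f t"
  have g: "integrable lborel ?g" using assms by (simp add: set_integrable_def)
  have eq: "ennreal (?g t) = ennreal (f t) * indicator {0..2*pi} t"
           "ennreal (- ?g t) = ennreal (- f t) * indicator {0..2*pi} t" for t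
    by (auto simp: indicator_def)
  from g have fin: "(\<integral>\<^sup>+ t. ennreal (?g t) \<partial>lborel) \<noteq> \<infinity>" "(\<integral>\<^sup>+ t. ennreal (- ?g t) \<partial>lborel) \<noteq> \<infinity>"
    unfolding real_integrable_def by auto
  then show "(\<integral>\<^sup>+ t. ennreal (f t) * indicator {0..2*pi} t \<partial>lborel) < \<infinity>"
    "(\<integral>\<^sup>+ t. ennreal (- f t) * indicator {0..2*pi} t \<partial>lborel) < \<infinity>"
    unfolding eq by (auto simp: less_top)
  have "circle_int f = enn2real (\<integral>\<^sup>+ t. ennreal (?g t) \<partial>lborel) - enn2real (\<integral>\<^sup>+ t. ennreal (- ?g t) \<partial>lborel)"
    unfolding set_lebesgue_integral_def by (rule real_lebesgue_integral_def[OF g])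
  then have "ereal (circle_int f) = ereal (enn2real (\<integral>\<^sup>+ t. ennreal (?g t) \<partial>lborel)) - ereal (enn2real (\<integral>\<^sup>+ t. ennreal (- ?g t) \<partial>lborel))"
    by simp
  also have "ereal (enn2real (\<integral>\<^sup>+ t. ennreal (?g t) \<partial>lborel)) = enn2ereal (\<integral>\<^sup>+ t. ennreal (?g t) \<partial>lborel)"
    using fin(1) by (cases "\<integral>\<^sup>+ t. ennreal (?g t) \<partial>lborel") (auto simp: enn2ereal_ennreal)
  also have "ereal (enn2real (\<integral>\<^sup>+ t. ennreal (- ?g t) \<partial>lborel)) = enn2ereal (\<integral>\<^sup>+ t. ennreal (- ?g t) \<partial>lborel)"
    using fin(2) by (cases "\<integral>\<^sup>+ t. ennreal (- ?g t) \<partial>lborel") (auto simp: enn2ereal_ennreal)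
  finally show "ereal_int_circle (\<lambda>t. ereal (f t)) = ereal (circle_int f)"
    unfolding eq ereal_int_circle_def by (simp flip: ennreal.abs_eq)
qed

lemma ereal_int_circle_mono:
  assumes "AE t in lborel. t \<in> {0..2*pi} \<longrightarrow> u t \<le> v t"
  shows "ereal_int_circle u \<le> ereal_int_circle v"
  unfolding ereal_int_circle_def
proof (intro ereal_minus_mono)
  show "enn2ereal (\<integral>\<^sup>+ t. e2ennreal (u t) * indicator {0..2*pi} t \<partial>lborel)
    \<le> enn2ereal (\<integral>\<^sup>+ t. e2ennreal (v t) * indicator {0..2*pi} t \<partial>lborel)"
    unfolding less_eq_ennreal.rep_eq[symmetric] using assms
    by (intro nn_integral_mono_AE) (auto elim!: eventually_mono simp: indicator_def intro: e2ennreal_mono)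
  show "enn2ereal (\<integral>\<^sup>+ t. e2ennreal (- v t) * indicator {0..2*pi} t \<partial>lborel)
    \<le> enn2ereal (\<integral>\<^sup>+ t. e2ennreal (- u t) * indicator {0..2*pi} t \<partial>lborel)"
    unfolding less_eq_ennreal.rep_eq[symmetric] using assms
    by (intro nn_integral_mono_AE) (auto elim!: eventually_mono simp: indicator_def intro: e2ennreal_mono)
qed

lemma circle_integrable_continuous:
  "continuous_on {0..2*pi} f \<Longrightarrow> circle_integrable f"
  by (rule borel_integrable_atLeastAtMost')

text \<open>After division by \<open>a\<close> the integrand is the real part of
  \<open>Ln (1 + u * c)\<close>, holomorphic on a disc larger than the unit disc; Cauchy's formula
  at the centre gives the mean.\<close>

lemma ln_circle_mean_less:
  assumes ab: "cmod b < cmod a"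
  shows "circle_integrable (\<lambda>t. ln (cmod (a + cis t * b)))"
    and "circle_int (\<lambda>t. ln (cmod (a + cis t * b))) = 2 * pi * ln (cmod a)"
proof -
  have a: "a \<noteq> 0" using ab by auto
  have nz: "a + cis t * b \<noteq> 0" for t
  proof
    assume "a + cis t * b = 0"
    then have "a = - (cis t * b)" by (simp add: eq_neg_iff_add_eq_0)
    then have "cmod a = cmod (cis t * b)" by (metis norm_minus_cancel)
    then show False using ab by (simp add: norm_mult)
  qed
  show int: "circle_integrable (\<lambda>t. ln (cmod (a + cis t * b)))"
    by (intro circle_integrable_continuous continuous_intros) (use nz in auto)
  define c where "c = b / a"
  have c: "cmod c < 1" using ab a by (simp add: c_def norm_divide)
  define h where "h = (\<lambda>u. Ln (1 + u * c))"
  \<comment> \<open>Within this radius \<open>u * c\<close> has modulus below 1, which keeps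
    \<open>1 + u * c\<close> off the branch cut.\<close>
  define R where "R = (if c = 0 then 2 else 1 / cmod c)"
  have R: "R > 1" using c by (auto simp: R_def)
  have re: "Re (1 + u * c) > 0" if "u \<in> ball 0 R" for u
  proof -
    have "cmod (u * c) < 1"
      using that c by (cases "c = 0") (auto simp: R_def norm_mult field_simps)
    then have "\<bar>Re (u * c)\<bar> < 1" using abs_Re_le_cmod order_le_less_trans by blast
    then show ?thesis by simp
  qed
  have hol: "h holomorphic_on ball 0 R"
    unfolding h_def
    by (intro holomorphic_intros) (use re in \<open>auto simp: complex_nonpos_Reals_iff not_le\<close>)
  have "((\<lambda>u. h u / (u - 0)) has_contour_integral (2 * of_real pi * \<i> * h 0)) (circlepath 0 1)"
    by (rule Cauchy_integral_circlepath[where r = 1])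
       (use hol R in \<open>auto intro!: holomorphic_on_imp_continuous_on elim!: holomorphic_on_subset\<close>)
  then have "((\<lambda>t. h (cis t) / cis t * \<i> * cis t) has_integral 0) {0..2*pi}"
    unfolding circlepath_def by (subst (asm) has_contour_integral_part_circlepath_iff) (auto simp: h_def)
  then have "((\<lambda>t. \<i> * h (cis t)) has_integral 0) {0..2*pi}"
    by (rule has_integral_eq[rotated]) auto
  \<comment> \<open>The value of the integral is 0 because \<open>h 0 = 0\<close>. The factor
    \<open>\<i>\<close> from the parametrised circle turns the real part of \<open>h\<close> into an
    imaginary part.\<close>
  then have "((\<lambda>t. Im (\<i> * h (cis t))) has_integral Im 0) {0..2*pi}"
    by (rule has_integral_Im)
  moreover have "Im (\<i> * h (cis t)) = ln (cmod (a + cis t * b)) - ln (cmod a)" for t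
  proof -
    have n1: "1 + cis t * c \<noteq> 0" using re[of "cis t"] R by (auto simp: complex_eq_iff)
    have "Im (\<i> * h (cis t)) = ln (cmod (1 + cis t * c))" using n1 by (simp add: h_def)
    also have "1 + cis t * c = (a + cis t * b) / a" using a by (simp add: c_def field_simps)
    also have "ln (cmod ((a + cis t * b) / a)) = ln (cmod (a + cis t * b)) - ln (cmod a)"
      using a nz by (simp add: norm_divide ln_div)
    finally show ?thesis .
  qed
  ultimately have "((\<lambda>t. ln (cmod (a + cis t * b)) - ln (cmod a)) has_integral 0) {0..2*pi}" by simp
  from has_integral_add[OF this has_integral_const_real[of "ln (cmod a)" 0 "2*pi"]]
  have "((\<lambda>t. ln (cmod (a + cis t * b))) has_integral (2*pi * ln (cmod a))) {0..2*pi}" by simp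
  then show "circle_int (\<lambda>t. ln (cmod (a + cis t * b))) = 2 * pi * ln (cmod a)"
    using set_borel_integral_eq_integral(2)[OF int] by (simp add: integral_unique)
qed

lemma AE_circle_nonzero:
  assumes "a \<noteq> 0 \<or> b \<noteq> 0"
  shows "AE t in lborel. a + cis t * b \<noteq> 0"
proof (cases "\<exists>s. a + cis s * b = 0")
  case True
  then obtain s where s: "a + cis s * b = 0" by blast
  with assms have b: "b \<noteq> 0" by auto
  have "{t. a + cis t * b = 0} \<subseteq> range (\<lambda>n::int. s + 2 * pi * of_int n)"
  proof
    fix t assume "t \<in> {t. a + cis t * b = 0}"
    then have "a + cis t * b = a + cis s * b" using s by simp
    then have "cis t * b = cis s * b" by simp
    then have "cis t = cis s" using b by simp
    then have "sin t = sin s \<and> cos t = cos s" by (metis cis.sel)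
    then obtain n where "t = s + 2 * pi * of_int n" unfolding sin_cos_eq_iff by blast
    then show "t \<in> range (\<lambda>n::int. s + 2 * pi * of_int n)" by blast
  qed
  then have "countable {t. a + cis t * b = 0}" by (rule countable_subset) simp
  then have "{t. a + cis t * b = 0} \<in> null_sets lborel" by (rule countable_imp_null_set_lborel)
  from AE_not_in[OF this] show ?thesis by simp
next
  case False
  then show ?thesis by auto
qed

lemma measurable_circle [measurable]:
  "(\<lambda>t. a + cis t * b) \<in> borel_measurable borel"
  by (intro borel_measurable_continuous_onI continuous_intros)

text \<open>What is new is the case of equal moduli, where the logarithm can be singular on the
  circle. Shrink \<open>b\<close> by factors \<open>\<rho> n < 1\<close> tending to 1 and apply
  Fatou to the nonnegative functions \<open>M - f n\<close>: integrability and the inequality come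
  out together.\<close>

lemma ln_circle_mean_le:
  assumes ab: "cmod b \<le> cmod a" and a: "a \<noteq> 0"
  shows "circle_integrable (\<lambda>t. ln (cmod (a + cis t * b)))"
    and "2 * pi * ln (cmod a) \<le> circle_int (\<lambda>t. ln (cmod (a + cis t * b)))"
proof -
  define M where "M = ln (2 * cmod a)"
  define \<rho> where "\<rho> n = 1 - inverse (real (n + 2))" for n
  have \<rho>: "0 < \<rho> n" "\<rho> n < 1" for n by (auto simp: \<rho>_def divide_simps)
  define f where "f n t = ln (cmod (a + cis t * (of_real (\<rho> n) * b)))" for n t
  let ?f = "\<lambda>t. ln (cmod (a + cis t * b))"
  have less: "cmod (of_real (\<rho> n) * b) < cmod a" for n
  proof (cases "b = 0")
    case False
    then have "\<rho> n * cmod b < cmod b" using \<rho> by simp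
    then show ?thesis using ab \<rho>(1)[of n] by (simp add: norm_mult)
  qed (use a in auto)
  have ub: "ln (cmod (a + cis t * c)) \<le> M" if "cmod c \<le> cmod a" "a + cis t * c \<noteq> 0" for c t
  proof -
    have "cmod (a + cis t * c) \<le> cmod a + cmod (cis t * c)" by (rule norm_triangle_ineq)
    also have "\<dots> \<le> 2 * cmod a" using that by (simp add: norm_mult)
    finally show ?thesis unfolding M_def using that by (subst ln_le_cancel_iff) auto
  qed
  have nz: "a + cis t * (of_real (\<rho> n) * b) \<noteq> 0" for n t
  proof
    assume "a + cis t * (of_real (\<rho> n) * b) = 0"
    then have "a = - (cis t * (of_real (\<rho> n) * b))" by (simp add: eq_neg_iff_add_eq_0)
    then have "cmod a = cmod (cis t * (of_real (\<rho> n) * b))" by (metis norm_minus_cancel)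
    then show False using less[of n] by (simp add: norm_mult)
  qed
  have fM: "f n t \<le> M" for n t
    unfolding f_def by (rule ub) (use less[of n] nz in auto)
  have int_f: "circle_integrable (f n)" "circle_int (f n) = 2 * pi * ln (cmod a)" for n
    unfolding f_def by (rule ln_circle_mean_less[OF less])+
  have c_int: "circle_integrable (\<lambda>_. M)" by (intro circle_integrable_continuous continuous_intros)
  have c_val: "circle_int (\<lambda>_. M) = 2 * pi * M"
    using set_borel_integral_eq_integral(2)[OF c_int] by simp
  have AEnz: "AE t in lborel. a + cis t * b \<noteq> 0" using a by (intro AE_circle_nonzero) auto
  let ?I = "indicator {0..2*pi} :: real \<Rightarrow> real"
  have "(\<integral>\<^sup>+ t. ennreal (?I t * (M - ?f t)) \<partial>lborel)
        \<le> liminf (\<lambda>n. \<integral>\<^sup>+ t. ennreal (?I t * (M - f n t)) \<partial>lborel)"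
  proof (rule order_trans[OF nn_integral_mono_AE nn_integral_liminf])
    show "AE t in lborel. ennreal (?I t * (M - ?f t)) \<le> liminf (\<lambda>n. ennreal (?I t * (M - f n t)))"
      using AEnz
    proof eventually_elim
      case (elim t)
      have "(\<lambda>n. inverse (real (n + 2))) \<longlonglongrightarrow> 0"
        using LIMSEQ_ignore_initial_segment[OF LIMSEQ_inverse_real_of_nat, of 1] by simp
      then have "\<rho> \<longlonglongrightarrow> 1 - 0" unfolding \<rho>_def
        by (intro tendsto_intros)
      then have "(\<lambda>n. ennreal (?I t * (M - f n t))) \<longlonglongrightarrow> ennreal (?I t * (M - ln (cmod (a + cis t * (of_real 1 * b)))))"
        unfolding f_def using elim by (intro tendsto_intros tendsto_ennrealI) auto
      then show ?case by (simp add: lim_imp_Liminf)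
    qed
    show "(\<lambda>t. ennreal (?I t * (M - f n t))) \<in> borel_measurable lborel" for n
      unfolding f_def by measurable
  qed
  also have "(\<lambda>n. \<integral>\<^sup>+ t. ennreal (?I t * (M - f n t)) \<partial>lborel) = (\<lambda>n. ennreal (2*pi*M - 2 * pi * ln (cmod a)))"
  proof
    fix n
    have i: "circle_integrable (\<lambda>t. M - f n t)"
      by (rule set_integral_diff(1)[OF c_int int_f(1)])
    have "(\<integral>\<^sup>+ t. ennreal (?I t * (M - f n t)) \<partial>lborel) = ennreal (circle_int (\<lambda>t. M - f n t))"
      using i fM unfolding set_lebesgue_integral_def set_integrable_def
      by (subst nn_integral_eq_integral) (auto simp: indicator_def)
    also have "circle_int (\<lambda>t. M - f n t) = 2*pi*M - 2 * pi * ln (cmod a)"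
      by (subst set_integral_diff(2)[OF c_int int_f(1)]) (simp add: c_val int_f(2))
    finally show "(\<integral>\<^sup>+ t. ennreal (?I t * (M - f n t)) \<partial>lborel) = ennreal (2*pi*M - 2 * pi * ln (cmod a))" .
  qed
  finally have le: "(\<integral>\<^sup>+ t. ennreal (?I t * (M - ?f t)) \<partial>lborel) \<le> ennreal (2*pi*M - 2 * pi * ln (cmod a))"
    by (simp add: Liminf_const)
  have nonneg: "AE t in lborel. 0 \<le> ?I t * (M - ?f t)"
    using AEnz by eventually_elim (auto simp: indicator_def intro: ub[OF ab])
  have meas: "(\<lambda>t. ?I t * (M - ?f t)) \<in> borel_measurable lborel" by measurable
  have intd: "integrable lborel (\<lambda>t. ?I t * (M - ?f t))"
    by (rule integrableI_nonneg[OF meas nonneg]) (use le in \<open>auto simp: less_top[symmetric] top_unique intro: le_less_trans\<close>)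
  then have "circle_integrable (\<lambda>t. M - ?f t)" by (simp add: set_integrable_def)
  from set_integral_diff(1)[OF c_int this]
  show int: "circle_integrable ?f" by simp
  have "ennreal (circle_int (\<lambda>t. M - ?f t)) \<le> ennreal (2*pi*M - 2 * pi * ln (cmod a))"
    using le nn_integral_eq_integral[OF intd nonneg] by (simp add: set_lebesgue_integral_def)
  moreover have "0 \<le> 2*pi*M - 2 * pi * ln (cmod a)"
    using a by (simp add: M_def)
  ultimately have "circle_int (\<lambda>t. M - ?f t) \<le> 2*pi*M - 2 * pi * ln (cmod a)"
    by (subst (asm) ennreal_le_iff) auto
  then show "2 * pi * ln (cmod a) \<le> circle_int ?f"
    by (subst (asm) set_integral_diff(2)[OF c_int int]) (simp add: c_val)
qed

text \<open>If \<open>b\<close> is the larger one, multiply by \<open>cis (- t)\<close> and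
  conjugate: the modulus becomes that of \<open>cnj b + cis t * cnj a\<close>, with the two
  coefficients exchanged.\<close>

lemma ln_circle_mean:
  assumes a: "a \<noteq> 0"
  shows "circle_integrable (\<lambda>t. ln (cmod (a + cis t * b)))"
    and "2 * pi * ln (cmod a) \<le> circle_int (\<lambda>t. ln (cmod (a + cis t * b)))"
proof -
  have "circle_integrable (\<lambda>t. ln (cmod (a + cis t * b))) \<and>
        2 * pi * ln (cmod a) \<le> circle_int (\<lambda>t. ln (cmod (a + cis t * b)))"
  proof (cases "cmod b \<le> cmod a")
    case True
    then show ?thesis using ln_circle_mean_le[OF True a] by blast
  next
    case False
    have eq: "cmod (a + cis t * b) = cmod (cnj b + cis t * cnj a)" for t
    proof -
      have "cmod (a + cis t * b) = cmod (cis (- t) * (a + cis t * b))" by (simp add: norm_mult)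
      also have "cis (- t) * (a + cis t * b) = cis (- t) * a + b" by (simp add: algebra_simps cis_mult flip: mult.assoc)
      also have "cmod \<dots> = cmod (cnj \<dots>)" by (rule complex_mod_cnj[symmetric])
      also have "cnj (cis (- t) * a + b) = cnj b + cis t * cnj a" by (simp add: cis_cnj)
      finally show ?thesis .
    qed
    have "cmod (cnj a) \<le> cmod (cnj b)" "cnj b \<noteq> 0" using False by auto
    from ln_circle_mean_le[OF this] have 1: "circle_integrable (\<lambda>t. ln (cmod (a + cis t * b)))"
      and 2: "2 * pi * ln (cmod b) \<le> circle_int (\<lambda>t. ln (cmod (a + cis t * b)))"
      unfolding eq by auto
    have "ln (cmod a) \<le> ln (cmod b)" using False a by (intro ln_mono) auto
    then have "2 * pi * ln (cmod a) \<le> 2 * pi * ln (cmod b)" by (intro mult_left_mono) auto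
    with 1 2 show ?thesis by linarith
  qed
  then show "circle_integrable (\<lambda>t. ln (cmod (a + cis t * b)))"
    and "2 * pi * ln (cmod a) \<le> circle_int (\<lambda>t. ln (cmod (a + cis t * b)))" by auto
qed

subsection \<open>Toric plurisubharmonic functions\<close>

definition vupd :: "'a ^ 'n \<Rightarrow> 'n \<Rightarrow> 'a \<Rightarrow> 'a ^ 'n" where
  "vupd z i c = (\<chi> j. if j = i then c else z $ j)"

lemma vupd_nth: "vupd z i c $ j = (if j = i then c else z $ j)"
  by (simp add: vupd_def)

lemma vupd_same [simp]: "vupd z i c $ i = c" and vupd_other [simp]: "j \<noteq> i \<Longrightarrow> vupd z i c $ j = z $ j"
  by (simp_all add: vupd_nth)

lemma vupd_triv [simp]: "vupd z i (z $ i) = z" and vupd_vupd [simp]: "vupd (vupd z i c) i e = vupd z i e"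
  by (simp_all add: vupd_def vec_eq_iff)

lemma vupd_twist: "i \<noteq> j \<Longrightarrow> vupd (vupd z i c) j e = vupd (vupd z j e) i c"
  by (simp add: vupd_def vec_eq_iff)

lemma usc_attains_max:
  fixes F :: "'a::metric_space \<Rightarrow> ereal"
  assumes K: "compact K" "K \<noteq> {}"
    and usc: "\<And>z c. z \<in> K \<Longrightarrow> F z < c \<Longrightarrow> eventually (\<lambda>w. F w < c) (at z within K)"
  obtains z where "z \<in> K" "\<And>w. w \<in> K \<Longrightarrow> F w \<le> F z"
proof (rule ccontr)
  assume "\<not> thesis"
  then have no: "\<exists>w\<in>K. \<not> F w \<le> F z" if "z \<in> K" for z using that \<open>\<And>z. z \<in> K \<Longrightarrow> (\<And>w. w \<in> K \<Longrightarrow> F w \<le> F z) \<Longrightarrow> thesis\<close> by blast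
  define M where "M = Sup (F ` K)"
  have lt: "F z < M" if z: "z \<in> K" for z
  proof -
    have "F z \<le> M" using z by (auto simp: M_def intro: Sup_upper)
    moreover have "F z \<noteq> M"
    proof
      assume "F z = M"
      then have "F w \<le> F z" if "w \<in> K" for w using that by (auto simp: M_def intro: Sup_upper)
      with no[OF z] show False by blast
    qed
    ultimately show ?thesis by simp
  qed
  have "\<exists>c U. c < M \<and> open U \<and> z \<in> U \<and> (\<forall>w\<in>U \<inter> K. F w < c)" if z: "z \<in> K" for z
  proof -
    obtain c where c: "F z < c" "c < M" using lt[OF z] dense by blast
    from usc[OF z c(1)] obtain U where U: "open U" "z \<in> U" "\<forall>w\<in>U. w \<noteq> z \<longrightarrow> w \<in> K \<longrightarrow> F w < c"
      unfolding eventually_at_topological by blast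
    then show ?thesis using c by (intro exI[of _ c] exI[of _ U]) auto
  qed
  then obtain c U where cU: "\<And>z. z \<in> K \<Longrightarrow> c z < M \<and> open (U z) \<and> z \<in> U z \<and> (\<forall>w\<in>U z \<inter> K. F w < c z)"
    by metis
  obtain D where D: "D \<subseteq> K" "finite D" "K \<subseteq> (\<Union>z\<in>D. U z)"
  proof (rule compactE_image[OF K(1), of K U])
    show "K \<subseteq> \<Union> (U ` K)" using cU by blast
  qed (use cU in auto)
  have "D \<noteq> {}" using D(3) K(2) by auto
  define m where "m = Max (c ` D)"
  have "m < M" unfolding m_def using D \<open>D \<noteq> {}\<close> cU by (subst Max_less_iff) auto
  have "F w \<le> m" if w: "w \<in> K" for w
  proof -
    obtain z where z: "z \<in> D" "w \<in> U z" using D(3) w by blast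
    then have "F w < c z" using cU D(1) w by blast
    also have "c z \<le> m" unfolding m_def using D(2) z(1) by simp
    finally show ?thesis by simp
  qed
  then have "M \<le> m" unfolding M_def by (auto intro: Sup_least)
  with \<open>m < M\<close> show False by simp
qed

lemma circle_has_integral:
  assumes "(f has_integral I) {0..2*pi}" "continuous_on {0..2*pi} f"
  shows "circle_integrable f" "circle_int f = I"
proof -
  show "circle_integrable f" using assms(2) by (rule circle_integrable_continuous)
  from set_borel_integral_eq_integral(2)[OF this] show "circle_int f = I"
    using assms(1) by (simp add: integral_unique)
qed

lemma circle_int_Re_cis:
  "circle_integrable (\<lambda>t. A + Re (c * cis t))" "circle_int (\<lambda>t. A + Re (c * cis t)) = 2 * pi * A"
proof -
  have "((\<lambda>t. A + Re (c * cis t)) has_integral ((2 * pi * A + Im (c * cis (2*pi))) - (0 * A + Im (c * cis 0)))) {0..2*pi}"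
    by (rule fundamental_theorem_of_calculus)
       (auto intro!: derivative_eq_intros simp flip: has_real_derivative_iff_has_vector_derivative)
  then have "((\<lambda>t. A + Re (c * cis t)) has_integral (2 * pi * A)) {0..2*pi}" by simp
  moreover have "continuous_on {0..2*pi} (\<lambda>t. A + Re (c * cis t))" by (intro continuous_intros)
  ultimately show "circle_integrable (\<lambda>t. A + Re (c * cis t))"
    "circle_int (\<lambda>t. A + Re (c * cis t)) = 2 * pi * A"
    by (rule circle_has_integral)+
qed

lemma circle_int_cos_squared:
  "circle_integrable (\<lambda>t. A + B * (cos t)\<^sup>2)" "circle_int (\<lambda>t. A + B * (cos t)\<^sup>2) = 2 * pi * A + pi * B"
proof -
  have eq: "A + B * (cos t)\<^sup>2 = A + B * (1 + (cos t)\<^sup>2 - (sin t)\<^sup>2) / 2" for t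
    by (simp add: sin_squared_eq)
  have "((\<lambda>t. A + B * (cos t)\<^sup>2) has_integral
      ((A * (2 * pi) + B * (2 * pi + sin (2*pi) * cos (2*pi)) / 2) - (A * 0 + B * (0 + sin 0 * cos 0) / 2))) {0..2*pi}"
    unfolding eq
    by (rule fundamental_theorem_of_calculus)
       (auto intro!: derivative_eq_intros simp: power2_eq_square simp flip: has_real_derivative_iff_has_vector_derivative)
  then have "((\<lambda>t. A + B * (cos t)\<^sup>2) has_integral (2 * pi * A + pi * B)) {0..2*pi}"
    by (simp add: algebra_simps)
  moreover have "continuous_on {0..2*pi} (\<lambda>t. A + B * (cos t)\<^sup>2)" by (intro continuous_intros)
  ultimately show "circle_integrable (\<lambda>t. A + B * (cos t)\<^sup>2)"
    "circle_int (\<lambda>t. A + B * (cos t)\<^sup>2) = 2 * pi * A + pi * B"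
    by (rule circle_has_integral)+
qed

definition expv :: "real ^ 'n \<Rightarrow> complex ^ 'n" where
  "expv y = (\<chi> i. complex_of_real (exp (y $ i)))"

lemma expv_nth [simp]: "expv y $ i = complex_of_real (exp (y $ i))"
  by (simp add: expv_def)

lemma assoc_convex_expv: "assoc_convex \<phi> y = \<phi> (expv y)"
  by (simp add: assoc_convex_def expv_def)

lemma open_polydisk: "open (polydisk r :: (complex ^ 'n) set)"
proof -
  have "polydisk r = (\<Inter>i\<in>UNIV. {z :: complex ^ 'n. norm (z $ i) < r})"
    by (auto simp: polydisk_def)
  also have "open \<dots>" by (intro open_INT finite ballI open_Collect_less continuous_intros)
  finally show ?thesis .
qed

text \<open>For monotonicity and convexity the sub-mean value inequality is used through an
  integrable real majorant on the circle, so the extended integral of \<phi> itself is never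
  evaluated.\<close>

lemma submean_le:
  assumes psh: "psh_on \<Omega> \<phi>" and "\<And>\<zeta>::complex. norm \<zeta> \<le> 1 \<Longrightarrow> a + \<zeta> *s b \<in> \<Omega>"
    and int: "circle_integrable f" and le: "\<And>t. t \<in> {0..2*pi} \<Longrightarrow> \<phi> (a + cis t *s b) \<le> ereal (f t)"
  shows "\<phi> a \<le> ereal (circle_int f / (2 * pi))"
proof -
  have "\<phi> a \<le> ereal (1 / (2*pi)) * ereal_int_circle (\<lambda>t. \<phi> (a + cis t *s b))"
    using psh assms(2) unfolding psh_on_def by blast
  also have "\<dots> \<le> ereal (1 / (2*pi)) * ereal_int_circle (\<lambda>t. ereal (f t))"
    by (intro ereal_mult_left_mono ereal_int_circle_mono) (use le in auto)
  also have "\<dots> = ereal (circle_int f / (2 * pi))"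
    by (simp add: ereal_circle_int(1)[OF int])
  finally show ?thesis .
qed

locale toric_fun =
  fixes r :: real and \<phi> :: "complex ^ 'n \<Rightarrow> ereal"
  assumes r: "r > 0" and toric_psh: "toric_psh r \<phi>"
begin


lemma psh: "psh_on (polydisk r) \<phi>" and toric: "toric_on r \<phi>"
  using toric_psh by (auto simp: toric_psh_def)

lemma usc: "z \<in> polydisk r \<Longrightarrow> \<phi> z < c \<Longrightarrow> eventually (\<lambda>w. \<phi> w < c) (nhds z)"
  using psh at_within_open[OF _ open_polydisk, of z r]
  unfolding psh_on_def eventually_nhds_conv_at by metis

lemma less_inf: "z \<in> polydisk r \<Longrightarrow> \<phi> z < \<infinity>"
  using psh unfolding psh_on_def by blast

lemma toric_norm_eq:
  assumes z: "z \<in> polydisk r" and eq: "\<And>i. norm (w $ i) = norm (z $ i)"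
  shows "\<phi> w = \<phi> z"
proof -
  define \<theta> :: "real ^ 'n" where "\<theta> = (\<chi> i. Arg (w $ i) - Arg (z $ i))"
  have "w = (\<chi> i. cis (\<theta> $ i) * z $ i)"
  proof (subst vec_eq_iff, intro allI)
    fix i
    have "z $ i = of_real (norm (z $ i)) * cis (Arg (z $ i))"
         "w $ i = of_real (norm (z $ i)) * cis (Arg (w $ i))"
      using rcis_cmod_Arg[of "z $ i"] rcis_cmod_Arg[of "w $ i"] eq by (auto simp: rcis_def)
    then have "cis (\<theta> $ i) * z $ i = of_real (norm (z $ i)) * (cis (Arg (w $ i) - Arg (z $ i)) * cis (Arg (z $ i)))"
      by (simp add: \<theta>_def)
    also have "\<dots> = w $ i"
      using \<open>w $ i = _\<close> by (simp add: cis_mult)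
    finally show "w $ i = (\<chi> i. cis (\<theta> $ i) * z $ i) $ i" by simp
  qed
  then show ?thesis using toric z unfolding toric_on_def by metis
qed

lemma polydisk_vupd: "z \<in> polydisk r \<Longrightarrow> norm c < r \<Longrightarrow> vupd z i c \<in> polydisk r"
  by (auto simp: polydisk_def vupd_nth)

text \<open>Maximum principle on the disc in the \<open>i\<close>-th variable, for \<open>\<phi> + \<epsilon> |\<zeta>|\<^sup>2\<close>:
  the perturbation turns the sub-mean value inequality at an interior maximum into a contradiction.\<close>

lemma mono_coord:
  assumes z: "z \<in> polydisk r" and le: "norm \<zeta>0 \<le> norm \<omega>" and \<omega>: "norm \<omega> < r"
  shows "\<phi> (vupd z i \<zeta>0) \<le> \<phi> (vupd z i \<omega>)"
proof (rule ccontr)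
  assume "\<not> ?thesis"
  define \<rho> where "\<rho> = norm \<omega>"
  define u where "u = (\<lambda>\<zeta>. \<phi> (vupd z i \<zeta>))"
  have inD: "vupd z i \<zeta> \<in> polydisk r" if "norm \<zeta> \<le> \<rho>" for \<zeta>
    using polydisk_vupd[OF z] that \<omega> by (auto simp: \<rho>_def)
  have lt: "u \<omega> < u \<zeta>0" using \<open>\<not> _\<close> by (simp add: u_def)
  obtain c2 where c2: "u \<omega> < ereal c2" "ereal c2 < u \<zeta>0" using ereal_dense2[OF lt] by blast
  obtain c1 where c1: "u \<omega> < ereal c1" "c1 < c2" using ereal_dense2[OF c2(1)] by auto
  \<comment> \<open>On the bounding circle torus invariance gives the constant value
    \<open>u \<omega>\<close>, below \<open>c1\<close>; this \<epsilon> is small enough that the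
    perturbation cannot lift it above \<open>c2\<close>. The summand 1 covers
    \<open>\<rho> = 0\<close>.\<close>
  define \<epsilon> where "\<epsilon> = (c2 - c1) / (\<rho>\<^sup>2 + 1)"
  have \<epsilon>: "\<epsilon> > 0" unfolding \<epsilon>_def using c1 by (intro divide_pos_pos) (auto intro: add_nonneg_pos)
  have \<epsilon>\<rho>: "\<epsilon> * \<rho>\<^sup>2 \<le> c2 - c1"
  proof -
    have "\<epsilon> * \<rho>\<^sup>2 \<le> \<epsilon> * (\<rho>\<^sup>2 + 1)" using \<epsilon> by (intro mult_left_mono) auto
    also have "\<epsilon> * (\<rho>\<^sup>2 + 1) = c2 - c1" unfolding \<epsilon>_def
      by (simp add: add_nonneg_eq_0_iff)
    finally show ?thesis .
  qed
  define F where "F = (\<lambda>\<zeta>. u \<zeta> + ereal (\<epsilon> * (norm \<zeta>)\<^sup>2))"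
  have ucont: "eventually (\<lambda>w. F w < c) (at \<zeta> within cball 0 \<rho>)" if \<zeta>: "\<zeta> \<in> cball 0 \<rho>" and "F \<zeta> < c" for \<zeta> c
  proof -
    have "u \<zeta> + ereal (\<epsilon> * (norm \<zeta>)\<^sup>2) < c" using that by (simp add: F_def)
    then have "u \<zeta> < c - ereal (\<epsilon> * (norm \<zeta>)\<^sup>2)"
      by (subst ereal_less_minus_iff) (auto simp: add.commute)
    then obtain e where e: "u \<zeta> < ereal e" "ereal e < c - ereal (\<epsilon> * (norm \<zeta>)\<^sup>2)"
      using ereal_dense2 by blast
    then have "ereal (e + \<epsilon> * (norm \<zeta>)\<^sup>2) < c" by (subst (asm) ereal_less_minus_iff) (auto simp: add.commute)
    then obtain e' where e': "ereal (e + \<epsilon> * (norm \<zeta>)\<^sup>2) < ereal e'" "ereal e' < c"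
      using ereal_dense2 by blast
    have "((\<lambda>w. vupd z i w) \<longlongrightarrow> vupd z i \<zeta>) (at \<zeta> within cball 0 \<rho>)"
      unfolding vupd_def by (intro vec_tendstoI) (auto simp: intro!: tendsto_eq_intros)
    with usc[OF inD e(1)[unfolded u_def]] \<zeta> have "eventually (\<lambda>w. u w < ereal e) (at \<zeta> within cball 0 \<rho>)"
      unfolding u_def by (auto simp: filterlim_iff)
    moreover have "((\<lambda>w. e + \<epsilon> * (norm w)\<^sup>2) \<longlongrightarrow> e + \<epsilon> * (norm \<zeta>)\<^sup>2) (at \<zeta> within cball 0 \<rho>)"
      by (intro tendsto_intros)
    then have "eventually (\<lambda>w. e + \<epsilon> * (norm w)\<^sup>2 < e') (at \<zeta> within cball 0 \<rho>)"
      using e'(1) by (intro order_tendstoD(2)) auto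
    ultimately show ?thesis
    proof eventually_elim
      case (elim w)
      have "F w \<le> ereal e + ereal (\<epsilon> * (norm w)\<^sup>2)" unfolding F_def
        using elim(1) by (intro add_right_mono) auto
      also have "\<dots> < ereal e'" using elim(2) by simp
      also have "\<dots> < c" by fact
      finally show ?case .
    qed
  qed
  obtain \<zeta>1 where \<zeta>1: "\<zeta>1 \<in> cball 0 \<rho>" "\<And>w. w \<in> cball 0 \<rho> \<Longrightarrow> F w \<le> F \<zeta>1"
    using usc_attains_max[of "cball 0 \<rho>" F] ucont by (auto simp: \<rho>_def)
  have F1: "F \<zeta>1 > ereal c2"
  proof -
    have "ereal c2 < u \<zeta>0 + 0" using c2 by simp
    also have "\<dots> \<le> F \<zeta>0" unfolding F_def using \<epsilon> by (intro add_left_mono) auto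
    also have "\<dots> \<le> F \<zeta>1" using le by (intro \<zeta>1) (auto simp: \<rho>_def)
    finally show ?thesis .
  qed
  have "norm \<zeta>1 \<noteq> \<rho>"
  proof
    assume eq: "norm \<zeta>1 = \<rho>"
    have "u \<zeta>1 = u \<omega>" unfolding u_def using eq inD[of \<omega>]
      by (intro toric_norm_eq) (auto simp: vupd_nth \<rho>_def)
    then have "F \<zeta>1 \<le> ereal c1 + ereal (\<epsilon> * \<rho>\<^sup>2)" unfolding F_def eq using c1
      by (intro add_right_mono) auto
    also have "\<dots> \<le> ereal c2" using \<epsilon>\<rho> by simp
    finally show False using F1 by simp
  qed
  then have n1: "norm \<zeta>1 < \<rho>" using \<zeta>1(1) by simp
  have "u \<zeta>1 \<noteq> \<infinity>" using less_inf[OF inD[of \<zeta>1]] n1 by (auto simp: u_def)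
  moreover have "u \<zeta>1 \<noteq> -\<infinity>" using F1 by (auto simp: F_def)
  ultimately obtain v where v: "u \<zeta>1 = ereal v" by (cases "u \<zeta>1") auto
  define \<delta> where "\<delta> = \<rho> - norm \<zeta>1"
  have \<delta>: "\<delta> > 0" using n1 by (simp add: \<delta>_def)
  define b where "b = (\<chi> j. if j = i then complex_of_real \<delta> else 0)"
  have ab: "vupd z i \<zeta>1 + c *s b = vupd z i (\<zeta>1 + of_real \<delta> * c)" for c
    by (auto simp: vec_eq_iff vupd_nth b_def)
  have inK: "\<zeta>1 + of_real \<delta> * c \<in> cball 0 \<rho>" if "norm c \<le> 1" for c
  proof -
    have "norm (\<zeta>1 + of_real \<delta> * c) \<le> norm \<zeta>1 + norm (of_real \<delta> * c)" by (rule norm_triangle_ineq)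
    also have "norm (of_real \<delta> * c) \<le> \<delta>" using that \<delta> by (simp add: norm_mult mult_left_le)
    finally show ?thesis by (simp add: \<delta>_def)
  qed
  \<comment> \<open>The last term has mean 0 over the circle, so averaging leaves a strict loss of
    \<open>\<epsilon> * \<delta>\<^sup>2\<close>.\<close>
  have expand: "(norm (\<zeta>1 + of_real \<delta> * cis t))\<^sup>2 = (norm \<zeta>1)\<^sup>2 + \<delta>\<^sup>2 + Re (2 * of_real \<delta> * cnj \<zeta>1 * cis t)" for t
    unfolding cmod_power2 by (simp add: power2_eq_square algebra_simps) (simp add: flip: distrib_left power2_eq_square)
  have "\<phi> (vupd z i \<zeta>1) \<le> ereal (circle_int (\<lambda>t. (v - \<epsilon> * \<delta>\<^sup>2) + Re ((- of_real \<epsilon> * 2 * of_real \<delta> * cnj \<zeta>1) * cis t)) / (2*pi))"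
  proof (rule submean_le[OF psh])
    show "vupd z i \<zeta>1 + c *s b \<in> polydisk r" if "norm c \<le> 1" for c
      unfolding ab using inK[OF that] by (intro inD) auto
    fix t
    have "F (\<zeta>1 + of_real \<delta> * cis t) \<le> F \<zeta>1" by (intro \<zeta>1 inK) auto
    then have "u (\<zeta>1 + of_real \<delta> * cis t) + ereal (\<epsilon> * (norm (\<zeta>1 + of_real \<delta> * cis t))\<^sup>2) \<le> ereal (v + \<epsilon> * (norm \<zeta>1)\<^sup>2)"
      unfolding F_def v by simp
    then have "u (\<zeta>1 + of_real \<delta> * cis t) \<le> ereal (v + \<epsilon> * (norm \<zeta>1)\<^sup>2 - \<epsilon> * (norm (\<zeta>1 + of_real \<delta> * cis t))\<^sup>2)"
      by (cases "u (\<zeta>1 + of_real \<delta> * cis t)") auto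
    also have "v + \<epsilon> * (norm \<zeta>1)\<^sup>2 - \<epsilon> * (norm (\<zeta>1 + of_real \<delta> * cis t))\<^sup>2
       = (v - \<epsilon> * \<delta>\<^sup>2) + Re ((- of_real \<epsilon> * 2 * of_real \<delta> * cnj \<zeta>1) * cis t)"
      unfolding expand by (simp add: algebra_simps)
    finally show "\<phi> (vupd z i \<zeta>1 + cis t *s b) \<le> ereal ((v - \<epsilon> * \<delta>\<^sup>2) + Re ((- of_real \<epsilon> * 2 * of_real \<delta> * cnj \<zeta>1) * cis t))"
      unfolding ab u_def .
  qed (rule circle_int_Re_cis)
  then have "v \<le> v - \<epsilon> * \<delta>\<^sup>2" unfolding circle_int_Re_cis using v by (simp add: u_def)
  moreover have "\<epsilon> * \<delta>\<^sup>2 > 0" using \<epsilon> \<delta> by simp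
  ultimately show False by linarith
qed

lemma mono:
  assumes z: "z \<in> polydisk r" and w: "w \<in> polydisk r" and le: "\<And>i. norm (z $ i) \<le> norm (w $ i)"
  shows "\<phi> z \<le> \<phi> w"
proof -
  have "\<phi> z \<le> \<phi> (\<chi> i. if i \<in> S then w $ i else z $ i)" if "finite S" for S
    using that
  proof (induction S)
    case (insert x S)
    let ?v = "\<chi> i. if i \<in> S then w $ i else z $ i"
    have v: "?v \<in> polydisk r" using z w by (auto simp: polydisk_def)
    have "\<phi> (vupd ?v x (z $ x)) \<le> \<phi> (vupd ?v x (w $ x))"
      by (rule mono_coord[OF v]) (use le w in \<open>auto simp: polydisk_def\<close>)
    moreover have "vupd ?v x (z $ x) = ?v" using insert by (auto simp: vec_eq_iff vupd_nth)
    moreover have "vupd ?v x (w $ x) = (\<chi> i. if i \<in> insert x S then w $ i else z $ i)"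
      by (auto simp: vec_eq_iff vupd_nth)
    ultimately show ?case using insert by (auto intro: order_trans)
  qed auto
  from this[of UNIV] show ?thesis by simp
qed

section \<open>The associated function in logarithmic coordinates\<close>

definition U :: "(real ^ 'n) set" where "U = {y. \<forall>i. y $ i < ln r}"

definition g :: "real ^ 'n \<Rightarrow> ereal" where "g = assoc_convex \<phi>"

lemma expv_in: "y \<in> U \<Longrightarrow> expv y \<in> polydisk r"
  using r by (auto simp: U_def polydisk_def) (metis exp_less_mono exp_ln)

lemma open_U: "open U"
proof -
  have "U = (\<Inter>i\<in>UNIV. {y. y $ i < ln r})" by (auto simp: U_def)
  also have "open \<dots>" by (intro open_INT finite ballI open_Collect_less continuous_intros)
  finally show ?thesis .
qed

lemma convex_U: "convex U"
proof -
  have "U = (\<Inter>i\<in>UNIV. {y. axis i 1 \<bullet> y < ln r})" by (auto simp: U_def inner_axis')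
  then show ?thesis by (simp add: convex_INT convex_halfspace_lt)
qed

lemma g_phi: "y \<in> U \<Longrightarrow> (\<And>i. norm (z $ i) = exp (y $ i)) \<Longrightarrow> \<phi> z = g y"
  unfolding g_def assoc_convex_expv using expv_in by (intro toric_norm_eq) auto

lemma g_mono: "x \<in> U \<Longrightarrow> y \<in> U \<Longrightarrow> (\<And>i. x $ i \<le> y $ i) \<Longrightarrow> g x \<le> g y"
  unfolding g_def assoc_convex_expv using expv_in by (intro mono) auto

lemma g_less_inf: "y \<in> U \<Longrightarrow> g y < \<infinity>"
  unfolding g_def assoc_convex_expv using expv_in by (intro less_inf) auto

lemma g_usc:
  assumes "y \<in> U" "g y < c"
  shows "eventually (\<lambda>x. g x < c) (nhds y)"
proof -
  have "(expv \<longlongrightarrow> expv y) (nhds y)" unfolding expv_def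
    by (intro vec_tendstoI) (auto intro!: tendsto_intros filterlim_ident)
  with usc[OF expv_in[OF assms(1)]] assms(2) show ?thesis
    unfolding g_def assoc_convex_expv by (auto simp: filterlim_iff)
qed

end

subsection \<open>Convexity of the associated function\<close>

lemma ln_one_plus_approx:
  assumes "\<bar>s\<bar> \<le> 1/2"
  shows "\<bar>ln (cmod (1 + cis t * of_real s)) - s * cos t\<bar> \<le> 2 * s\<^sup>2"
proof -
  let ?w = "cis t * complex_of_real s"
  have n: "cmod ?w = \<bar>s\<bar>" by (simp add: norm_mult)
  then have lt: "cmod ?w < 1" using assms by linarith
  have nz: "1 + ?w \<noteq> 0"
  proof
    assume "1 + ?w = 0"
    then have "?w = - 1" by (simp add: eq_neg_iff_add_eq_0 add.commute)
    then show False using lt by simp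
  qed
  have "\<bar>Re (Ln (1 + ?w) - ?w)\<bar> \<le> cmod (Ln (1 + ?w) - ?w)" by (rule abs_Re_le_cmod)
  also have "\<dots> \<le> (cmod ?w)\<^sup>2 / (1 - cmod ?w)" by (rule Ln_approx_linear[OF lt])
  also have "\<dots> \<le> (cmod ?w)\<^sup>2 / (1/2)" using assms n by (intro divide_left_mono) auto
  also have "\<dots> = 2 * s\<^sup>2" unfolding n by simp
  also have "Re (Ln (1 + ?w) - ?w) = ln (cmod (1 + ?w)) - s * cos t" using nz by simp
  finally show ?thesis .
qed

context toric_fun
begin

text \<open>The disc through \<open>expv y\<close> with direction
  \<open>exp (y $ i) * s $ i\<close>, read in logarithmic coordinates. The bound
  \<open>\<bar>s $ i\<bar> < 1\<close> keeps it off the coordinate hyperplanes, where these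
  coordinates break down.\<close>

lemma g_submean:
  assumes y: "y \<in> U" and s: "\<And>i. \<bar>s $ i\<bar> < 1" "\<And>i. y $ i + ln (1 + \<bar>s $ i\<bar>) < ln r"
    and int: "circle_integrable f"
    and le: "\<And>t. g (y + (\<chi> i. ln (cmod (1 + cis t * of_real (s $ i))))) \<le> ereal (f t)"
  shows "g y \<le> ereal (circle_int f / (2 * pi))"
proof -
  define b :: "complex ^ 'n" where "b = (\<chi> i. of_real (exp (y $ i) * s $ i))"
  have ab: "(expv y + \<zeta> *s b) $ i = of_real (exp (y $ i)) * (1 + \<zeta> * of_real (s $ i))" for \<zeta> i
    by (simp add: b_def algebra_simps)
  have lt: "cmod (1 + \<zeta> * of_real (s $ i)) \<le> 1 + \<bar>s $ i\<bar>" if "norm \<zeta> \<le> 1" for \<zeta> i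
  proof -
    have "cmod (1 + \<zeta> * of_real (s $ i)) \<le> cmod 1 + cmod (\<zeta> * of_real (s $ i))" by (rule norm_triangle_ineq)
    also have "cmod (\<zeta> * of_real (s $ i)) \<le> \<bar>s $ i\<bar>"
      using that by (simp add: norm_mult mult_left_le_one_le)
    finally show ?thesis by simp
  qed
  have nz: "0 < cmod (1 + \<zeta> * of_real (s $ i))" if "norm \<zeta> \<le> 1" for \<zeta> i
  proof -
    have "cmod (\<zeta> * of_real (s $ i)) \<le> \<bar>s $ i\<bar>"
      using that by (simp add: norm_mult mult_left_le_one_le)
    then have "cmod (\<zeta> * of_real (s $ i)) < 1" using s(1)[of i] by linarith
    then have "\<zeta> * of_real (s $ i) \<noteq> -1" by auto
    then have "1 + \<zeta> * of_real (s $ i) \<noteq> 0"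
      using eq_neg_iff_add_eq_0[of "\<zeta> * of_real (s $ i)" 1] by (simp add: add.commute)
    then show ?thesis by simp
  qed
  have inU: "y + (\<chi> i. ln (cmod (1 + \<zeta> * of_real (s $ i)))) \<in> U" if "norm \<zeta> \<le> 1" for \<zeta>
    unfolding U_def
  proof (safe)
    fix i
    have "ln (cmod (1 + \<zeta> * of_real (s $ i))) \<le> ln (1 + \<bar>s $ i\<bar>)"
      using lt[OF that] nz[OF that] by (intro ln_mono) auto
    then show "(y + (\<chi> i. ln (cmod (1 + \<zeta> * of_real (s $ i))))) $ i < ln r"
      using s(2)[of i] by simp
  qed
  have nrm: "norm ((expv y + \<zeta> *s b) $ i) = exp ((y + (\<chi> i. ln (cmod (1 + \<zeta> * of_real (s $ i))))) $ i)"
    if "norm \<zeta> \<le> 1" for \<zeta> i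
    unfolding ab using nz[OF that, of i] by (simp add: norm_mult exp_add)
  have "\<phi> (expv y) \<le> ereal (circle_int f / (2 * pi))"
  proof (rule submean_le[OF psh _ int])
    fix \<zeta> :: complex assume z: "norm \<zeta> \<le> 1"
    show "expv y + \<zeta> *s b \<in> polydisk r"
      unfolding polydisk_def
    proof safe
      fix i
      have "exp ((y + (\<chi> i. ln (cmod (1 + \<zeta> * of_real (s $ i))))) $ i) < exp (ln r)"
        using inU[OF z] unfolding U_def by (subst exp_less_cancel_iff) auto
      then show "cmod ((expv y + \<zeta> *s b) $ i) < r" unfolding nrm[OF z] using r by simp
    qed
  next
    fix t
    have "\<phi> (expv y + cis t *s b) = g (y + (\<chi> i. ln (cmod (1 + cis t * of_real (s $ i)))))"
      using inU[of "cis t"] nrm[of "cis t"] by (intro g_phi) auto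
    then show "\<phi> (expv y + cis t *s b) \<le> ereal (f t)" using le[of t] by simp
  qed
  then show ?thesis by (simp add: g_def assoc_convex_expv)
qed

text \<open>Viscosity form of the sub-mean value inequality. The disc through \<open>exp y\<close> in the direction
  \<open>(d\<^sub>i exp y\<^sub>i)\<close> follows, in logarithmic coordinates, the line \<open>\<real> d\<close> up to second order, and
  affine functions of the logarithmic coordinates have the mean value property.\<close>

lemma no_touching:
  fixes p k d :: "real ^ 'n"
  assumes y: "y \<in> U" and v: "g y = ereal v" and kd: "k \<bullet> d = 1" and \<epsilon>: "\<epsilon> > 0" and K: "K \<ge> 0"
    and le: "eventually (\<lambda>h. g (y + h) \<le> ereal (v + p \<bullet> h - \<epsilon> * (k \<bullet> h)\<^sup>2 + K * (norm (h - (k \<bullet> h) *\<^sub>R d))\<^sup>2)) (nhds 0)"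
  shows False
proof -
  define V where "V = (\<lambda>\<rho> t. \<chi> i. ln (cmod (1 + cis t * of_real (\<rho> * d $ i))))"
  \<comment> \<open>For a disc of size \<rho>, \<open>C1\<close> measures its deviation from the
    line and \<open>C2\<close> the transverse part of that deviation, both in units of
    \<open>\<rho>\<^sup>2\<close>. \<open>C4\<close> collects their effect on the quadratic terms,
    in units of \<open>\<rho> ^ 4\<close>.\<close>
  define C1 where "C1 = (\<Sum>i\<in>UNIV. 2 * (d $ i)\<^sup>2)"
  define C2 where "C2 = C1 + norm k * C1 * norm d"
  define C4 where "C4 = \<epsilon> * (norm k * C1)\<^sup>2 + K * C2\<^sup>2"
  have C1: "C1 \<ge> 0" unfolding C1_def by (intro sum_nonneg) auto
  obtain \<eta> where \<eta>: "\<eta> > 0" "\<And>h. norm h < \<eta> \<Longrightarrow> g (y + h) \<le> ereal (v + p \<bullet> h - \<epsilon> * (k \<bullet> h)\<^sup>2 + K * (norm (h - (k \<bullet> h) *\<^sub>R d))\<^sup>2)"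
    using le unfolding eventually_nhds_metric by auto
  have ev_small: "eventually (\<lambda>\<rho>. \<forall>i. \<bar>\<rho> * d $ i\<bar> < 1/2 \<and> y $ i + ln (1 + \<bar>\<rho> * d $ i\<bar>) < ln r) (at_right 0)"
  proof (rule eventually_all_finite)
    fix i
    have "((\<lambda>\<rho>. \<bar>\<rho> * d $ i\<bar>) \<longlongrightarrow> \<bar>0 * d $ i\<bar>) (at_right 0)" by (intro tendsto_intros)
    then have "eventually (\<lambda>\<rho>. \<bar>\<rho> * d $ i\<bar> < 1/2) (at_right 0)" by (rule order_tendstoD) auto
    moreover have "((\<lambda>\<rho>. y $ i + ln (1 + \<bar>\<rho> * d $ i\<bar>)) \<longlongrightarrow> y $ i + ln (1 + \<bar>0 * d $ i\<bar>)) (at_right 0)"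
      by (intro tendsto_intros) auto
    then have "eventually (\<lambda>\<rho>. y $ i + ln (1 + \<bar>\<rho> * d $ i\<bar>) < ln r) (at_right 0)"
      using y by (intro order_tendstoD) (auto simp: U_def)
    ultimately show "eventually (\<lambda>\<rho>. \<bar>\<rho> * d $ i\<bar> < 1/2 \<and> y $ i + ln (1 + \<bar>\<rho> * d $ i\<bar>) < ln r) (at_right 0)"
      by eventually_elim auto
  qed
  have "((\<lambda>\<rho>. \<bar>\<rho>\<bar> * norm d + C1 * \<rho>\<^sup>2) \<longlongrightarrow> \<bar>0\<bar> * norm d + C1 * 0\<^sup>2) (at_right 0)"
    by (intro tendsto_intros)
  then have ev_eta: "eventually (\<lambda>\<rho>. \<bar>\<rho>\<bar> * norm d + C1 * \<rho>\<^sup>2 < \<eta>) (at_right 0)"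
    by (rule order_tendstoD) (use \<eta> in auto)
  have "((\<lambda>\<rho>. C4 * \<rho>\<^sup>2) \<longlongrightarrow> C4 * 0\<^sup>2) (at_right 0)" by (intro tendsto_intros)
  \<comment> \<open>The quarter is what remains of \<epsilon> after half of the square is given up
    to the error and \<open>(cos t)\<^sup>2\<close> is replaced by its mean 1/2.\<close>
  then have ev_C4: "eventually (\<lambda>\<rho>. C4 * \<rho>\<^sup>2 < \<epsilon> / 4) (at_right 0)"
    by (rule order_tendstoD) (use \<epsilon> in auto)
  have "eventually (\<lambda>\<rho>::real. \<rho> > 0) (at_right 0)" by (rule eventually_at_right_less)
  from eventually_happens[OF eventually_conj[OF this eventually_conj[OF ev_small eventually_conj[OF ev_eta ev_C4]]]]
  obtain \<rho> where \<rho>: "\<rho> > 0" and small: "\<And>i. \<bar>\<rho> * d $ i\<bar> < 1/2" "\<And>i. y $ i + ln (1 + \<bar>\<rho> * d $ i\<bar>) < ln r"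
    and eta: "\<bar>\<rho>\<bar> * norm d + C1 * \<rho>\<^sup>2 < \<eta>" and C4: "C4 * \<rho>\<^sup>2 < \<epsilon> / 4"
    by auto
  define e where "e t = V \<rho> t - (\<rho> * cos t) *\<^sub>R d" for t
  have V_eq: "V \<rho> t = (\<rho> * cos t) *\<^sub>R d + e t" for t by (simp add: e_def)
  have e: "norm (e t) \<le> C1 * \<rho>\<^sup>2" for t
  proof -
    have "norm (e t) \<le> (\<Sum>i\<in>UNIV. \<bar>e t $ i\<bar>)" by (rule norm_le_l1_cart)
    also have "\<dots> \<le> (\<Sum>i\<in>UNIV. 2 * (\<rho> * d $ i)\<^sup>2)"
    proof (rule sum_mono)
      fix i
      have "\<bar>\<rho> * d $ i\<bar> \<le> 1/2" using small(1)[of i] by simp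
      from ln_one_plus_approx[OF this, of t] show "\<bar>e t $ i\<bar> \<le> 2 * (\<rho> * d $ i)\<^sup>2"
        by (simp add: e_def V_def mult_ac)
    qed
    also have "\<dots> = C1 * \<rho>\<^sup>2"
      unfolding C1_def sum_distrib_right power_mult_distrib by (simp add: mult_ac)
    finally show ?thesis .
  qed
  have bound: "g (y + V \<rho> t) \<le> ereal (v + p \<bullet> V \<rho> t + (C4 * \<rho> ^ 4 + (- \<epsilon> * \<rho>\<^sup>2 / 2) * (cos t)\<^sup>2))" for t
  proof -
    let ?h = "V \<rho> t"
    have ke: "\<bar>k \<bullet> e t\<bar> \<le> norm k * (C1 * \<rho>\<^sup>2)"
      using Cauchy_Schwarz_ineq2[of k "e t"] mult_left_mono[OF e, of "norm k" t] by (meson norm_ge_zero order_trans)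
    have "norm ?h \<le> \<bar>\<rho> * cos t\<bar> * norm d + norm (e t)"
      unfolding V_eq by (metis norm_scaleR norm_triangle_ineq)
    also have "\<bar>\<rho> * cos t\<bar> * norm d \<le> \<bar>\<rho>\<bar> * norm d"
      by (intro mult_right_mono) (auto simp: abs_mult mult_left_le)
    finally have "norm ?h < \<eta>" using e[of t] eta by linarith
    from \<eta>(2)[OF this] have "g (y + ?h) \<le> ereal (v + p \<bullet> ?h - \<epsilon> * (k \<bullet> ?h)\<^sup>2 + K * (norm (?h - (k \<bullet> ?h) *\<^sub>R d))\<^sup>2)" .
    also have "\<dots> \<le> ereal (v + p \<bullet> V \<rho> t + (C4 * \<rho> ^ 4 + (- \<epsilon> * \<rho>\<^sup>2 / 2) * (cos t)\<^sup>2))"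
    proof -
      have kh: "k \<bullet> ?h = \<rho> * cos t + k \<bullet> e t" by (simp add: V_eq inner_add_right kd)
      \<comment> \<open>Half of the main square survives the perturbation; the cross term is
        absorbed in the rest.\<close>
      have "(\<rho> * cos t)\<^sup>2 / 2 - (k \<bullet> e t)\<^sup>2 \<le> (k \<bullet> ?h)\<^sup>2"
      proof -
        have "0 \<le> (\<rho> * cos t + 2 * (k \<bullet> e t))\<^sup>2" by simp
        then show ?thesis unfolding kh by (simp add: power2_eq_square algebra_simps)
      qed
      moreover have "(k \<bullet> e t)\<^sup>2 \<le> (norm k * C1)\<^sup>2 * \<rho> ^ 4"
      proof -
        have "(k \<bullet> e t)\<^sup>2 = \<bar>k \<bullet> e t\<bar>\<^sup>2" by simp
        also have "\<dots> \<le> (norm k * (C1 * \<rho>\<^sup>2))\<^sup>2" using ke by (intro power_mono) auto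
        also have "\<dots> = (norm k * C1)\<^sup>2 * \<rho> ^ 4" by (simp add: power_mult_distrib flip: power_mult)
        finally show ?thesis .
      qed
      ultimately have "(\<rho> * cos t)\<^sup>2 / 2 - (norm k * C1)\<^sup>2 * \<rho> ^ 4 \<le> (k \<bullet> ?h)\<^sup>2" by linarith
      then have 1: "\<epsilon> * ((\<rho> * cos t)\<^sup>2 / 2 - (norm k * C1)\<^sup>2 * \<rho> ^ 4) \<le> \<epsilon> * (k \<bullet> ?h)\<^sup>2"
        using \<epsilon> by (intro mult_left_mono) auto
      have "?h - (k \<bullet> ?h) *\<^sub>R d = e t - (k \<bullet> e t) *\<^sub>R d"
        unfolding kh by (simp add: V_eq scaleR_add_left)
      then have "norm (?h - (k \<bullet> ?h) *\<^sub>R d) \<le> norm (e t) + \<bar>k \<bullet> e t\<bar> * norm d"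
        using norm_triangle_ineq4[of "e t" "(k \<bullet> e t) *\<^sub>R d"] by simp
      also have "\<dots> \<le> C1 * \<rho>\<^sup>2 + norm k * (C1 * \<rho>\<^sup>2) * norm d"
        using e ke by (intro add_mono mult_right_mono) auto
      also have "\<dots> = C2 * \<rho>\<^sup>2" by (simp add: C2_def algebra_simps)
      finally have "(norm (?h - (k \<bullet> ?h) *\<^sub>R d))\<^sup>2 \<le> (C2 * \<rho>\<^sup>2)\<^sup>2" by (intro power_mono) auto
      then have "K * (norm (?h - (k \<bullet> ?h) *\<^sub>R d))\<^sup>2 \<le> K * (C2\<^sup>2 * \<rho> ^ 4)"
        using K by (intro mult_left_mono) (auto simp: power_mult_distrib simp flip: power_mult)
      with 1 have "v + p \<bullet> ?h - \<epsilon> * (k \<bullet> ?h)\<^sup>2 + K * (norm (?h - (k \<bullet> ?h) *\<^sub>R d))\<^sup>2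
        \<le> v + p \<bullet> ?h - \<epsilon> * ((\<rho> * cos t)\<^sup>2 / 2 - (norm k * C1)\<^sup>2 * \<rho> ^ 4) + K * (C2\<^sup>2 * \<rho> ^ 4)"
        by linarith
      also have "\<dots> = v + p \<bullet> V \<rho> t + (C4 * \<rho> ^ 4 + (- \<epsilon> * \<rho>\<^sup>2 / 2) * (cos t)\<^sup>2)"
        by (simp add: C4_def algebra_simps power_mult_distrib)
      finally show ?thesis by simp
    qed
    finally show ?thesis .
  qed
  have lin: "circle_integrable (\<lambda>t. p \<bullet> V \<rho> t)" "circle_int (\<lambda>t. p \<bullet> V \<rho> t) = 0"
  proof -
    have i: "circle_integrable (\<lambda>t. p $ i * ln (cmod (1 + cis t * of_real (\<rho> * d $ i))))"
       "circle_int (\<lambda>t. p $ i * ln (cmod (1 + cis t * of_real (\<rho> * d $ i)))) = 0" for i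
    proof -
      have "cmod (of_real (\<rho> * d $ i)) < cmod 1" using small(1)[of i] by (simp only: norm_of_real norm_one)
      from ln_circle_mean_less[OF this]
      show "circle_integrable (\<lambda>t. p $ i * ln (cmod (1 + cis t * of_real (\<rho> * d $ i))))"
       "circle_int (\<lambda>t. p $ i * ln (cmod (1 + cis t * of_real (\<rho> * d $ i)))) = 0"
        by (auto intro: set_integrable_mult_right)
    qed
    have eq: "p \<bullet> V \<rho> t = (\<Sum>i\<in>UNIV. p $ i * ln (cmod (1 + cis t * of_real (\<rho> * d $ i))))" for t
      by (simp add: inner_vec_def V_def)
    show "circle_integrable (\<lambda>t. p \<bullet> V \<rho> t)" unfolding eq
      using i(1) unfolding set_integrable_def scaleR_sum_right by (intro Bochner_Integration.integrable_sum) auto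
    show "circle_int (\<lambda>t. p \<bullet> V \<rho> t) = 0" unfolding eq
      using i unfolding set_integrable_def set_lebesgue_integral_def scaleR_sum_right
      by (subst Bochner_Integration.integral_sum) auto
  qed
  define A where "A = v + C4 * \<rho> ^ 4"
  define B where "B = - \<epsilon> * \<rho>\<^sup>2 / 2"
  have eq: "v + p \<bullet> V \<rho> t + (C4 * \<rho> ^ 4 + (- \<epsilon> * \<rho>\<^sup>2 / 2) * (cos t)\<^sup>2) = p \<bullet> V \<rho> t + (A + B * (cos t)\<^sup>2)" for t
    by (simp add: A_def B_def)
  have "g y \<le> ereal (circle_int (\<lambda>t. p \<bullet> V \<rho> t + (A + B * (cos t)\<^sup>2)) / (2 * pi))"
  proof (rule g_submean[OF y, of "\<rho> *\<^sub>R d"])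
    show "\<bar>(\<rho> *\<^sub>R d) $ i\<bar> < 1" "y $ i + ln (1 + \<bar>(\<rho> *\<^sub>R d) $ i\<bar>) < ln r" for i
      using small[of i] by auto
    show "circle_integrable (\<lambda>t. p \<bullet> V \<rho> t + (A + B * (cos t)\<^sup>2))"
      by (rule set_integral_add(1)[OF lin(1) circle_int_cos_squared(1)])
    show "g (y + (\<chi> i. ln (cmod (1 + cis t * of_real ((\<rho> *\<^sub>R d) $ i))))) \<le> ereal (p \<bullet> V \<rho> t + (A + B * (cos t)\<^sup>2))" for t
      using bound[of t] unfolding eq by (simp add: V_def)
  qed
  also have "circle_int (\<lambda>t. p \<bullet> V \<rho> t + (A + B * (cos t)\<^sup>2)) = 2 * pi * A + pi * B"
    by (subst set_integral_add(2)[OF lin(1) circle_int_cos_squared(1)]) (simp add: lin circle_int_cos_squared)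
  finally have "v \<le> (2 * pi * A + pi * B) / (2 * pi)" by (simp add: v)
  also have "\<dots> = A + B / 2" by (simp add: field_simps)
  also have "\<dots> = v + \<rho>\<^sup>2 * (C4 * \<rho>\<^sup>2 - \<epsilon> / 4)"
    by (simp add: A_def B_def algebra_simps flip: power_add)
  finally have "0 \<le> \<rho>\<^sup>2 * (C4 * \<rho>\<^sup>2 - \<epsilon> / 4)" by simp
  moreover have "\<rho>\<^sup>2 * (C4 * \<rho>\<^sup>2 - \<epsilon> / 4) < 0"
    using \<rho> C4 by (intro mult_pos_neg) auto
  ultimately show False by simp
qed

text \<open>If \<open>g\<close> exceeded the chord at \<open>ys\<close>, then \<open>g - q\<close>
  would attain its maximum over a thin tube around the segment in the interior of the tube. Here
  \<open>q\<close> is the chord minus a concave bump along the segment plus a steep transverse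
  penalty; up to a constant it would touch \<open>g\<close> from above, which
  \<open>no_touching\<close> forbids. The strict bounds \<open>A\<close> and \<open>B\<close>
  persist near the end points by upper semicontinuity, and this controls the ends of the
  tube.\<close>

lemma g_convex_strict:
  assumes y1: "y1 \<in> U" and y2: "y2 \<in> U" and A: "g y1 < ereal A" and B: "g y2 < ereal B"
    and l: "0 < l" "l < 1"
  shows "g ((1 - l) *\<^sub>R y1 + l *\<^sub>R y2) \<le> ereal ((1 - l) * A + l * B)"
proof (rule ccontr)
  assume neg: "\<not> ?thesis"
  define d where "d = y2 - y1"
  define ys where "ys = (1 - l) *\<^sub>R y1 + l *\<^sub>R y2"
  have ys: "ys = y1 + l *\<^sub>R d" by (simp add: ys_def d_def algebra_simps)
  have d0: "d \<noteq> 0"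
  proof
    assume "d = 0"
    then have "y1 = y2" "ys = y1" using ys by (auto simp: d_def)
    then have "g ys < ereal (min A B)" using A B by (simp add: min_def)
    also have "min A B = (1 - l) * min A B + l * min A B" by (simp add: algebra_simps)
    also have "ereal \<dots> \<le> ereal ((1 - l) * A + l * B)"
      using l by (auto intro!: add_mono mult_left_mono)
    finally show False using neg by (simp add: ys_def)
  qed
  \<comment> \<open>\<open>k\<close> is dual to \<open>d\<close>, so \<open>t\<close> is the
    coordinate along the segment and \<open>P\<close> the orthogonal projection away from
    \<open>d\<close>.\<close>
  define k where "k = (1 / (d \<bullet> d)) *\<^sub>R d"
  have kd: "k \<bullet> d = 1" using d0 by (simp add: k_def)
  define t where "t y = k \<bullet> (y - y1)" for y
  define P where "P h = h - (k \<bullet> h) *\<^sub>R d" for h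
  have P_eq: "y = y1 + t y *\<^sub>R d + P (y - y1)" for y by (simp add: P_def t_def)
  have P_add: "P (u + v) = P u + P v" for u v by (simp add: P_def inner_add_right scaleR_add_left)
  have cont_t: "continuous_on S t" for S unfolding t_def by (intro continuous_intros)
  have cont_P: "continuous_on S (\<lambda>y. norm (P (y - y1)))" for S unfolding P_def by (intro continuous_intros)
  have "ereal ((1 - l) * A + l * B) < g ys" using neg by (simp add: ys_def)
  then obtain c where c: "(1 - l) * A + l * B < c" "ereal c < g ys" using ereal_dense2 by force
  \<comment> \<open>One constant in two roles: the gap at \<open>ys\<close> and the coefficient of
    the bump. At the end \<open>t = 1\<close> the bump raises \<open>F\<close> by exactly
    \<epsilon>, which the value at \<open>ys\<close> still exceeds.\<close>
  define \<epsilon> where "\<epsilon> = c - ((1 - l) * A + l * B)"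
  have \<epsilon>: "\<epsilon> > 0" using c by (simp add: \<epsilon>_def)
  obtain \<eta>1 where \<eta>1: "\<eta>1 > 0" "\<And>x. dist x y1 < \<eta>1 \<Longrightarrow> g x < ereal A"
    using g_usc[OF y1 A] unfolding eventually_nhds_metric by blast
  obtain \<eta>2 where \<eta>2: "\<eta>2 > 0" "\<And>x. dist x y2 < \<eta>2 \<Longrightarrow> g x < ereal B"
    using g_usc[OF y2 B] unfolding eventually_nhds_metric by blast
  define top where "top = Max (range (\<lambda>i. max (y1 $ i) (y2 $ i)))"
  have top: "y1 $ i \<le> top" "y2 $ i \<le> top" for i
  proof -
    have "max (y1 $ i) (y2 $ i) \<le> top" unfolding top_def by (intro Max_ge) auto
    then show "y1 $ i \<le> top" "y2 $ i \<le> top" by auto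
  qed
  have "top \<in> range (\<lambda>i. max (y1 $ i) (y2 $ i))" unfolding top_def by (intro Max_in) auto
  then have top_r: "top < ln r" using y1 y2 by (auto simp: U_def max_def)
  \<comment> \<open>Thin enough for the tube to stay in \<open>U\<close> and for its two ends to lie
    where \<open>g\<close> is below \<open>A\<close> and \<open>B\<close>.\<close>
  define \<eta> where "\<eta> = min (min \<eta>1 \<eta>2) (ln r - top) / 2"
  have \<eta>: "\<eta> > 0" "\<eta> < \<eta>1" "\<eta> < \<eta>2" "\<eta> < ln r - top" using \<eta>1 \<eta>2 top_r by (auto simp: \<eta>_def)
  define T where "T = {y. 0 \<le> t y \<and> t y \<le> 1 \<and> norm (P (y - y1)) \<le> \<eta>}"
  have bound_i: "y $ i \<le> top + \<eta>" if "y \<in> T" for y i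
  proof -
    have "y $ i = (1 - t y) * y1 $ i + t y * y2 $ i + P (y - y1) $ i"
      by (subst P_eq) (simp add: d_def algebra_simps)
    also have "\<dots> \<le> (1 - t y) * top + t y * top + \<eta>"
    proof (intro add_mono mult_left_mono top)
      have "\<bar>P (y - y1) $ i\<bar> \<le> norm (P (y - y1))" by (rule component_le_norm_cart)
      then show "P (y - y1) $ i \<le> \<eta>" using that by (auto simp: T_def)
    qed (use that in \<open>auto simp: T_def\<close>)
    finally show ?thesis by (simp add: algebra_simps)
  qed
  have TU: "T \<subseteq> U"
  proof
    fix y assume "y \<in> T"
    then have "y $ i < ln r" for i using bound_i[of y i] \<eta>(4) by linarith
    then show "y \<in> U" by (simp add: U_def)
  qed
  have T_Int: "T = {y. 0 \<le> t y} \<inter> {y. t y \<le> 1} \<inter> {y. norm (P (y - y1)) \<le> \<eta>}"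
    by (auto simp: T_def)
  have closed: "closed T" unfolding T_Int
    by (intro closed_Int closed_Collect_le cont_t cont_P continuous_intros)
  have bounded: "bounded T"
  proof (rule boundedI)
    fix y assume y: "y \<in> T"
    have "norm y \<le> norm (y1 + t y *\<^sub>R d) + norm (P (y - y1))"
      by (subst P_eq) (rule norm_triangle_ineq)
    also have "norm (y1 + t y *\<^sub>R d) \<le> norm y1 + norm (t y *\<^sub>R d)" by (rule norm_triangle_ineq)
    also have "norm (t y *\<^sub>R d) \<le> norm d" using y by (auto simp: T_def mult_left_le_one_le)
    finally show "norm y \<le> norm y1 + norm d + \<eta>" using y by (auto simp: T_def)
  qed
  have compact: "compact T" using closed bounded by (simp add: compact_eq_bounded_closed)
  \<comment> \<open>A point above the whole tube: monotonicity bounds \<open>g\<close> on the tube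
    by its value there.\<close>
  define ytop :: "real ^ 'n" where "ytop = (\<chi> i. top + \<eta>)"
  have ytop: "ytop \<in> U" using \<eta> by (auto simp: ytop_def U_def)
  obtain M where M: "g ytop < ereal M" using g_less_inf[OF ytop] less_PInf_Ex_of_nat[of "g ytop"] by auto
  have gM: "g y < ereal M" if "y \<in> T" for y
  proof -
    have "g y \<le> g ytop" using bound_i[OF that] TU that ytop by (intro g_mono) (auto simp: ytop_def)
    then show ?thesis using M by simp
  qed
  \<comment> \<open>On the lateral wall the penalty is \<open>K * \<eta>\<^sup>2\<close>, which
    outweighs the bound \<open>M\<close> on \<open>g\<close> and every value of the chord.\<close>
  define K where "K = (\<bar>M\<bar> + \<bar>A\<bar> + \<bar>B\<bar> + 1) / \<eta>\<^sup>2"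
  have K: "K \<ge> 0" by (simp add: K_def)
  define q where "q y = A + t y * (B - A) - \<epsilon> * (t y)\<^sup>2 + K * (norm (P (y - y1)))\<^sup>2" for y
  define F where "F y = g y - ereal (q y)" for y
  have cont_q: "continuous_on S q" for S
    unfolding q_def by (intro continuous_intros cont_t cont_P)
  have F_usc: "eventually (\<lambda>w. F w < c) (at y within T)" if y: "y \<in> T" and lt: "F y < c" for y c
  proof -
    have "g y < c + ereal (q y)" using lt unfolding F_def by (subst (asm) ereal_minus_less_iff) auto
    then obtain e where e: "g y < ereal e" "ereal e < c + ereal (q y)" using ereal_dense2 by blast
    then have "ereal (e - q y) < c" by (cases c) auto
    then obtain e' where e': "ereal (e - q y) < ereal e'" "ereal e' < c" using ereal_dense2 by blast
    have "eventually (\<lambda>x. g x < ereal e) (at y within T)"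
      unfolding eventually_at_filter by (rule eventually_mono[OF g_usc[OF _ e(1)]]) (use TU y in auto)
    moreover have "((\<lambda>x. e - q x) \<longlongrightarrow> e - q y) (at y within T)"
      using cont_q[of T] y by (intro tendsto_intros) (auto simp: continuous_on_def)
    then have "eventually (\<lambda>x. e - q x < e') (at y within T)" using e'(1) by (intro order_tendstoD(2)) auto
    ultimately show ?thesis
    proof eventually_elim
      case (elim w)
      have "F w \<le> ereal e - ereal (q w)" unfolding F_def using elim(1) by (intro ereal_minus_mono) auto
      also have "\<dots> < ereal e'" using elim(2) by simp
      also have "\<dots> < c" by fact
      finally show ?case .
    qed
  qed
  have t_ys: "t ys = l" by (simp add: t_def ys kd)
  have P_ys: "P (ys - y1) = 0" by (simp add: P_def ys kd)
  have ysT: "ys \<in> T" using l \<eta> by (simp add: T_def t_ys P_ys)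
  obtain y0 where y0: "y0 \<in> T" "\<And>w. w \<in> T \<Longrightarrow> F w \<le> F y0"
    using usc_attains_max[OF compact _ F_usc] ysT by blast
  have F_ys: "F ys > ereal \<epsilon>"
  proof -
    have "q ys \<le> (1 - l) * A + l * B - \<epsilon> * l\<^sup>2" by (simp add: q_def t_ys P_ys algebra_simps)
    also have "\<dots> \<le> c - \<epsilon>" using \<epsilon> by (simp add: \<epsilon>_def)
    finally have "ereal \<epsilon> \<le> ereal c - ereal (q ys)" by simp
    also have "\<dots> < F ys" unfolding F_def using c(2) by (cases "g ys") auto
    finally show ?thesis .
  qed
  then have F0: "F y0 > ereal \<epsilon>" using y0(2)[OF ysT] by simp
  have F_le: "F y \<le> ereal (z - q y)" if "g y \<le> ereal z" for y z
    unfolding F_def using that by (cases "g y") auto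
  have t0: "t y0 \<noteq> 0"
  proof
    assume t: "t y0 = 0"
    have "dist y0 y1 = norm (P (y0 - y1))"
      using P_eq[of y0] t by (metis add.right_neutral add_diff_cancel_left' dist_norm scaleR_zero_left)
    then have "g y0 < ereal A" using y0(1) \<eta> by (intro \<eta>1) (auto simp: T_def)
    then have "F y0 \<le> ereal (A - q y0)" by (intro F_le) auto
    also have "\<dots> \<le> ereal 0" using K by (simp add: q_def t)
    finally have "ereal \<epsilon> < ereal 0" using F0 by (rule less_le_trans[rotated])
    then show False using \<epsilon> by simp
  qed
  have t1: "t y0 \<noteq> 1"
  proof
    assume t: "t y0 = 1"
    have "y0 - y2 = P (y0 - y1)" using P_eq[of y0] t by (simp add: d_def algebra_simps)
    then have "dist y0 y2 = norm (P (y0 - y1))" by (simp add: dist_norm)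
    then have "g y0 < ereal B" using y0(1) \<eta> by (intro \<eta>2) (auto simp: T_def)
    then have "F y0 \<le> ereal (B - q y0)" by (intro F_le) auto
    also have "\<dots> \<le> ereal \<epsilon>" using K by (simp add: q_def t)
    finally show False using F0 by simp
  qed
  have n0: "norm (P (y0 - y1)) \<noteq> \<eta>"
  proof
    assume n: "norm (P (y0 - y1)) = \<eta>"
    have tt: "0 \<le> t y0" "t y0 \<le> 1" using y0(1) by (auto simp: T_def)
    have "K * \<eta>\<^sup>2 = \<bar>M\<bar> + \<bar>A\<bar> + \<bar>B\<bar> + 1" using \<eta> by (simp add: K_def)
    moreover have "- \<bar>A\<bar> - \<bar>B\<bar> \<le> A + t y0 * (B - A)"
    proof -
      have "(1 - t y0) * (- \<bar>A\<bar>) \<le> (1 - t y0) * A" using tt by (intro mult_left_mono) auto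
      moreover have "t y0 * (- \<bar>B\<bar>) \<le> t y0 * B" using tt by (intro mult_left_mono) auto
      moreover have "- \<bar>A\<bar> \<le> (1 - t y0) * (- \<bar>A\<bar>)" "- \<bar>B\<bar> \<le> t y0 * (- \<bar>B\<bar>)"
        using mult_left_le_one_le[of "\<bar>A\<bar>" "1 - t y0"] mult_left_le_one_le[of "\<bar>B\<bar>" "t y0"] tt
        unfolding mult_minus_right by auto
      ultimately show ?thesis by (simp add: algebra_simps)
    qed
    moreover have "\<epsilon> * (t y0)\<^sup>2 \<le> \<epsilon>" using \<epsilon> tt by (simp add: mult_left_le power_le_one)
    ultimately have "M - q y0 \<le> \<epsilon>" unfolding q_def n by linarith
    moreover have "F y0 \<le> ereal (M - q y0)" using gM[OF y0(1)] by (intro F_le) auto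
    ultimately show False using F0 by (meson ereal_less_eq(3) leD order_trans)
  qed
  have y0U: "y0 \<in> U" using y0 TU by blast
  have "g y0 \<noteq> -\<infinity>" using F0 by (auto simp: F_def)
  with g_less_inf[OF y0U] obtain v where v: "g y0 = ereal v" by (cases "g y0") auto
  define p0 where "p0 = P (y0 - y1)"
  \<comment> \<open>The gradient of \<open>q\<close> at \<open>y0\<close>; its second part is the
    transposed projection applied to \<open>p0\<close>.\<close>
  define pp where "pp = (B - A - 2 * \<epsilon> * t y0) *\<^sub>R k + (2 * K) *\<^sub>R (p0 - (p0 \<bullet> d) *\<^sub>R k)"
  have q_diff: "q (y0 + h) - q y0 = pp \<bullet> h - \<epsilon> * (k \<bullet> h)\<^sup>2 + K * (norm (P h))\<^sup>2" for h
  proof -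
    have th: "t (y0 + h) = t y0 + k \<bullet> h" by (simp add: t_def inner_add_right inner_diff_right)
    have "P (y0 + h - y1) = p0 + P h" unfolding p0_def by (simp flip: P_add add: algebra_simps)
    define X where "X = (p0 - (p0 \<bullet> d) *\<^sub>R k) \<bullet> h"
    have "p0 \<bullet> P h = X"
      by (simp add: X_def P_def inner_diff_left inner_diff_right mult.commute)
    then have n2: "(norm (P (y0 + h - y1)))\<^sup>2 = (norm p0)\<^sup>2 + 2 * X + (norm (P h))\<^sup>2"
      unfolding \<open>P (y0 + h - y1) = p0 + P h\<close> power2_norm_eq_inner
      by (simp add: inner_add_left inner_add_right inner_commute[of "P h" p0])
    have pph: "pp \<bullet> h = (B - A - 2 * \<epsilon> * t y0) * (k \<bullet> h) + 2 * K * X"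
      by (simp add: pp_def inner_add_left X_def)
    show ?thesis unfolding q_def th n2 pph p0_def[symmetric]
      by (simp add: power2_eq_square algebra_simps)
  qed
  have evT: "eventually (\<lambda>h. y0 + h \<in> T) (nhds 0)"
  proof -
    define W where "W = {y. 0 < t y} \<inter> {y. t y < 1} \<inter> {y. norm (P (y - y1)) < \<eta>}"
    have "open W" unfolding W_def
      by (intro open_Int open_Collect_less cont_t cont_P continuous_intros)
    moreover have "y0 \<in> W" using y0(1) t0 t1 n0 by (auto simp: W_def T_def)
    moreover have "((\<lambda>h. y0 + h) \<longlongrightarrow> y0 + 0) (nhds 0)" by (intro tendsto_intros filterlim_ident)
    ultimately have "eventually (\<lambda>h. y0 + h \<in> W) (nhds 0)" by (intro topological_tendstoD) auto
    then show ?thesis by (rule eventually_mono) (auto simp: W_def T_def)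
  qed
  have "eventually (\<lambda>h. g (y0 + h) \<le> ereal (v + pp \<bullet> h - \<epsilon> * (k \<bullet> h)\<^sup>2 + K * (norm (h - (k \<bullet> h) *\<^sub>R d))\<^sup>2)) (nhds 0)"
    using evT
  proof eventually_elim
    case (elim h)
    have "F (y0 + h) \<le> F y0" using y0(2)[OF elim] .
    then have "g (y0 + h) \<le> ereal (v + (q (y0 + h) - q y0))"
      unfolding F_def v by (cases "g (y0 + h)") auto
    then show ?case unfolding q_diff by (simp add: P_def algebra_simps)
  qed
  from no_touching[OF y0U v kd \<epsilon> K this] show False .
qed

text \<open>If \<open>g y = -\<infinity>\<close>, prolong the segment from \<open>y\<close> through
  any \<open>x\<close> in \<open>U\<close> a little: convexity, with arbitrarily negative bounds at
  \<open>y\<close>, makes \<open>g x\<close> equal to -\<infinity> too. Monotonicity then carries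
  this to the coordinate hyperplanes, against the existence of a value other than
  -\<infinity>.\<close>

lemma g_not_minf:
  assumes y: "y \<in> U" shows "g y \<noteq> -\<infinity>"
proof
  assume ym: "g y = -\<infinity>"
  have all: "g x = -\<infinity>" if x: "x \<in> U" for x
  proof -
    have "((\<lambda>s. x + s *\<^sub>R (x - y)) \<longlongrightarrow> x + 0 *\<^sub>R (x - y)) (at_right (0::real))" by (intro tendsto_intros)
    then have "eventually (\<lambda>s. x + s *\<^sub>R (x - y) \<in> U) (at_right (0::real))"
      by (rule topological_tendstoD) (use open_U x in auto)
    from eventually_happens[OF eventually_conj[OF this eventually_at_right_less]]
    obtain s :: real where s: "x + s *\<^sub>R (x - y) \<in> U" "s > 0" by auto
    define l where "l = 1 / (1 + s)"
    have l: "0 < l" "l < 1" using s by (auto simp: l_def)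
    have ls: "l + l * s = 1" using s by (simp add: l_def field_simps)
    have xe: "x = (1 - l) *\<^sub>R y + l *\<^sub>R (x + s *\<^sub>R (x - y))"
    proof -
      have "(1 - l) *\<^sub>R y + l *\<^sub>R (x + s *\<^sub>R (x - y)) = (1 - l - l * s) *\<^sub>R y + (l + l * s) *\<^sub>R x"
        by (simp add: algebra_simps)
      moreover have "1 - l - l * s = 0" using ls by simp
      ultimately show ?thesis using ls by simp
    qed
    obtain B where B: "g (x + s *\<^sub>R (x - y)) < ereal B"
      using ereal_dense2[OF g_less_inf[OF s(1)]] by blast
    have "g x \<le> ereal z" for z
    proof -
      define A where "A = (z - l * B) / (1 - l)"
      have "g x \<le> ereal ((1 - l) * A + l * B)"
        by (subst xe, rule g_convex_strict[OF y s(1) _ B l]) (simp add: ym)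
      also have "(1 - l) * A + l * B = z" using l by (simp add: A_def)
      finally show ?thesis .
    qed
    then show ?thesis by (rule ereal_bot)
  qed
  obtain z where z: "z \<in> polydisk r" "\<phi> z \<noteq> -\<infinity>" using psh unfolding psh_on_def by blast
  define m where "m = Max (range (\<lambda>i. norm (z $ i)))"
  define \<rho> where "\<rho> = (max m 0 + r) / 2"
  have "m \<in> range (\<lambda>i. norm (z $ i))" unfolding m_def by (intro Max_in) auto
  then have "m < r" using z(1) by (auto simp: polydisk_def)
  have mi: "norm (z $ i) \<le> m" for i unfolding m_def by (intro Max_ge) auto
  have \<rho>: "\<rho> > 0" "\<rho> < r" "m \<le> \<rho>" using r \<open>m < r\<close> by (auto simp: \<rho>_def max_def)
  define x :: "real ^ 'n" where "x = (\<chi> i. ln \<rho>)"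
  have x: "x \<in> U" using \<rho> r by (auto simp: x_def U_def)
  have "\<phi> z \<le> \<phi> (expv x)"
    using mi \<rho> by (intro mono[OF z(1) expv_in[OF x]]) (auto simp: x_def intro: order_trans)
  also have "\<phi> (expv x) = -\<infinity>" using all[OF x] by (simp add: g_def assoc_convex_expv)
  finally show False using z(2) by simp
qed

section \<open>The finite convex function, its subgradients and the Newton body\<close>

definition G :: "real ^ 'n \<Rightarrow> real" where "G y = real_of_ereal (g y)"

lemma g_eq_G: "y \<in> U \<Longrightarrow> g y = ereal (G y)"
  using g_not_minf[of y] g_less_inf[of y] unfolding G_def by (cases "g y") auto

lemma convex_G: "convex_on U G"
proof (rule convex_onI[OF _ convex_U])
  fix l x y assume l: "0 < l" "l < (1::real)" and xy: "x \<in> U" "y \<in> U"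
  have in_U: "(1 - l) *\<^sub>R x + l *\<^sub>R y \<in> U" using convex_U xy l by (auto intro: convexD)
  show "G ((1 - l) *\<^sub>R x + l *\<^sub>R y) \<le> (1 - l) * G x + l * G y"
  proof (rule field_le_epsilon)
    fix e :: real assume e: "e > 0"
    have "g ((1 - l) *\<^sub>R x + l *\<^sub>R y) \<le> ereal ((1 - l) * (G x + e) + l * (G y + e))"
      using e by (intro g_convex_strict xy l) (auto simp: g_eq_G xy)
    then show "G ((1 - l) *\<^sub>R x + l *\<^sub>R y) \<le> (1 - l) * G x + l * G y + e"
      unfolding g_eq_G[OF in_U] by (simp add: algebra_simps)
  qed
qed

lemma G_mono: "x \<in> U \<Longrightarrow> y \<in> U \<Longrightarrow> (\<And>i. x $ i \<le> y $ i) \<Longrightarrow> G x \<le> G y"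
  using g_mono[of x y] by (simp add: g_eq_G)

end

text \<open>Separate \<open>(x, f x)\<close> from the strict epigraph. The hyperplane is not
  vertical because \<open>S\<close> contains a neighbourhood of \<open>x\<close>.\<close>

lemma convex_on_subgradient:
  fixes f :: "'a::euclidean_space \<Rightarrow> real"
  assumes f: "convex_on S f" and S: "open S" and x: "x \<in> S"
  obtains v where "\<And>y. y \<in> S \<Longrightarrow> f x + v \<bullet> (y - x) \<le> f y"
proof -
  have cS: "convex S" using f by (rule convex_on_imp_convex)
  define E where "E = {(y, t). y \<in> S \<and> f y < t}"
  have "convex E"
  proof (rule convexI)
    fix a b :: "'a \<times> real" and u v :: real
    assume a: "a \<in> E" and b: "b \<in> E" and uv: "0 \<le> u" "0 \<le> v" "u + v = 1"
    have "f (u *\<^sub>R fst a + v *\<^sub>R fst b) \<le> u * f (fst a) + v * f (fst b)"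
      using a b uv f unfolding convex_on_def by (auto simp: E_def)
    also have "\<dots> < u * snd a + v * snd b"
    proof (cases "u = 0")
      case True
      then show ?thesis using uv b by (auto simp: E_def)
    next
      case False
      then show ?thesis using uv a b
        by (intro add_less_le_mono mult_strict_left_mono mult_left_mono) (auto simp: E_def)
    qed
    finally show "u *\<^sub>R a + v *\<^sub>R b \<in> E"
      using convexD[OF cS _ _ uv, of "fst a" "fst b"] a b by (auto simp: E_def split: prod.splits)
  qed
  moreover have "E \<noteq> {}" using x by (auto simp: E_def intro!: exI[of _ x] exI[of _ "f x + 1"])
  moreover have "{(x, f x)} \<inter> E = {}" by (auto simp: E_def)
  ultimately obtain w \<beta> where w: "w \<noteq> 0" "w \<bullet> (x, f x) \<le> \<beta>" "\<And>z. z \<in> E \<Longrightarrow> \<beta> \<le> w \<bullet> z"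
    using separating_hyperplane_sets[of "{(x, f x)}" E] by (metis convex_singleton empty_not_insert singletonI)
  obtain a \<alpha> where wa: "w = (a, \<alpha>)" by (cases w)
  have sep: "a \<bullet> x + \<alpha> * f x \<le> a \<bullet> y + \<alpha> * t" if "y \<in> S" "f y < t" for y t
    using w(2) w(3)[of "(y, t)"] that by (auto simp: wa E_def)
  have \<alpha>0: "\<alpha> \<ge> 0" using sep[OF x, of "f x + 1"] by (simp add: algebra_simps)
  have "\<alpha> \<noteq> 0"
  proof
    assume z: "\<alpha> = 0"
    then have a0: "a \<noteq> 0" using w(1) wa by (auto simp: zero_prod_def)
    have "((\<lambda>s. x - s *\<^sub>R a) \<longlongrightarrow> x - 0 *\<^sub>R a) (at_right (0::real))" by (intro tendsto_intros)
    then have "eventually (\<lambda>s. x - s *\<^sub>R a \<in> S) (at_right (0::real))"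
      by (rule topological_tendstoD) (use S x in auto)
    from eventually_happens[OF eventually_conj[OF this eventually_at_right_less]]
    obtain s :: real where s: "x - s *\<^sub>R a \<in> S" "s > 0" by auto
    have "s * (a \<bullet> a) \<le> 0" using sep[OF s(1), of "f (x - s *\<^sub>R a) + 1"] z by (simp add: inner_diff_right)
    moreover have "s * (a \<bullet> a) > 0" using s a0 by simp
    ultimately show False by simp
  qed
  with \<alpha>0 have \<alpha>: "\<alpha> > 0" by simp
  have "f x + (- (1 / \<alpha>) *\<^sub>R a) \<bullet> (y - x) \<le> f y" if y: "y \<in> S" for y
  proof (rule field_le_epsilon)
    fix e :: real assume "e > 0"
    then have "a \<bullet> x + \<alpha> * f x \<le> a \<bullet> y + \<alpha> * (f y + e)" using sep[OF y, of "f y + e"] by simp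
    then have "\<alpha> * (f x + (- (1 / \<alpha>) *\<^sub>R a) \<bullet> (y - x)) \<le> \<alpha> * (f y + e)"
      using \<alpha> by (simp add: algebra_simps inner_diff_right)
    then show "f x + (- (1 / \<alpha>) *\<^sub>R a) \<bullet> (y - x) \<le> f y + e" using \<alpha> by (simp add: mult_le_cancel_left_pos)
  qed
  then show ?thesis using that by blast
qed

context toric_fun
begin

abbreviation NB :: "(real ^ 'n) set" where "NB \<equiv> newton_body r \<phi>"

lemma NB_iff: "x \<in> NB \<longleftrightarrow> (\<exists>C. \<forall>y\<in>U. x \<bullet> y - G y \<le> C)"
proof -
  have "ereal (x \<bullet> y) - assoc_convex \<phi> y \<le> ereal C \<longleftrightarrow> x \<bullet> y - G y \<le> C" if "y \<in> U" for C y
    using g_eq_G[OF that] by (simp add: g_def)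
  then show ?thesis unfolding newton_body_def by (auto simp: U_def)
qed

text \<open>For a subgradient \<open>x\<close> at \<open>y\<close> the function
  \<open>x \<bullet> z - G z\<close> is largest at \<open>z = y\<close>, hence bounded. Linear
  bounds on the Newton body thereby become growth bounds on \<open>G\<close>.\<close>

lemma subgradient:
  assumes "y \<in> U"
  obtains x where "x \<in> NB" "\<And>z. z \<in> U \<Longrightarrow> G y + x \<bullet> (z - y) \<le> G z"
proof -
  obtain x where x: "\<And>z. z \<in> U \<Longrightarrow> G y + x \<bullet> (z - y) \<le> G z"
    using convex_on_subgradient[OF convex_G open_U assms] by blast
  have "x \<bullet> z - G z \<le> x \<bullet> y - G y" if "z \<in> U" for z
    using x[OF that] by (simp add: inner_diff_right)
  then have "x \<in> NB" unfolding NB_iff by blast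
  then show ?thesis using x that by blast
qed

lemma U_nonempty: "(\<chi> i. ln r - 1) \<in> U"
  by (simp add: U_def)

lemma NB_nonempty: "NB \<noteq> {}"
  using subgradient[OF U_nonempty] by blast

lemma convex_NB: "convex NB"
proof (rule convexI)
  fix x y and u v :: real assume x: "x \<in> NB" and y: "y \<in> NB" and uv: "0 \<le> u" "0 \<le> v" "u + v = 1"
  obtain C D where CD: "\<And>z. z \<in> U \<Longrightarrow> x \<bullet> z - G z \<le> C" "\<And>z. z \<in> U \<Longrightarrow> y \<bullet> z - G z \<le> D"
    using x y unfolding NB_iff by blast
  have "(u *\<^sub>R x + v *\<^sub>R y) \<bullet> z - G z \<le> u * C + v * D" if "z \<in> U" for z
  proof -
    have "(u *\<^sub>R x + v *\<^sub>R y) \<bullet> z - (u + v) * G z = u * (x \<bullet> z - G z) + v * (y \<bullet> z - G z)"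
      by (simp add: inner_add_left algebra_simps)
    also have "\<dots> \<le> u * C + v * D" using CD that uv by (intro add_mono mult_left_mono) auto
    finally show ?thesis using uv by simp
  qed
  then show "u *\<^sub>R x + v *\<^sub>R y \<in> NB" unfolding NB_iff by blast
qed

lemma NB_up:
  assumes x: "x \<in> NB" and le: "\<And>i. x $ i \<le> y $ i"
  shows "y \<in> NB"
proof -
  obtain C where C: "\<And>z. z \<in> U \<Longrightarrow> x \<bullet> z - G z \<le> C" using x unfolding NB_iff by blast
  have "y \<bullet> z - G z \<le> C + (y - x) \<bullet> (\<chi> i. ln r)" if z: "z \<in> U" for z
  proof -
    have "(y - x) \<bullet> z \<le> (y - x) \<bullet> (\<chi> i. ln r)"
      using z le by (intro inner_le_nonneg) (auto simp: U_def less_imp_le)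
    then show ?thesis using C[OF z] by (simp add: inner_diff_left)
  qed
  then show ?thesis unfolding NB_iff by blast
qed

text \<open>Along \<open>- axis i 1\<close> the increasing function \<open>G\<close> does not grow,
  so a negative coordinate would make \<open>x \<bullet> y - G y\<close> unbounded.\<close>

lemma NB_nonneg:
  assumes x: "x \<in> NB" shows "0 \<le> x $ i"
proof (rule ccontr)
  assume neg: "\<not> 0 \<le> x $ i"
  obtain C where C: "\<And>z. z \<in> U \<Longrightarrow> x \<bullet> z - G z \<le> C" using x unfolding NB_iff by blast
  define y :: "real ^ 'n" where "y = (\<chi> i. ln r - 1)"
  define s where "s = (\<bar>C + G y - x \<bullet> y\<bar> + 1) / (- (x $ i))"
  have s: "s > 0" using neg by (auto simp: s_def divide_simps)
  have yU: "y - s *\<^sub>R axis i 1 \<in> U" using s by (auto simp: y_def U_def axis_def)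
  have "G (y - s *\<^sub>R axis i 1) \<le> G y"
    using s U_nonempty by (intro G_mono[OF yU]) (auto simp: y_def axis_def)
  then have "x \<bullet> y - s * (x $ i) \<le> C + G y"
    using C[OF yU] by (simp add: inner_diff_right inner_axis)
  moreover have "s * (x $ i) = - (\<bar>C + G y - x \<bullet> y\<bar> + 1)" using neg by (simp add: s_def)
  ultimately show False by linarith
qed

end

subsection \<open>Integrability of monomials\<close>

lemma measurable_vec_lambda_PiM:
  "(\<lambda>f. \<chi> i. f i) \<in> (\<Pi>\<^sub>M i\<in>UNIV. (lborel :: 'a::euclidean_space measure)) \<rightarrow>\<^sub>M (borel :: ('a ^ 'n) measure)"
proof (subst borel_measurable_euclidean_space, safe)
  fix e :: "'a ^ 'n" assume "e \<in> Basis"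
  then obtain i b where e: "e = axis i b" by (auto simp: Basis_vec_def)
  have "(\<lambda>f::'n \<Rightarrow> 'a. f i \<bullet> b) \<in> borel_measurable (\<Pi>\<^sub>M i\<in>UNIV. lborel)"
    by measurable
  then show "(\<lambda>f. (\<chi> i. f i) \<bullet> e) \<in> borel_measurable (\<Pi>\<^sub>M i\<in>(UNIV::'n set). (lborel :: 'a measure))"
    by (simp add: e inner_axis)
qed

text \<open>Lebesgue measure is determined by boxes, and the volume of a box factors over the
  coordinates and then over the basis of each of them.\<close>

lemma lborel_vec_eq_PiM:
  "(lborel :: ('a::euclidean_space ^ 'n) measure) = distr (\<Pi>\<^sub>M i\<in>UNIV. lborel) borel (\<lambda>f. \<chi> i. f i)"
proof (rule lborel_eqI)
  interpret product_sigma_finite "\<lambda>_ :: 'n. lborel :: 'a measure"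
    by standard
  fix l u :: "'a ^ 'n" assume le: "\<And>b. b \<in> Basis \<Longrightarrow> l \<bullet> b \<le> u \<bullet> b"
  have lei: "l $ i \<bullet> b \<le> u $ i \<bullet> b" if "b \<in> Basis" for i b
    using le[of "axis i b"] that by (simp add: inner_axis)
  have eq: "(\<lambda>f. \<chi> i. f i) -` box l u \<inter> space (\<Pi>\<^sub>M i\<in>UNIV. lborel) = (\<Pi>\<^sub>E i\<in>UNIV. box (l $ i) (u $ i))"
    by (auto simp: mem_box Basis_vec_def inner_axis space_PiM PiE_iff)
  have "emeasure (distr (\<Pi>\<^sub>M i\<in>UNIV. lborel) borel (\<lambda>f. \<chi> i. f i)) (box l u) = (\<Prod>i\<in>UNIV. emeasure lborel (box (l $ i) (u $ i)))"
    by (subst emeasure_distr[OF measurable_vec_lambda_PiM]) (auto simp: eq emeasure_PiM)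
  also have "\<dots> = (\<Prod>i\<in>UNIV. ennreal (\<Prod>b\<in>Basis. (u $ i - l $ i) \<bullet> b))"
    by (intro prod.cong refl emeasure_lborel_box) (use lei in auto)
  also have "\<dots> = ennreal (\<Prod>i\<in>UNIV. \<Prod>b\<in>Basis. (u $ i - l $ i) \<bullet> b)"
    by (intro prod_ennreal prod_nonneg) (use lei in \<open>auto simp: inner_diff_left\<close>)
  also have "(\<Prod>i\<in>UNIV. \<Prod>b\<in>Basis. (u $ i - l $ i) \<bullet> b) = (\<Prod>b\<in>Basis. (u - l) \<bullet> b)"
  proof -
    have "(\<Prod>b\<in>Basis. (u - l) \<bullet> b) = (\<Prod>b\<in>(\<lambda>(i, b). axis i b) ` (UNIV \<times> Basis). (u - l) \<bullet> b)"
      by (rule prod.cong) (auto simp: Basis_vec_def)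
    also have "\<dots> = (\<Prod>(i, b)\<in>UNIV \<times> Basis. (u $ i - l $ i) \<bullet> b)"
      by (subst prod.reindex) (auto simp: inj_on_def axis_eq_axis inner_axis case_prod_beta)
    also have "\<dots> = (\<Prod>i\<in>UNIV. \<Prod>b\<in>Basis. (u $ i - l $ i) \<bullet> b)"
      by (subst prod.cartesian_product) auto
    finally show ?thesis by simp
  qed
  finally show "emeasure (distr (\<Pi>\<^sub>M i\<in>UNIV. lborel) borel (\<lambda>f. \<chi> i. f i)) (box l u) = ennreal (\<Prod>b\<in>Basis. (u - l) \<bullet> b)" .
qed simp

lemma nn_integral_lborel_vec_prod:
  fixes f :: "'n::finite \<Rightarrow> 'a::euclidean_space \<Rightarrow> ennreal"
  assumes [measurable]: "\<And>i. f i \<in> borel_measurable borel"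
  shows "(\<integral>\<^sup>+ z. (\<Prod>i\<in>UNIV. f i (z $ i)) \<partial>lborel) = (\<Prod>i\<in>UNIV. \<integral>\<^sup>+ w. f i w \<partial>lborel)"
proof -
  interpret product_sigma_finite "\<lambda>_ :: 'n. lborel :: 'a measure"
    by standard
  have nth [measurable]: "(\<lambda>z :: 'a ^ 'n. z $ i) \<in> borel_measurable borel" for i
    by (intro borel_measurable_continuous_onI continuous_intros)
  have "(\<integral>\<^sup>+ z. (\<Prod>i\<in>UNIV. f i (z $ i)) \<partial>lborel) = (\<integral>\<^sup>+ g. (\<Prod>i\<in>UNIV. f i (g i)) \<partial>(\<Pi>\<^sub>M i\<in>UNIV. lborel))"
    unfolding lborel_vec_eq_PiM
    by (subst nn_integral_distr[OF measurable_vec_lambda_PiM]) auto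
  also have "\<dots> = (\<Prod>i\<in>UNIV. \<integral>\<^sup>+ w. f i w \<partial>lborel)"
    by (rule product_nn_integral_prod) auto
  finally show ?thesis .
qed

lemma emeasure_lborel_vec_prod:
  fixes A :: "'n::finite \<Rightarrow> 'a::euclidean_space set"
  assumes [measurable]: "\<And>i. A i \<in> sets borel"
  shows "{z. \<forall>i. z $ i \<in> A i} \<in> sets borel"
    and "emeasure lborel {z. \<forall>i. z $ i \<in> A i} = (\<Prod>i\<in>UNIV. emeasure lborel (A i))"
proof -
  have nth [measurable]: "(\<lambda>z :: 'a ^ 'n. z $ i) \<in> borel_measurable borel" for i
    by (intro borel_measurable_continuous_onI continuous_intros)
  have "{z :: 'a ^ 'n. \<forall>i. z $ i \<in> A i} = (\<Inter>i\<in>UNIV. (\<lambda>z. z $ i) -` A i \<inter> space borel)" by auto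
  also have "\<dots> \<in> sets borel"
    by (intro sets.finite_INT measurable_sets[OF nth]) auto
  finally show *: "{z :: 'a ^ 'n. \<forall>i. z $ i \<in> A i} \<in> sets borel" .
  have "(indicator {z :: 'a ^ 'n. \<forall>i. z $ i \<in> A i} z :: ennreal) = (\<Prod>i\<in>UNIV. indicator (A i) (z $ i))" for z
    by (auto simp: indicator_def)
  then have "emeasure lborel {z :: 'a ^ 'n. \<forall>i. z $ i \<in> A i} = (\<integral>\<^sup>+ z. (\<Prod>i\<in>UNIV. indicator (A i) (z $ i)) \<partial>lborel)"
    using * by (simp flip: nn_integral_indicator)
  also have "\<dots> = (\<Prod>i\<in>UNIV. emeasure lborel (A i))"
    by (subst nn_integral_lborel_vec_prod) auto
  finally show "emeasure lborel {z :: 'a ^ 'n. \<forall>i. z $ i \<in> A i} = (\<Prod>i\<in>UNIV. emeasure lborel (A i))" .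
qed

lemma emeasure_ball_complex: "r \<ge> 0 \<Longrightarrow> emeasure lborel (ball (c::complex) r) = ennreal (pi * r\<^sup>2)"
  by (simp add: emeasure_ball eval_unit_ball_vol)

lemma ennreal_le_suminf: "f k \<le> (\<Sum>k. f k)" for f :: "nat \<Rightarrow> ennreal"
  using sum_le_suminf[of f "{k}"] by simp

lemma ennreal_prod_mono:
  fixes f g :: "'a \<Rightarrow> ennreal"
  assumes "\<And>i. i \<in> S \<Longrightarrow> f i \<le> g i"
  shows "prod f S \<le> prod g S"
  using assms by (induction S rule: infinite_finite_induct) (auto intro: mult_mono)

lemma ennreal_prod_less_top:
  fixes f :: "'a \<Rightarrow> ennreal"
  assumes "\<And>i. i \<in> S \<Longrightarrow> f i < \<infinity>"
  shows "prod f S < \<infinity>"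
  using assms by (induction S rule: infinite_finite_induct) (auto simp: ennreal_mult_less_top)

text \<open>Dyadic decomposition of the disc.\<close>

lemma nn_integral_norm_powr_finite:
  assumes \<epsilon>: "0 < \<epsilon>" "\<epsilon> \<le> 1" and R: "R > 0"
  shows "(\<integral>\<^sup>+ (z::complex). (if z = 0 then \<infinity> else ennreal (norm z powr (2 * \<epsilon> - 2))) * indicator (ball 0 R) z \<partial>lborel) < \<infinity>"
proof -
  \<comment> \<open>The ratio of the final geometric series: from one shell to the next the
    integrand is scaled by \<open>(1/2) powr (2 * \<epsilon> - 2)\<close> and the area by 1/4. The
    bound \<open>c k\<close> uses the inner radius of the shell, the exponent being
    nonpositive.\<close>
  define q where "q = (1/2::real) powr (2 * \<epsilon>)"
  have q: "0 < q" "q < 1" using \<epsilon> powr_less_mono2[of "2 * \<epsilon>" "1/2" 1] by (auto simp: q_def)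
  define c where "c k = (R * (1/2) ^ Suc k) powr (2 * \<epsilon> - 2)" for k
  define B :: "nat \<Rightarrow> complex set" where "B k = ball 0 (R * (1/2) ^ k)" for k
  have [measurable]: "B k \<in> sets borel" for k by (simp add: B_def)
  have "(\<integral>\<^sup>+ (z::complex). (if z = 0 then \<infinity> else ennreal (norm z powr (2 * \<epsilon> - 2))) * indicator (ball 0 R) z \<partial>lborel)
     \<le> (\<integral>\<^sup>+ z. (\<Sum>k. ennreal (c k) * indicator (B k) z) \<partial>lborel)"
  proof (rule nn_integral_mono_AE)
    \<comment> \<open>The value \<infinity> at 0, which lets the function majorise weights where
      \<phi> may be -\<infinity>, sits on a null set.\<close>
    have "AE z::complex in lborel. z \<notin> {0}" by (rule AE_not_in) (auto intro: countable_imp_null_set_lborel)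
    then show "AE z::complex in lborel. (if z = 0 then \<infinity> else ennreal (norm z powr (2 * \<epsilon> - 2))) * indicator (ball 0 R) z
       \<le> (\<Sum>k. ennreal (c k) * indicator (B k) z)"
    proof eventually_elim
      case (elim z)
      show ?case
      proof (cases "z \<in> ball 0 R")
        case True
        have z0: "norm z > 0" "norm z < R" using elim True by auto
        have ex: "\<exists>n. R * (1/2) ^ n \<le> norm z"
        proof -
          obtain n where "(1/2::real) ^ n < norm z / R" using real_arch_pow_inv[of "norm z / R" "1/2"] z0 R by auto
          then show ?thesis using R by (intro exI[of _ n]) (simp add: field_simps)
        qed
        define n where "n = (LEAST n. R * (1/2) ^ n \<le> norm z)"
        have n: "R * (1/2) ^ n \<le> norm z" unfolding n_def using ex by (rule LeastI_ex)
        have "n \<noteq> 0" using n z0 by (intro notI) auto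
        then obtain k where k: "n = Suc k" by (cases n) auto
        have "\<not> R * (1/2) ^ k \<le> norm z" using not_less_Least[of k "\<lambda>n. R * (1/2) ^ n \<le> norm z"] k
          unfolding n_def by simp
        then have zB: "z \<in> B k" by (simp add: B_def)
        have "norm z powr (2 * \<epsilon> - 2) \<le> c k" unfolding c_def
          using n \<epsilon> k by (intro powr_mono2') (auto simp: R)
        then have "ennreal (norm z powr (2 * \<epsilon> - 2)) \<le> ennreal (c k) * indicator (B k) z"
          using zB by (simp add: ennreal_leI)
        also have "\<dots> \<le> (\<Sum>k. ennreal (c k) * indicator (B k) z)"
          by (rule ennreal_le_suminf)
        finally show ?thesis using z0 True by auto
      qed auto
    qed
  qed
  also have "\<dots> = (\<Sum>k. \<integral>\<^sup>+ z. ennreal (c k) * indicator (B k) z \<partial>lborel)"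
    by (rule nn_integral_suminf) measurable
  also have "\<dots> = (\<Sum>k. ennreal (c k * (pi * (R * (1/2) ^ k)\<^sup>2)))"
  proof (intro suminf_cong)
    fix k
    have "(\<integral>\<^sup>+ z. ennreal (c k) * indicator (B k) z \<partial>lborel) = ennreal (c k) * emeasure lborel (B k)"
      by (subst nn_integral_cmult_indicator) (auto simp: B_def)
    also have "emeasure lborel (B k) = ennreal (pi * (R * (1/2) ^ k)\<^sup>2)"
      unfolding B_def using R by (intro emeasure_ball_complex) auto
    finally show "(\<integral>\<^sup>+ z. ennreal (c k) * indicator (B k) z \<partial>lborel) = ennreal (c k * (pi * (R * (1/2) ^ k)\<^sup>2))"
      by (simp add: ennreal_mult c_def)
  qed
  also have "\<dots> = (\<Sum>k. ennreal ((R/2) powr (2 * \<epsilon> - 2) * pi * R\<^sup>2 * q ^ k))"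
  proof (intro suminf_cong arg_cong[where f = ennreal])
    fix k
    have pk: "((1/2::real) ^ k) powr (2 * \<epsilon> - 2) * ((1/2) ^ k)\<^sup>2 = q ^ k"
    proof -
      have "((1/2::real) ^ k)\<^sup>2 = ((1/2) ^ k) powr 2" by (simp add: powr_numeral)
      then have "((1/2::real) ^ k) powr (2 * \<epsilon> - 2) * ((1/2) ^ k)\<^sup>2 = ((1/2) ^ k) powr (2 * \<epsilon>)"
        by (simp only: powr_add[symmetric]) simp
      also have "\<dots> = q ^ k" unfolding q_def by (simp add: powr_powr powr_realpow[symmetric] mult.commute)
      finally show ?thesis .
    qed
    have "c k = (R/2) powr (2 * \<epsilon> - 2) * ((1/2::real) ^ k) powr (2 * \<epsilon> - 2)"
      unfolding c_def using R by (subst powr_mult[symmetric]) auto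
    then show "c k * (pi * (R * (1/2) ^ k)\<^sup>2) = (R/2) powr (2 * \<epsilon> - 2) * pi * R\<^sup>2 * q ^ k"
      unfolding pk[symmetric] by (simp add: power_mult_distrib)
  qed
  also have "\<dots> < \<infinity>"
  proof -
    have "summable (\<lambda>k. (R/2) powr (2 * \<epsilon> - 2) * pi * R\<^sup>2 * q ^ k)"
      using q by (intro summable_mult summable_geometric) auto
    then show ?thesis by (subst suminf_ennreal2) (use q in auto)
  qed
  finally show ?thesis .
qed

section \<open>Monomials against the weight, near an arbitrary point\<close>

definition mon :: "('n::finite \<Rightarrow> nat) \<Rightarrow> complex ^ 'n \<Rightarrow> complex" where
  "mon a z = (\<Prod>i\<in>UNIV. (z $ i) ^ a i)"

definition polybox :: "complex ^ 'n \<Rightarrow> real \<Rightarrow> (complex ^ 'n) set" where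
  "polybox x \<delta> = {z. \<forall>i. cmod (z $ i - x $ i) < \<delta>}"

lemma open_polybox: "open (polybox x \<delta>)"
proof -
  have "polybox x \<delta> = (\<Inter>i\<in>UNIV. {z. cmod (z $ i - x $ i) < \<delta>})"
    by (auto simp: polybox_def)
  also have "open \<dots>" by (intro open_INT finite ballI open_Collect_less continuous_intros)
  finally show ?thesis .
qed

lemma polybox_subset_open:
  assumes V: "open V" "x \<in> V"
  obtains \<delta> where "\<delta> > 0" "polybox x \<delta> \<subseteq> V"
proof -
  obtain e where e: "e > 0" "ball x e \<subseteq> V" using V open_contains_ball by blast
  define \<delta> where "\<delta> = e / real CARD('a)"
  have "polybox x \<delta> \<subseteq> ball x e"
  proof
    fix z assume z: "z \<in> polybox x \<delta>"
    have "norm (z - x) \<le> (\<Sum>i\<in>UNIV. norm ((z - x) $ i))"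
      unfolding norm_vec_def by (rule L2_set_le_sum) auto
    also have "\<dots> < (\<Sum>i\<in>(UNIV::'a set). \<delta>)"
      using z by (intro sum_strict_mono) (auto simp: polybox_def)
    also have "\<dots> = e" by (simp add: \<delta>_def)
    finally show "z \<in> ball x e" by (simp add: dist_norm norm_minus_commute)
  qed
  then show ?thesis using that[of \<delta>] e by (auto simp: \<delta>_def)
qed

lemma weight_ereal [simp]: "weight (ereal v) = ennreal (exp (- 2 * v))"
  by (simp add: weight_def)

lemma weight_antimono: "u \<le> v \<Longrightarrow> weight v \<le> weight u"
  by (cases u; cases v) (auto simp: weight_def intro: ennreal_leI)

text \<open>In the coordinates with \<open>x\<^sub>i \<noteq> 0\<close> the exponent is irrelevant near \<open>x\<close>; it may be shifted by any \<open>k\<close>.\<close>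

definition shifted_exp :: "complex ^ 'n \<Rightarrow> ('n \<Rightarrow> nat) \<Rightarrow> real \<Rightarrow> real ^ 'n" where
  "shifted_exp x a k = (\<chi> i. real (a i) + 1 + (if x $ i = 0 then 0 else k))"

context toric_fun
begin

definition logv :: "complex ^ 'n \<Rightarrow> real ^ 'n" where
  "logv z = (\<chi> i. ln (cmod (z $ i)))"

lemma logv_in_U: "z \<in> polydisk r \<Longrightarrow> (\<And>i. z $ i \<noteq> 0) \<Longrightarrow> logv z \<in> U"
  using r by (auto simp: logv_def U_def polydisk_def)

lemma phi_logv: "z \<in> polydisk r \<Longrightarrow> (\<And>i. z $ i \<noteq> 0) \<Longrightarrow> \<phi> z = ereal (G (logv z))"
  using logv_in_U[of z] by (subst g_eq_G[symmetric]) (auto simp: logv_def intro: g_phi)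

text \<open>Lowering every exponent by \<epsilon> turns the bound on \<open>G\<close> into a product
  of one-variable majorants: \<open>cmod w powr (2 * \<epsilon> - 2)\<close>, integrable in the
  plane, where \<open>x\<close> vanishes, and a constant elsewhere. All small radii are covered so
  that finitely many exponents can later share one.\<close>

lemma interior_NB_imp_integrable:
  assumes x: "x \<in> polydisk r" and e: "shifted_exp x a k \<in> interior NB" and k: "k \<ge> 0"
  obtains \<delta>0 where "\<delta>0 > 0" "polybox x \<delta>0 \<subseteq> polydisk r"
    "\<And>\<delta>. 0 < \<delta> \<Longrightarrow> \<delta> \<le> \<delta>0 \<Longrightarrow> (\<integral>\<^sup>+ z. ennreal ((cmod (mon a z))\<^sup>2) * weight (\<phi> z) * indicator (polybox x \<delta>) z \<partial>lborel) < \<infinity>"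
proof -
  let ?e = "shifted_exp x a k"
  define one :: "real ^ 'n" where "one = (\<chi> i. 1)"
  have "((\<lambda>s. ?e - s *\<^sub>R one) \<longlongrightarrow> ?e - 0 *\<^sub>R one) (at_right (0::real))" by (intro tendsto_intros)
  then have ev: "eventually (\<lambda>s. ?e - s *\<^sub>R one \<in> interior NB) (at_right (0::real))"
    by (rule topological_tendstoD) (use e in auto)
  have "eventually (\<lambda>s. s < 1) (at_right (0::real))"
    by (rule order_tendstoD(2)[OF tendsto_ident_at]) simp
  from eventually_happens[OF eventually_conj[OF ev eventually_conj[OF this eventually_at_right_less]]]
  obtain \<epsilon> where \<epsilon>: "?e - \<epsilon> *\<^sub>R one \<in> interior NB" "0 < \<epsilon>" "\<epsilon> < 1" by auto
  then have "?e - \<epsilon> *\<^sub>R one \<in> NB" using interior_subset by blast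
  then obtain C where C: "\<And>y. y \<in> U \<Longrightarrow> (?e - \<epsilon> *\<^sub>R one) \<bullet> y - G y \<le> C" unfolding NB_iff by blast
  obtain \<delta>1 where \<delta>1: "\<delta>1 > 0" "polybox x \<delta>1 \<subseteq> polydisk r"
    using polybox_subset_open[OF open_polydisk x] by blast
  \<comment> \<open>Half of \<open>cmod (x $ i)\<close> keeps the nonzero coordinates of
    \<open>x\<close> bounded away from 0 on the polydisc.\<close>
  define \<delta>0 where "\<delta>0 = Min (insert \<delta>1 ((\<lambda>i. cmod (x $ i) / 2) ` {i. x $ i \<noteq> 0}))"
  have \<delta>0_le: "\<delta>0 \<le> \<delta>1" "x $ i \<noteq> 0 \<Longrightarrow> \<delta>0 \<le> cmod (x $ i) / 2" for i
  proof -
    show "\<delta>0 \<le> \<delta>1" unfolding \<delta>0_def by (intro Min_le) auto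
    assume "x $ i \<noteq> 0"
    then show "\<delta>0 \<le> cmod (x $ i) / 2" unfolding \<delta>0_def by (intro Min_le) auto
  qed
  have \<delta>0: "\<delta>0 > 0" unfolding \<delta>0_def using \<delta>1 by (subst Min_gr_iff) auto
  have sub: "polybox x \<delta> \<subseteq> polydisk r" if "\<delta> \<le> \<delta>0" for \<delta>
  proof -
    have "polybox x \<delta> \<subseteq> polybox x \<delta>1"
      using that \<delta>0_le(1) by (auto simp: polybox_def intro: less_le_trans)
    then show ?thesis using \<delta>1(2) by blast
  qed
  \<comment> \<open>The bound for the factor of a nonvanishing coordinate: its exponent is negative
    because \<open>k \<ge> 0\<close>, so the smallest modulus is the worst case.\<close>
  define K where "K i = (cmod (x $ i) / 2) powr (2 * \<epsilon> - 2 - 2 * k)" for i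
  define f :: "real \<Rightarrow> 'n \<Rightarrow> complex \<Rightarrow> ennreal" where
    "f \<delta> i w = (if x $ i = 0 then (if w = 0 then \<infinity> else ennreal (cmod w powr (2 * \<epsilon> - 2))) * indicator (ball 0 \<delta>) w
                else ennreal (K i) * indicator (ball (x $ i) \<delta>) w)" for \<delta> i w
  have "(\<integral>\<^sup>+ z. ennreal ((cmod (mon a z))\<^sup>2) * weight (\<phi> z) * indicator (polybox x \<delta>) z \<partial>lborel) < \<infinity>"
    if \<delta>: "0 < \<delta>" "\<delta> \<le> \<delta>0" for \<delta>
  proof -
    have nz: "z $ i \<noteq> 0 \<and> cmod (x $ i) / 2 \<le> cmod (z $ i)" if "z \<in> polybox x \<delta>" "x $ i \<noteq> 0" for z i
    proof -
      have "cmod (x $ i) \<le> cmod (z $ i) + cmod (z $ i - x $ i)"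
        by (metis add.commute norm_minus_commute norm_triangle_sub)
      moreover have "cmod (z $ i - x $ i) < cmod (x $ i) / 2"
        using that(1) \<delta> \<delta>0_le(2)[OF that(2)] by (auto simp: polybox_def dest!: spec[of _ i])
      moreover have "0 < cmod (x $ i)" using that(2) by simp
      ultimately show ?thesis by auto
    qed
    have "(\<integral>\<^sup>+ z. ennreal ((cmod (mon a z))\<^sup>2) * weight (\<phi> z) * indicator (polybox x \<delta>) z \<partial>lborel)
       \<le> (\<integral>\<^sup>+ z. ennreal (exp (2 * C)) * (\<Prod>i\<in>UNIV. f \<delta> i (z $ i)) \<partial>lborel)"
    proof (rule nn_integral_mono)
      fix z :: "complex ^ 'n"
      show "ennreal ((cmod (mon a z))\<^sup>2) * weight (\<phi> z) * indicator (polybox x \<delta>) z \<le> ennreal (exp (2 * C)) * (\<Prod>i\<in>UNIV. f \<delta> i (z $ i))"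
      proof (cases "z \<in> polybox x \<delta>")
        case zD: True
        have ind: "x $ i = 0 \<Longrightarrow> indicator (ball 0 \<delta>) (z $ i) = (1::ennreal)"
             "indicator (ball (x $ i) \<delta>) (z $ i) = (1::ennreal)" for i
          using zD by (auto simp: polybox_def dist_norm norm_minus_commute dest!: spec[of _ i])
        have fpos: "f \<delta> i (z $ i) \<noteq> 0" for i
          using ind[of i] by (auto simp: f_def K_def)
        show ?thesis
        proof (cases "\<exists>i. z $ i = 0")
          case True
          \<comment> \<open>The weight may be infinite here; the factor of the majorant at
            \<open>i\<close> is \<infinity> and the others do not vanish.\<close>
          then obtain i where i: "z $ i = 0" by blast
          then have "x $ i = 0" using nz[OF zD] by blast
          then have "f \<delta> i (z $ i) = \<infinity>" using i \<delta> by (simp add: f_def)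
          moreover have "(\<Prod>i\<in>UNIV - {i}. f \<delta> i (z $ i)) \<noteq> 0" using fpos by simp
          ultimately have "(\<Prod>i\<in>UNIV. f \<delta> i (z $ i)) = \<infinity>"
            by (subst prod.remove[of _ i]) (auto simp: ennreal_top_mult)
          then show ?thesis by (simp add: ennreal_mult_top)
        next
          case False
          then have z0: "z $ i \<noteq> 0" for i by blast
          let ?y = "logv z"
          have zr: "z \<in> polydisk r" using sub[OF \<delta>(2)] zD by blast
          have yU: "?y \<in> U" by (rule logv_in_U[OF zr z0])
          have m: "(cmod (mon a z))\<^sup>2 = exp (2 * (\<Sum>i\<in>UNIV. real (a i) * ?y $ i))"
          proof -
            have "cmod (mon a z) = (\<Prod>i\<in>UNIV. exp (real (a i) * ?y $ i))"
              unfolding mon_def prod_norm[symmetric]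
              by (intro prod.cong) (auto simp: norm_power logv_def z0 exp_of_nat_mult)
            also have "\<dots> = exp (\<Sum>i\<in>UNIV. real (a i) * ?y $ i)" by (simp add: exp_sum)
            finally show ?thesis by (simp add: exp_double)
          qed
          have eC: "(?e - \<epsilon> *\<^sub>R one) \<bullet> ?y = (\<Sum>i\<in>UNIV. (real (a i) + 1 + (if x $ i = 0 then 0 else k) - \<epsilon>) * ?y $ i)"
            by (simp add: inner_vec_def shifted_exp_def one_def)
          have "(cmod (mon a z))\<^sup>2 * exp (- 2 * G ?y) \<le> exp (2 * C) * exp (2 * (\<Sum>i\<in>UNIV. (\<epsilon> - 1 - (if x $ i = 0 then 0 else k)) * ?y $ i))"
          proof -
            have "2 * (\<Sum>i\<in>UNIV. real (a i) * ?y $ i) - 2 * G ?y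
               = 2 * ((?e - \<epsilon> *\<^sub>R one) \<bullet> ?y - G ?y) + 2 * (\<Sum>i\<in>UNIV. (\<epsilon> - 1 - (if x $ i = 0 then 0 else k)) * ?y $ i)"
            proof -
              have "(\<Sum>i\<in>UNIV. real (a i) * ?y $ i) = (?e - \<epsilon> *\<^sub>R one) \<bullet> ?y + (\<Sum>i\<in>UNIV. (\<epsilon> - 1 - (if x $ i = 0 then 0 else k)) * ?y $ i)"
                unfolding eC sum.distrib[symmetric] by (intro sum.cong) (auto simp: algebra_simps)
              then show ?thesis by simp
            qed
            also have "\<dots> \<le> 2 * C + 2 * (\<Sum>i\<in>UNIV. (\<epsilon> - 1 - (if x $ i = 0 then 0 else k)) * ?y $ i)"
              using C[OF yU] by simp
            finally show ?thesis unfolding m by (simp flip: exp_add add: algebra_simps)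
          qed
          also have "exp (2 * (\<Sum>i\<in>UNIV. (\<epsilon> - 1 - (if x $ i = 0 then 0 else k)) * ?y $ i)) = (\<Prod>i\<in>UNIV. cmod (z $ i) powr (2 * \<epsilon> - 2 - 2 * (if x $ i = 0 then 0 else k)))"
          proof -
            have "exp (2 * (\<Sum>i\<in>UNIV. (\<epsilon> - 1 - (if x $ i = 0 then 0 else k)) * ?y $ i)) = (\<Prod>i\<in>UNIV. exp (2 * ((\<epsilon> - 1 - (if x $ i = 0 then 0 else k)) * ?y $ i)))"
              by (simp add: sum_distrib_left exp_sum)
            also have "\<dots> = (\<Prod>i\<in>UNIV. cmod (z $ i) powr (2 * \<epsilon> - 2 - 2 * (if x $ i = 0 then 0 else k)))"
              by (intro prod.cong) (auto simp: powr_def z0 logv_def algebra_simps)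
            finally show ?thesis .
          qed
          finally have le: "(cmod (mon a z))\<^sup>2 * exp (- 2 * G ?y) \<le> exp (2 * C) * (\<Prod>i\<in>UNIV. cmod (z $ i) powr (2 * \<epsilon> - 2 - 2 * (if x $ i = 0 then 0 else k)))" .
          have fi: "ennreal (cmod (z $ i) powr (2 * \<epsilon> - 2 - 2 * (if x $ i = 0 then 0 else k))) \<le> f \<delta> i (z $ i)" for i
          proof (cases "x $ i = 0")
            case True
            then show ?thesis using z0 ind by (simp add: f_def)
          next
            case False
            then have "cmod (z $ i) powr (2 * \<epsilon> - 2 - 2 * k) \<le> K i" unfolding K_def
              using nz[OF zD False] \<epsilon> k by (intro powr_mono2') auto
            then show ?thesis using False ind by (simp add: f_def ennreal_leI)
          qed
          have "ennreal ((cmod (mon a z))\<^sup>2) * weight (\<phi> z) * indicator (polybox x \<delta>) z = ennreal ((cmod (mon a z))\<^sup>2 * exp (- 2 * G ?y))"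
            using zD by (simp add: phi_logv[OF zr z0] ennreal_mult)
          also have "\<dots> \<le> ennreal (exp (2 * C) * (\<Prod>i\<in>UNIV. cmod (z $ i) powr (2 * \<epsilon> - 2 - 2 * (if x $ i = 0 then 0 else k))))"
            using le by (rule ennreal_leI)
          also have "\<dots> = ennreal (exp (2 * C)) * (\<Prod>i\<in>UNIV. ennreal (cmod (z $ i) powr (2 * \<epsilon> - 2 - 2 * (if x $ i = 0 then 0 else k))))"
            by (simp add: ennreal_mult prod_nonneg prod_ennreal)
          also have "\<dots> \<le> ennreal (exp (2 * C)) * (\<Prod>i\<in>UNIV. f \<delta> i (z $ i))"
            by (intro mult_left_mono ennreal_prod_mono fi) auto
          finally show ?thesis .
        qed
      qed auto
    qed
    also have "\<dots> = ennreal (exp (2 * C)) * (\<Prod>i\<in>UNIV. \<integral>\<^sup>+ w. f \<delta> i w \<partial>lborel)"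
    proof -
      have [measurable]: "ball c \<delta> \<in> sets borel" for c :: complex by simp
      have [measurable]: "(\<lambda>w::complex. cmod w powr p) \<in> borel_measurable borel" for p by measurable
      have fm [measurable]: "f \<delta> i \<in> borel_measurable borel" for i
      proof (cases "x $ i = 0")
        case True
        have "(\<lambda>w. (if w \<in> {0::complex} then \<infinity> else ennreal (cmod w powr (2 * \<epsilon> - 2))) * indicator (ball 0 \<delta>) w) \<in> borel_measurable borel"
          by measurable
        then show ?thesis using True by (simp add: f_def[abs_def])
      next
        case False
        have "(\<lambda>w. ennreal (K i) * indicator (ball (x $ i) \<delta>) w) \<in> borel_measurable borel"
          by measurable
        then show ?thesis using False by (simp add: f_def[abs_def])
      qed
      have nth [measurable]: "(\<lambda>z :: complex ^ 'n. z $ i) \<in> borel_measurable borel" for i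
        by (intro borel_measurable_continuous_onI continuous_intros)
      show ?thesis
        by (subst nn_integral_cmult) (auto simp: nn_integral_lborel_vec_prod fm)
    qed
    also have "\<dots> < \<infinity>"
    proof -
      have "(\<integral>\<^sup>+ w. f \<delta> i w \<partial>lborel) < \<infinity>" for i
      proof (cases "x $ i = 0")
        case True
        then show ?thesis using nn_integral_norm_powr_finite[of \<epsilon> \<delta>] \<epsilon> \<delta> by (simp add: f_def)
      next
        case False
        then have "(\<integral>\<^sup>+ w. f \<delta> i w \<partial>lborel) = ennreal (K i) * emeasure lborel (ball (x $ i) \<delta>)"
          unfolding f_def by (simp add: nn_integral_cmult_indicator)
        then show ?thesis using \<delta> by (simp add: emeasure_ball_complex ennreal_mult_less_top)
      qed
      then have "(\<Prod>i\<in>UNIV. \<integral>\<^sup>+ w. f \<delta> i w \<partial>lborel) < \<infinity>"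
        by (intro ennreal_prod_less_top) auto
      then show ?thesis by (simp add: ennreal_mult_less_top)
    qed
    finally show ?thesis .
  qed
  then show ?thesis using that[OF \<delta>0 sub[OF order_refl]] by blast
qed

end

lemma interior_upclosed:
  fixes S :: "(real ^ 'n) set"
  assumes up: "\<And>x y. x \<in> S \<Longrightarrow> (\<And>i. x $ i \<le> y $ i) \<Longrightarrow> y \<in> S"
    and x: "x \<in> interior S" and le: "\<And>i. x $ i \<le> y $ i"
  shows "y \<in> interior S"
proof (rule interiorI)
  show "open ((\<lambda>z. (y - x) + z) ` interior S)" by (intro open_translation open_interior)
  show "y \<in> (\<lambda>z. (y - x) + z) ` interior S" using x by (intro image_eqI[of _ _ x]) auto
  show "(\<lambda>z. (y - x) + z) ` interior S \<subseteq> S"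
  proof safe
    fix z assume "z \<in> interior S"
    then have "z \<in> S" using interior_subset by blast
    then show "(y - x) + z \<in> S" by (rule up) (use le in auto)
  qed
qed

lemma upclosed_strict_interior:
  fixes S :: "(real ^ 'n) set"
  assumes up: "\<And>x y. x \<in> S \<Longrightarrow> (\<And>i. x $ i \<le> y $ i) \<Longrightarrow> y \<in> S"
    and x: "x \<in> S" and le: "\<And>i. x $ i < y $ i"
  shows "y \<in> interior S"
proof (rule interiorI)
  have "{z. \<forall>i. x $ i < z $ i} = (\<Inter>i\<in>UNIV. {z. x $ i < z $ i})" by auto
  also have "open \<dots>" by (intro open_INT finite ballI open_Collect_less continuous_intros)
  finally show "open {z. \<forall>i. x $ i < z $ i}" .
  show "{z. \<forall>i. x $ i < z $ i} \<subseteq> S" using up[OF x] by (auto simp: less_imp_le)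
qed (use le in auto)

context toric_fun
begin

text \<open>Take the subgradient at the far point \<open>y - t *\<^sub>R w\<close>, not at
  \<open>y\<close>: it lies in the Newton body, so its slope along \<open>w\<close> is at least
  \<beta>.\<close>

lemma G_decay:
  assumes y: "y \<in> U" and w: "\<And>i. 0 \<le> w $ i" and \<beta>: "\<And>x. x \<in> NB \<Longrightarrow> \<beta> \<le> w \<bullet> x" and t: "t \<ge> 0"
  shows "G (y - t *\<^sub>R w) \<le> G y - t * \<beta>"
proof -
  have yt: "y - t *\<^sub>R w \<in> U" unfolding U_def
  proof safe
    fix i
    have "0 \<le> t * w $ i" using t w by simp
    moreover have "y $ i < ln r" using y by (simp add: U_def)
    ultimately show "(y - t *\<^sub>R w) $ i < ln r" by simp
  qed
  obtain x where x: "x \<in> NB" "\<And>z. z \<in> U \<Longrightarrow> G (y - t *\<^sub>R w) + x \<bullet> (z - (y - t *\<^sub>R w)) \<le> G z"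
    using subgradient[OF yt] by blast
  have "G (y - t *\<^sub>R w) + t * (w \<bullet> x) \<le> G y" using x(2)[OF y] by (simp add: inner_commute)
  moreover have "t * \<beta> \<le> t * (w \<bullet> x)" using \<beta>[OF x(1)] t by (intro mult_left_mono) auto
  ultimately show ?thesis by linarith
qed

text \<open>For real \<open>k \<ge> 0\<close> the shifted exponents form a convex set, which misses
  the interior because rounding \<open>k\<close> up is a move upwards. In a separating functional
  the nonnegative entries at the nonzero coordinates of \<open>x\<close> must vanish, as
  \<open>k\<close> is unbounded.\<close>

lemma separate_from_interior_NB:
  assumes no: "\<And>k::nat. shifted_exp x a (real k) \<notin> interior NB"
  obtains w where "\<And>i. 0 \<le> w $ i" "\<And>i. x $ i \<noteq> 0 \<Longrightarrow> w $ i = 0" "w \<noteq> 0"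
    "\<And>v. v \<in> NB \<Longrightarrow> w \<bullet> shifted_exp x a 0 \<le> w \<bullet> v"
proof -
  define K where "K = (\<lambda>k. shifted_exp x a k) ` {0..}"
  have aff: "u *\<^sub>R shifted_exp x a k + v *\<^sub>R shifted_exp x a l = shifted_exp x a (u * k + v * l)" if "u + v = 1" for u v k l
  proof -
    have *: "u * (c + k) + v * (c + l) = c + (u * k + v * l)" for c k l :: real
    proof -
      have "u * (c + k) + v * (c + l) = (u + v) * c + (u * k + v * l)" by (simp add: algebra_simps)
      then show ?thesis using that by simp
    qed
    have "(u *\<^sub>R shifted_exp x a k + v *\<^sub>R shifted_exp x a l) $ i = shifted_exp x a (u * k + v * l) $ i" for i
      using *[of "real (a i) + 1" k l] *[of "real (a i) + 1" 0 0] by (simp add: shifted_exp_def)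
    then show ?thesis unfolding vec_eq_iff by blast
  qed
  have "convex K" unfolding K_def
    by (rule convexI) (auto simp: aff)
  moreover have "K \<inter> interior NB = {}"
  proof -
    have "shifted_exp x a k \<notin> interior NB" if "k \<ge> 0" for k
    proof
      assume *: "shifted_exp x a k \<in> interior NB"
      have "shifted_exp x a (real (nat \<lceil>k\<rceil>)) \<in> interior NB"
        by (rule interior_upclosed[OF NB_up *]) (use that in \<open>auto simp: shifted_exp_def le_of_int_ceiling\<close>)
      then show False using no by blast
    qed
    then show ?thesis by (auto simp: K_def)
  qed
  moreover have "K \<noteq> {}" by (auto simp: K_def)
  moreover obtain p where p: "p \<in> NB" using NB_nonempty by blast
  have pi: "p + s *\<^sub>R (\<chi> i. 1) \<in> interior NB" if "p \<in> NB" "s > 0" for p s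
    by (rule upclosed_strict_interior[OF NB_up that(1)]) (use that in auto)
  have ne: "interior NB \<noteq> {}" using pi[OF p, of 1] by auto
  ultimately obtain w \<beta> where w: "w \<noteq> 0" "\<And>v. v \<in> K \<Longrightarrow> w \<bullet> v \<le> \<beta>" "\<And>v. v \<in> interior NB \<Longrightarrow> \<beta> \<le> w \<bullet> v"
    using separating_hyperplane_sets[of K "interior NB"] convex_interior[OF convex_NB] by blast
  have wn: "0 \<le> w $ i" for i
    by (rule upclosed_normal_nonneg[OF pi[OF p, of 1] _ w(3)]) (use interior_upclosed[OF NB_up] in auto)
  have wNB: "\<beta> \<le> w \<bullet> v" if v: "v \<in> NB" for v
  proof (rule field_le_epsilon)
    fix e :: real assume e: "e > 0"
    define c where "c = w \<bullet> (\<chi> i. 1)"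
    have c: "c \<ge> 0" using wn by (auto simp: c_def inner_vec_def intro!: sum_nonneg)
    define s where "s = e / (c + 1)"
    have s: "s > 0" "s * c \<le> e" using e c by (auto simp: s_def field_simps)
    have "\<beta> \<le> w \<bullet> (v + s *\<^sub>R (\<chi> i. 1))" using w(3)[OF pi[OF v s(1)]] .
    also have "\<dots> = w \<bullet> v + s * c" by (simp add: inner_add_right c_def)
    finally show "\<beta> \<le> w \<bullet> v + e" using s by linarith
  qed
  define S where "S = (\<Sum>i\<in>{i. x $ i \<noteq> 0}. w $ i)"
  have wK: "w \<bullet> shifted_exp x a k = w \<bullet> shifted_exp x a 0 + k * S" for k
  proof -
    have "w \<bullet> shifted_exp x a k - w \<bullet> shifted_exp x a 0 = (\<Sum>i\<in>UNIV. if x $ i \<noteq> 0 then k * w $ i else 0)"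
      unfolding inner_vec_def sum_subtractf[symmetric]
      by (intro sum.cong) (auto simp: shifted_exp_def algebra_simps)
    also have "\<dots> = k * S" unfolding S_def sum_distrib_left by (subst sum.inter_filter[symmetric]) auto
    finally show ?thesis by simp
  qed
  have S0: "S = 0"
  proof (rule ccontr)
    assume "S \<noteq> 0"
    moreover have "S \<ge> 0" unfolding S_def using wn by (intro sum_nonneg) auto
    ultimately have S: "S > 0" by simp
    define k where "k = (\<bar>\<beta> - w \<bullet> shifted_exp x a 0\<bar> + 1) / S"
    have "k \<ge> 0" using S by (simp add: k_def)
    then have "shifted_exp x a k \<in> K" by (auto simp: K_def)
    from w(2)[OF this] wK[of k] have "w \<bullet> shifted_exp x a 0 + k * S \<le> \<beta>" by linarith
    moreover have "k * S = \<bar>\<beta> - w \<bullet> shifted_exp x a 0\<bar> + 1" using S by (simp add: k_def)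
    ultimately show False by linarith
  qed
  have "w $ i = 0" if "x $ i \<noteq> 0" for i
    using S0 that wn unfolding S_def by (subst (asm) sum_nonneg_eq_0_iff) auto
  moreover have "w \<bullet> shifted_exp x a 0 \<le> w \<bullet> v" if "v \<in> NB" for v
  proof -
    have "shifted_exp x a 0 \<in> K" by (auto simp: K_def)
    from w(2)[OF this] wNB[OF that] show ?thesis by linarith
  qed
  ultimately show ?thesis using that wn w(1) by blast
qed

text \<open>If the exponent stays outside the interior, \<open>\<phi>\<close> decays linearly along the separating
  direction \<open>w\<close>; the integrals over the disjoint polydiscs obtained by scaling one polydisc
  by \<open>exp (- k w)\<close> are then bounded below by a positive constant.\<close>

lemma integrable_imp_interior_NB:
  assumes V: "open V" "x \<in> V" "V \<subseteq> polydisk r"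
    and int: "(\<integral>\<^sup>+ z. ennreal ((cmod (mon a z))\<^sup>2) * weight (\<phi> z) * indicator V z \<partial>lborel) < \<infinity>"
  shows "\<exists>k::nat. shifted_exp x a (real k) \<in> interior NB"
proof (rule ccontr)
  assume "\<not> ?thesis"
  then obtain w0 where w0: "\<And>i. 0 \<le> w0 $ i" "\<And>i. x $ i \<noteq> 0 \<Longrightarrow> w0 $ i = 0" "w0 \<noteq> 0"
    "\<And>v. v \<in> NB \<Longrightarrow> w0 \<bullet> shifted_exp x a 0 \<le> w0 \<bullet> v"
    using separate_from_interior_NB[of x a] by blast
  obtain i0 where i0: "w0 $ i0 \<noteq> 0" using w0(3) by (auto simp: vec_eq_iff)
  \<comment> \<open>With \<open>w $ i0 = 1\<close> the coordinate \<open>i0\<close> shrinks by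
    \<open>exp 1\<close>, at least 2, from each set \<open>S k\<close> to the next; this separates
    them.\<close>
  define w where "w = (1 / w0 $ i0) *\<^sub>R w0"
  have i0p: "w0 $ i0 > 0" using w0(1)[of i0] i0 by simp
  have w: "0 \<le> w $ i" "x $ i \<noteq> 0 \<Longrightarrow> w $ i = 0" "w $ i0 = 1" for i
    using w0 i0p by (auto simp: w_def)
  have w_NB: "w \<bullet> shifted_exp x a 0 \<le> w \<bullet> v" if "v \<in> NB" for v
    using w0(4)[OF that] i0p unfolding w_def inner_scaleR_left by (intro mult_left_mono) auto
  define \<beta> where "\<beta> = w \<bullet> shifted_exp x a 0"
  obtain \<delta>1 where \<delta>1: "\<delta>1 > 0" "polybox x \<delta>1 \<subseteq> V" using polybox_subset_open[OF V(1,2)] by blast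
  define \<delta> where "\<delta> = Min (insert \<delta>1 (range (\<lambda>i. r - cmod (x $ i)) \<union> (\<lambda>i. cmod (x $ i)) ` {i. x $ i \<noteq> 0}))"
  have fin: "finite (insert \<delta>1 (range (\<lambda>i. r - cmod (x $ i)) \<union> (\<lambda>i. cmod (x $ i)) ` {i. x $ i \<noteq> 0}))" by simp
  have xr: "cmod (x $ i) < r" for i using V by (auto simp: polydisk_def)
  have \<delta>: "\<delta> > 0" unfolding \<delta>_def using \<delta>1 xr by (subst Min_gr_iff) auto
  have \<delta>_le: "\<delta> \<le> \<delta>1" "\<delta> \<le> r - cmod (x $ i)" "x $ i \<noteq> 0 \<Longrightarrow> \<delta> \<le> cmod (x $ i)" for i
    unfolding \<delta>_def by (rule Min_le[OF fin]; simp)+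
  \<comment> \<open>Every centre then has modulus at least \<open>4 * \<rho>\<close>, more than the
    \<open>3 * \<rho>\<close> that disjointness requires, and the polydisc stays within \<delta> of
    \<open>x\<close>.\<close>
  define \<rho> where "\<rho> = \<delta> / 8"
  define p where "p i = (if x $ i = 0 then complex_of_real (\<delta> / 2) else x $ i)" for i
  have \<rho>: "\<rho> > 0" using \<delta> by (simp add: \<rho>_def)
  have p_gt: "4 * \<rho> \<le> cmod (p i)" and p_lt: "cmod (p i) + \<rho> < r" for i
    using \<delta> \<delta>_le(2,3)[of i] by (auto simp: p_def \<rho>_def)
  define S where "S k = {z. \<forall>i. z $ i \<in> ball (of_real (exp (- real k * w $ i)) * p i) (exp (- real k * w $ i) * \<rho>)}" for k :: nat
  have S_meas [measurable]: "S k \<in> sets borel" for k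
    unfolding S_def by (rule emeasure_lborel_vec_prod(1)) simp
  have vol: "emeasure lborel (S k) = ennreal (exp (- 2 * real k * (\<Sum>i\<in>UNIV. w $ i)) * (pi * \<rho>\<^sup>2) ^ CARD('n))" for k
  proof -
    have "emeasure lborel (S k) = (\<Prod>i\<in>UNIV. ennreal (pi * (exp (- real k * w $ i) * \<rho>)\<^sup>2))"
      unfolding S_def using \<rho> by (subst emeasure_lborel_vec_prod(2)) (auto simp: emeasure_ball_complex)
    also have "\<dots> = ennreal (\<Prod>i\<in>UNIV. exp (- 2 * real k * w $ i) * (pi * \<rho>\<^sup>2))"
      by (subst prod_ennreal) (auto intro!: arg_cong[where f = ennreal] prod.cong simp: power_mult_distrib exp_double[symmetric])
    also have "(\<Prod>i\<in>UNIV. exp (- 2 * real k * w $ i) * (pi * \<rho>\<^sup>2)) = exp (\<Sum>i\<in>UNIV. - 2 * real k * w $ i) * (pi * \<rho>\<^sup>2) ^ CARD('n)"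
      by (simp add: prod.distrib exp_sum)
    finally show ?thesis by (simp add: sum_distrib_left)
  qed
  have z_bounds: "exp (- real k * w $ i) * (cmod (p i) - \<rho>) \<le> cmod (z $ i)"
      "cmod (z $ i) \<le> exp (- real k * w $ i) * (cmod (p i) + \<rho>)" if "z \<in> S k" for z k i
  proof -
    let ?E = "exp (- real k * w $ i)"
    have d: "cmod (of_real ?E * p i - z $ i) < ?E * \<rho>" using that by (auto simp: S_def dist_norm)
    have n: "cmod (of_real ?E * p i) = ?E * cmod (p i)" by (simp add: norm_mult)
    show "?E * (cmod (p i) - \<rho>) \<le> cmod (z $ i)"
      using norm_triangle_ineq2[of "of_real ?E * p i" "z $ i"] d n by (simp add: algebra_simps)
    show "cmod (z $ i) \<le> ?E * (cmod (p i) + \<rho>)"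
      using norm_triangle_ineq2[of "z $ i" "of_real ?E * p i"] d n by (simp add: algebra_simps norm_minus_commute)
  qed
  have disj: "disjoint_family S"
  proof -
    have less: "S k \<inter> S l = {}" if "k < l" for k l
    proof (rule ccontr)
      assume "S k \<inter> S l \<noteq> {}"
      then obtain z where z: "z \<in> S k" "z \<in> S l" by blast
      have "exp (- real k) * (cmod (p i0) - \<rho>) \<le> exp (- real l) * (cmod (p i0) + \<rho>)"
        using z_bounds(1)[OF z(1), of i0] z_bounds(2)[OF z(2), of i0] w(3) by simp
      also have "\<dots> \<le> (exp (- real k) / 2) * (cmod (p i0) + \<rho>)"
      proof (rule mult_right_mono)
        have "exp (- real l) \<le> exp (- real k - 1)" using that by simp
        also have "\<dots> = exp (- real k) / exp 1" by (simp add: exp_diff)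
        also have "\<dots> \<le> exp (- real k) / 2" using exp_ge_add_one_self[of 1] by (intro divide_left_mono) auto
        finally show "exp (- real l) \<le> exp (- real k) / 2" .
      qed (use \<rho> in auto)
      finally have "exp (- real k) * (cmod (p i0) - \<rho>) \<le> exp (- real k) * ((cmod (p i0) + \<rho>) / 2)" by simp
      then have "cmod (p i0) - \<rho> \<le> (cmod (p i0) + \<rho>) / 2" by (simp only: mult_le_cancel_left_pos exp_gt_zero)
      then show False using p_gt[of i0] \<rho> by simp
    qed
    show ?thesis unfolding disjoint_family_on_def
      using less by (metis Int_commute linorder_neqE_nat)
  qed
  have S_sub: "S k \<subseteq> polybox x \<delta>" for k
  proof
    fix z assume z: "z \<in> S k"
    show "z \<in> polybox x \<delta>" unfolding polybox_def
    proof safe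
      fix i
      show "cmod (z $ i - x $ i) < \<delta>"
      proof (cases "x $ i = 0")
        case True
        have "cmod (z $ i) \<le> exp (- real k * w $ i) * (cmod (p i) + \<rho>)" by (rule z_bounds(2)[OF z])
        also have "\<dots> \<le> 1 * (cmod (p i) + \<rho>)" using w \<rho> by (intro mult_right_mono) auto
        also have "\<dots> < \<delta>" using True \<delta> by (simp add: p_def \<rho>_def)
        finally show ?thesis using True by simp
      next
        case False
        then have "cmod (x $ i - z $ i) < \<rho>" using z w(2)[OF False] by (auto simp: S_def p_def dist_norm dest!: spec[of _ i])
        then show ?thesis using \<delta> by (simp add: norm_minus_commute \<rho>_def)
      qed
    qed
  qed
  have SV: "S k \<subseteq> V" for k
    using S_sub[of k] \<delta>_le(1) \<delta>1(2) by (force simp: polybox_def intro: less_le_trans)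
  define y0 :: "real ^ 'n" where "y0 = (\<chi> i. ln (cmod (p i) + \<rho>))"
  have y0: "y0 \<in> U" unfolding U_def y0_def
  proof safe
    fix i
    have "0 < cmod (p i) + \<rho>" using \<rho> by (intro add_nonneg_pos) auto
    then show "(\<chi> i. ln (cmod (p i) + \<rho>)) $ i < ln r" using p_lt[of i] by simp
  qed
  define c0 where "c0 = (\<Prod>i\<in>UNIV. (cmod (p i) - \<rho>) ^ a i)"
  have pm: "0 < cmod (p i) - \<rho>" for i using p_gt[of i] \<rho> by linarith
  have c0: "c0 > 0" unfolding c0_def using pm by (intro prod_pos zero_less_power ballI)
  \<comment> \<open>The monomial contributes decay at rate \<open>2 * (w \<bullet> a)\<close> and
    the weight growth at rate \<open>2 * \<beta>\<close>, where \<beta> pairs \<open>w\<close> with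
    \<open>a + 1\<close>. The difference, twice the sum of \<open>w\<close>, exactly cancels the
    shrinking volume of \<open>S k\<close>.\<close>
  define c where "c k = c0\<^sup>2 * exp (- 2 * G y0) * exp (2 * real k * (\<Sum>i\<in>UNIV. w $ i))" for k :: nat
  have lower: "ennreal (c k) \<le> ennreal ((cmod (mon a z))\<^sup>2) * weight (\<phi> z)" if z: "z \<in> S k" for z k
  proof -
    have zp: "0 < cmod (z $ i)" for i
      using z_bounds(1)[OF z, of i] pm[of i] by (meson exp_gt_zero less_le_trans mult_pos_pos)
    have z0: "z $ i \<noteq> 0" for i using zp[of i] by auto
    have zr: "z \<in> polydisk r" using z SV V(3) by blast
    have "G (logv z) \<le> G (y0 - real k *\<^sub>R w)"
    proof (rule G_mono[OF logv_in_U[OF zr z0]])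
      show "y0 - real k *\<^sub>R w \<in> U" unfolding U_def
      proof safe
        fix i
        have "0 \<le> real k * w $ i" using w by simp
        moreover have "y0 $ i < ln r" using y0 by (simp add: U_def)
        ultimately show "(y0 - real k *\<^sub>R w) $ i < ln r" by simp
      qed
      fix i
      have "0 < cmod (p i) + \<rho>" using \<rho> by (intro add_nonneg_pos) auto
      then have "ln (cmod (z $ i)) \<le> ln (exp (- real k * w $ i) * (cmod (p i) + \<rho>))"
        using z_bounds(2)[OF z, of i] zp by (intro ln_mono) auto
      also have "\<dots> = - real k * w $ i + ln (cmod (p i) + \<rho>)"
        using \<open>0 < cmod (p i) + \<rho>\<close> by (simp add: ln_mult)
      finally show "logv z $ i \<le> (y0 - real k *\<^sub>R w) $ i" by (simp add: logv_def y0_def)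
    qed
    also have "\<dots> \<le> G y0 - real k * \<beta>"
      by (rule G_decay[OF y0 w(1)]) (auto simp: \<beta>_def w_NB)
    finally have G_le: "G (logv z) \<le> G y0 - real k * \<beta>" .
    have "(\<Prod>i\<in>UNIV. exp (- real k * w $ i * real (a i)) * (cmod (p i) - \<rho>) ^ a i) \<le> cmod (mon a z)"
      unfolding mon_def prod_norm[symmetric]
    proof (intro prod_mono conjI)
      fix i
      have "exp (- real k * w $ i * real (a i)) * (cmod (p i) - \<rho>) ^ a i = (exp (- real k * w $ i) * (cmod (p i) - \<rho>)) ^ a i"
        by (simp add: power_mult_distrib exp_of_nat2_mult[symmetric])
      also have "\<dots> \<le> cmod (z $ i) ^ a i" using z_bounds(1)[OF z] pm[of i] by (intro power_mono) auto
      finally show "exp (- real k * w $ i * real (a i)) * (cmod (p i) - \<rho>) ^ a i \<le> cmod (z $ i ^ a i)"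
        by (simp add: norm_power)
      show "0 \<le> exp (- real k * w $ i * real (a i)) * (cmod (p i) - \<rho>) ^ a i" using pm[of i] by simp
    qed
    then have "exp (- real k * (\<Sum>i\<in>UNIV. w $ i * real (a i))) * c0 \<le> cmod (mon a z)"
      by (simp add: prod.distrib c0_def exp_sum[symmetric] sum_distrib_left sum_negf mult.assoc)
    then have "(exp (- real k * (\<Sum>i\<in>UNIV. w $ i * real (a i))) * c0)\<^sup>2 \<le> (cmod (mon a z))\<^sup>2"
      using c0 by (intro power_mono) auto
    then have "(exp (- real k * (\<Sum>i\<in>UNIV. w $ i * real (a i))) * c0)\<^sup>2 * exp (- 2 * (G y0 - real k * \<beta>)) \<le> (cmod (mon a z))\<^sup>2 * exp (- 2 * G (logv z))"
      using G_le by (intro mult_mono) auto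
    moreover have "(exp (- real k * (\<Sum>i\<in>UNIV. w $ i * real (a i))) * c0)\<^sup>2 * exp (- 2 * (G y0 - real k * \<beta>)) = c k"
    proof -
      have \<beta>: "\<beta> = (\<Sum>i\<in>UNIV. w $ i * real (a i)) + (\<Sum>i\<in>UNIV. w $ i)"
        unfolding \<beta>_def inner_vec_def shifted_exp_def sum.distrib[symmetric] by (intro sum.cong) (auto simp: algebra_simps)
      show ?thesis unfolding c_def \<beta> power_mult_distrib exp_double[symmetric]
        by (simp add: algebra_simps flip: exp_add)
    qed
    ultimately have "ennreal (c k) \<le> ennreal ((cmod (mon a z))\<^sup>2 * exp (- 2 * G (logv z)))"
      by (intro ennreal_leI) simp
    then show ?thesis by (simp add: phi_logv[OF zr z0] ennreal_mult)
  qed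
  have "(\<Sum>k. ennreal (c k) * indicator (S k) z) \<le> ennreal ((cmod (mon a z))\<^sup>2) * weight (\<phi> z) * indicator V z" for z
  proof (cases "\<exists>k. z \<in> S k")
    case True
    then obtain k where k: "z \<in> S k" by blast
    have "(\<Sum>k. ennreal (c k) * indicator (S k) z) = ennreal (c k)"
      by (rule suminf_cmult_indicator[OF disj k])
    also have "\<dots> \<le> ennreal ((cmod (mon a z))\<^sup>2) * weight (\<phi> z)" by (rule lower[OF k])
    finally show ?thesis using k SV by (auto simp: indicator_def)
  next
    case False
    then have "(\<Sum>k. ennreal (c k) * indicator (S k) z) = 0" by simp
    then show ?thesis by simp
  qed
  then have "(\<integral>\<^sup>+ z. (\<Sum>k. ennreal (c k) * indicator (S k) z) \<partial>lborel)
    \<le> (\<integral>\<^sup>+ z. ennreal ((cmod (mon a z))\<^sup>2) * weight (\<phi> z) * indicator V z \<partial>lborel)"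
    by (intro nn_integral_mono) auto
  moreover have "(\<integral>\<^sup>+ z. (\<Sum>k. ennreal (c k) * indicator (S k) z) \<partial>lborel) = \<infinity>"
  proof -
    define C where "C = c0\<^sup>2 * exp (- 2 * G y0) * (pi * \<rho>\<^sup>2) ^ CARD('n)"
    have C: "C > 0" using c0 \<rho> by (simp add: C_def)
    have "(\<integral>\<^sup>+ z. (\<Sum>k. ennreal (c k) * indicator (S k) z) \<partial>lborel) = (\<Sum>k. ennreal (c k) * emeasure lborel (S k))"
      by (subst nn_integral_suminf) (auto simp: nn_integral_cmult_indicator)
    also have "\<dots> = (\<Sum>k. ennreal C)"
    proof (intro suminf_cong)
      fix k
      have "ennreal (c k) * emeasure lborel (S k) = ennreal (c k * (exp (- 2 * real k * (\<Sum>i\<in>UNIV. w $ i)) * (pi * \<rho>\<^sup>2) ^ CARD('n)))"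
        unfolding vol using c0 by (subst ennreal_mult) (auto simp: c_def)
      also have "c k * (exp (- 2 * real k * (\<Sum>i\<in>UNIV. w $ i)) * (pi * \<rho>\<^sup>2) ^ CARD('n)) = C"
        unfolding c_def C_def by (simp add: mult_ac flip: exp_add)
      finally show "ennreal (c k) * emeasure lborel (S k) = ennreal C" .
    qed
    also have "\<dots> = \<infinity>"
    proof (rule ccontr)
      assume "(\<Sum>k::nat. ennreal C) \<noteq> \<infinity>"
      then have "summable (\<lambda>k::nat. C)" using C by (intro summable_suminf_not_top) auto
      then show False using C by (simp add: summable_const_iff)
    qed
    finally show ?thesis .
  qed
  ultimately show False using int by (simp add: top_unique)
qed

end

subsection \<open>Domination by monomials\<close>

text \<open>The discrete Fourier projection onto the degrees congruent to \<open>k\<close> modulo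
  \<open>N\<close>.\<close>

definition root_avg :: "nat \<Rightarrow> nat \<Rightarrow> (complex \<Rightarrow> complex) \<Rightarrow> complex \<Rightarrow> complex" where
  "root_avg N k u \<zeta> = (\<Sum>j<N. cis (- (2 * pi * real j * real k / real N)) * u (cis (2 * pi * real j / real N) * \<zeta>)) / of_nat N"

definition taylor_coeff :: "nat \<Rightarrow> (complex \<Rightarrow> complex) \<Rightarrow> complex" where
  "taylor_coeff k u = (deriv ^^ k) u 0 / fact k"

lemma taylor_sums:
  assumes "u holomorphic_on ball 0 \<delta>" "norm \<zeta> < \<delta>"
  shows "(\<lambda>k. taylor_coeff k u * \<zeta> ^ k) sums u \<zeta>"
  using holomorphic_power_series[OF assms(1), of \<zeta>] assms(2) by (simp add: taylor_coeff_def)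

text \<open>Cauchy's estimate wants continuity up to the circle, so it is applied on radii below
  \<delta>, which then tend to \<delta>.\<close>

lemma taylor_coeff_bound:
  assumes hol: "u holomorphic_on ball 0 \<delta>" and M: "\<And>\<zeta>. norm \<zeta> < \<delta> \<Longrightarrow> norm (u \<zeta>) \<le> M" and \<delta>: "\<delta> > 0"
  shows "norm (taylor_coeff k u) * \<delta> ^ k \<le> M"
proof (rule tendsto_upperbound)
  show "((\<lambda>\<rho>. norm (taylor_coeff k u) * \<rho> ^ k) \<longlongrightarrow> norm (taylor_coeff k u) * \<delta> ^ k) (at_left \<delta>)"
    by (intro tendsto_intros)
  have "eventually (\<lambda>\<rho>. \<rho> \<in> {0<..<\<delta>}) (at_left \<delta>)" using \<delta> by (rule eventually_at_left_real)
  then show "eventually (\<lambda>\<rho>. norm (taylor_coeff k u) * \<rho> ^ k \<le> M) (at_left \<delta>)"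
  proof eventually_elim
    case (elim \<rho>)
    have sub: "cball 0 \<rho> \<subseteq> ball (0::complex) \<delta>" using elim by auto
    have "norm ((deriv ^^ k) u 0) \<le> fact k * M / \<rho> ^ k"
    proof (rule Cauchy_inequality)
      show "u holomorphic_on ball 0 \<rho>" by (rule holomorphic_on_subset[OF hol]) (use elim in auto)
      show "continuous_on (cball 0 \<rho>) u"
        by (rule holomorphic_on_imp_continuous_on[OF holomorphic_on_subset[OF hol sub]])
    qed (use elim M in auto)
    then show ?case using elim by (simp add: taylor_coeff_def norm_divide field_simps)
  qed
qed simp

text \<open>Orthogonality of characters: for distinct \<open>m\<close> and \<open>k\<close> below
  \<open>N\<close> the number \<open>w\<close> is an \<open>N\<close>-th root of unity other than 1,
  so its powers sum to 0.\<close>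

lemma root_filter:
  assumes N: "N > 0"
  defines "f \<equiv> \<lambda>m k. (\<Sum>j<N. cis (2 * pi * real j * (real m - real k) / real N)) / of_nat N"
  shows "f k k = 1" and "m < N \<Longrightarrow> k < N \<Longrightarrow> m \<noteq> k \<Longrightarrow> f m k = 0" and "norm (f m k) \<le> 1"
proof -
  show "f k k = 1" using N by (simp add: f_def)
  have "norm (\<Sum>j<N. cis (2 * pi * real j * (real m - real k) / real N)) \<le> (\<Sum>j<N. 1)"
    by (rule sum_norm_le) simp
  then show "norm (f m k) \<le> 1" using N by (simp add: f_def norm_divide)
  assume mk: "m < N" "k < N" "m \<noteq> k"
  define s where "s = (real m - real k) / real N"
  define w where "w = cis (2 * pi * s)"
  have s: "\<bar>s\<bar> < 1" "s \<noteq> 0" using mk by (auto simp: s_def field_simps abs_if)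
  have "w \<noteq> 1"
  proof
    assume "w = 1"
    then have "cos (2 * pi * s) = 1" by (metis w_def cis.sel(1) one_complex.sel(1))
    then obtain n :: int where "2 * pi * s = of_int n * 2 * pi" unfolding cos_one_2pi_int by blast
    then have "s = of_int n" by simp
    then show False using s by auto
  qed
  have pw: "cis (2 * pi * real j * (real m - real k) / real N) = w ^ j" for j
  proof -
    have "w ^ j = cis (real j * (2 * pi * s))" unfolding w_def by (rule Complex.DeMoivre)
    also have "real j * (2 * pi * s) = 2 * pi * real j * (real m - real k) / real N" by (simp add: s_def)
    finally show ?thesis by simp
  qed
  have N0: "2 * pi * real N * (real m - real k) / real N = 2 * pi * (real m - real k)"
    using N by (simp add: field_simps)
  have "w ^ N = cis (2 * pi * (real m - real k))" using pw[of N] unfolding N0 by simp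
  also have "\<dots> = cis (2 * pi * of_int (int m - int k))" by simp
  also have "\<dots> = 1" by (rule cis_multiple_2pi) simp
  finally have "w ^ N = 1" .
  then have "(\<Sum>j<N. w ^ j) = 0" using \<open>w \<noteq> 1\<close> by (simp add: geometric_sum)
  then show "f m k = 0" by (simp add: f_def pw)
qed

text \<open>The average reproduces degree \<open>k\<close>, kills the other degrees below
  \<open>N\<close> and does not enlarge the terms from degree \<open>N\<close> on; the error is a
  geometric tail.\<close>

lemma root_avg_approx:
  assumes hol: "u holomorphic_on ball 0 \<delta>" and M: "\<And>\<zeta>. norm \<zeta> < \<delta> \<Longrightarrow> norm (u \<zeta>) \<le> M"
    and \<zeta>: "norm \<zeta> < \<delta>" and k: "k < N"
  shows "norm (root_avg N k u \<zeta> - taylor_coeff k u * \<zeta> ^ k) \<le> M * (norm \<zeta> / \<delta>) ^ N / (1 - norm \<zeta> / \<delta>)"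
proof -
  define c where "c m = taylor_coeff m u" for m
  define f where "f m = (\<Sum>j<N. cis (2 * pi * real j * (real m - real k) / real N)) / of_nat N" for m
  define q where "q = norm \<zeta> / \<delta>"
  have N: "N > 0" using k by simp
  have \<delta>: "\<delta> > 0" using \<zeta> norm_ge_zero[of \<zeta>] by linarith
  have q: "0 \<le> q" "q < 1" using \<zeta> \<delta> by (auto simp: q_def)
  note rf = root_filter[OF N, of k, folded f_def] root_filter(2)[OF N _ k, folded f_def] root_filter(3)[OF N, of _ k, folded f_def]
  have cM: "norm (c m * \<zeta> ^ m) \<le> M * q ^ m" for m
  proof -
    have "norm (c m * \<zeta> ^ m) = norm (c m) * \<delta> ^ m * q ^ m"
      using \<delta> by (simp add: q_def norm_mult norm_power power_divide)
    also have "\<dots> \<le> M * q ^ m"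
      unfolding c_def using taylor_coeff_bound[OF hol M \<delta>] q by (intro mult_right_mono) auto
    finally show ?thesis .
  qed
  have "(\<lambda>m. cis (- (2 * pi * real j * real k / real N)) * (c m * (cis (2 * pi * real j / real N) * \<zeta>) ^ m))
      sums (cis (- (2 * pi * real j * real k / real N)) * u (cis (2 * pi * real j / real N) * \<zeta>))" for j
    unfolding c_def using \<zeta> by (intro sums_mult taylor_sums[OF hol]) (simp add: norm_mult)
  then have "(\<lambda>m. (\<Sum>j<N. cis (- (2 * pi * real j * real k / real N)) * (c m * (cis (2 * pi * real j / real N) * \<zeta>) ^ m)) / of_nat N)
      sums root_avg N k u \<zeta>"
    unfolding root_avg_def by (intro sums_divide sums_sum)
  moreover have "(\<Sum>j<N. cis (- (2 * pi * real j * real k / real N)) * (c m * (cis (2 * pi * real j / real N) * \<zeta>) ^ m)) / of_nat N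
      = f m * (c m * \<zeta> ^ m)" for m
  proof -
    have "cis (- (2 * pi * real j * real k / real N)) * (c m * (cis (2 * pi * real j / real N) * \<zeta>) ^ m)
       = cis (2 * pi * real j * (real m - real k) / real N) * (c m * \<zeta> ^ m)" for j
    proof -
      have "cis (2 * pi * real j / real N) ^ m = cis (real m * (2 * pi * real j / real N))" by (rule Complex.DeMoivre)
      then have "cis (- (2 * pi * real j * real k / real N)) * cis (2 * pi * real j / real N) ^ m
         = cis (- (2 * pi * real j * real k / real N) + real m * (2 * pi * real j / real N))" by (simp add: cis_mult)
      also have "- (2 * pi * real j * real k / real N) + real m * (2 * pi * real j / real N)
         = 2 * pi * real j * (real m - real k) / real N"
        by (simp add: field_simps flip: diff_divide_distrib)
      finally show ?thesis by (simp add: power_mult_distrib)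
    qed
    then show ?thesis by (simp only: f_def sum_distrib_right times_divide_eq_left)
  qed
  ultimately have "(\<lambda>m. f m * (c m * \<zeta> ^ m)) sums root_avg N k u \<zeta>" by simp
  moreover have "(\<lambda>m. if m = k then c m * \<zeta> ^ m else 0) sums (c k * \<zeta> ^ k)"
    by (rule sums_single)
  ultimately have S: "(\<lambda>m. f m * (c m * \<zeta> ^ m) - (if m = k then c m * \<zeta> ^ m else 0)) sums (root_avg N k u \<zeta> - c k * \<zeta> ^ k)"
    by (rule sums_diff)
  define d where "d m = f m * (c m * \<zeta> ^ m) - (if m = k then c m * \<zeta> ^ m else 0)" for m
  have d0: "d m = 0" if "m < N" for m
    using rf that by (auto simp: d_def)
  have dM: "norm (d (m + N)) \<le> M * q ^ N * q ^ m" for m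
  proof -
    have "norm (d (m + N)) = norm (f (m + N)) * norm (c (m + N) * \<zeta> ^ (m + N))"
      using k by (simp add: d_def norm_mult)
    also have "\<dots> \<le> 1 * (M * q ^ (m + N))"
      by (intro mult_mono cM rf) auto
    finally show ?thesis by (simp add: power_add mult_ac)
  qed
  have "root_avg N k u \<zeta> - c k * \<zeta> ^ k = suminf d" using S by (simp add: d_def[abs_def] sums_iff)
  also have "\<dots> = (\<Sum>m. d (m + N)) + sum d {..<N}"
    using S by (intro suminf_split_initial_segment) (simp add: d_def[abs_def] sums_iff)
  also have "sum d {..<N} = 0" using d0 by simp
  finally have "norm (root_avg N k u \<zeta> - c k * \<zeta> ^ k) \<le> norm (\<Sum>m. d (m + N))" by simp
  also have "\<dots> \<le> (\<Sum>m. M * q ^ N * q ^ m)"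
    by (rule norm_suminf_le[OF dM]) (use q in \<open>auto intro!: summable_mult summable_geometric\<close>)
  also have "\<dots> = M * q ^ N / (1 - q)" using q by (simp add: suminf_mult suminf_geometric)
  finally show ?thesis by (simp add: c_def q_def)
qed

text \<open>A polydisc around \<open>x\<close> is invariant under rotations of those coordinates in
  which \<open>x\<close> vanishes. Expansions are therefore made in the directions of
  \<open>J\<close>, the remaining coordinates being carried along as parameters.\<close>

locale reinhardt =
  fixes x :: "complex ^ 'n" and \<delta> M :: real
  assumes \<delta>: "\<delta> > 0"
begin

abbreviation "J \<equiv> {i. x $ i = 0}"
abbreviation "D \<equiv> polybox x \<delta>"

lemma D_J: "z \<in> D \<Longrightarrow> x $ i = 0 \<Longrightarrow> cmod (z $ i) < \<delta>"
  by (auto simp: polybox_def dest: spec[of _ i])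

lemma D_vupd: "z \<in> D \<Longrightarrow> x $ i = 0 \<Longrightarrow> cmod c < \<delta> \<Longrightarrow> vupd z i c \<in> D"
  by (auto simp: polybox_def vupd_nth)

text \<open>A class stable under the averages \<open>Av\<close> and their locally uniform limits
  \<open>Tc\<close>. Holomorphy in one variable at a time is what the power series in that variable
  ask for.\<close>

definition nice :: "(complex ^ 'n \<Rightarrow> complex) \<Rightarrow> bool" where
  "nice F \<longleftrightarrow> (\<forall>z\<in>D. \<forall>i\<in>J. (\<lambda>\<zeta>. F (vupd z i \<zeta>)) holomorphic_on ball 0 \<delta>) \<and>
     continuous_on D F \<and> (\<forall>z\<in>D. cmod (F z) \<le> M)"

definition Av :: "'n \<Rightarrow> nat \<Rightarrow> nat \<Rightarrow> (complex ^ 'n \<Rightarrow> complex) \<Rightarrow> complex ^ 'n \<Rightarrow> complex" where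
  "Av i N k F z = root_avg N k (\<lambda>\<zeta>. F (vupd z i \<zeta>)) (z $ i)"

definition Tc :: "'n \<Rightarrow> nat \<Rightarrow> (complex ^ 'n \<Rightarrow> complex) \<Rightarrow> complex ^ 'n \<Rightarrow> complex" where
  "Tc i k F z = taylor_coeff k (\<lambda>\<zeta>. F (vupd z i \<zeta>)) * (z $ i) ^ k"

text \<open>Homogeneity under contractions as well as rotations; this allows comparison with values
  on a torus of larger radius.\<close>

definition pure :: "'n \<Rightarrow> nat \<Rightarrow> (complex ^ 'n \<Rightarrow> complex) \<Rightarrow> bool" where
  "pure i l F \<longleftrightarrow> (\<forall>z\<in>D. \<forall>c. cmod c \<le> 1 \<longrightarrow> F (vupd z i (c * z $ i)) = c ^ l * F z)"

lemma D_rotate: "z \<in> D \<Longrightarrow> x $ i = 0 \<Longrightarrow> cmod c \<le> 1 \<Longrightarrow> vupd z i (c * z $ i) \<in> D"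
  by (intro D_vupd) (auto simp: norm_mult intro: le_less_trans[OF mult_left_le_one_le] D_J)

lemma M_nonneg: "nice F \<Longrightarrow> M \<ge> 0"
proof -
  assume "nice F"
  moreover have "x \<in> D" using \<delta> by (simp add: polybox_def)
  ultimately have "cmod (F x) \<le> M" by (auto simp: nice_def)
  then show ?thesis using norm_ge_zero order_trans by blast
qed

lemma Av_eq: "Av i N k F z = (\<Sum>j<N. cis (- (2 * pi * real j * real k / real N)) * F (vupd z i (cis (2 * pi * real j / real N) * z $ i))) / of_nat N"
  by (simp add: Av_def root_avg_def)

lemma nice_Av:
  assumes F: "nice F" and i: "x $ i = 0" and N: "N > 0"
  shows "nice (Av i N k F)"
  unfolding nice_def
proof (intro conjI ballI)
  fix z j assume z: "z \<in> D" and j: "j \<in> J"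
  show "(\<lambda>\<zeta>. Av i N k F (vupd z j \<zeta>)) holomorphic_on ball 0 \<delta>"
  proof (cases "j = i")
    case True
    have hol: "(\<lambda>\<zeta>. F (vupd z i \<zeta>)) holomorphic_on ball 0 \<delta>" using F z i by (auto simp: nice_def)
    have "(\<lambda>\<zeta>. F (vupd z i (cis t * \<zeta>))) holomorphic_on ball 0 \<delta>" for t
    proof -
      have "((\<lambda>\<zeta>. F (vupd z i \<zeta>)) \<circ> (\<lambda>\<zeta>. cis t * \<zeta>)) holomorphic_on ball 0 \<delta>"
        by (rule holomorphic_on_compose_gen[OF _ hol]) (auto intro!: holomorphic_intros simp: norm_mult)
      then show ?thesis by (simp add: comp_def)
    qed
    then show ?thesis unfolding Av_eq True using N by (auto intro!: holomorphic_intros)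
  next
    case False
    have "(\<lambda>\<zeta>. F (vupd (vupd z i (cis t * z $ i)) j \<zeta>)) holomorphic_on ball 0 \<delta>" for t
    proof -
      have "vupd z i (cis t * z $ i) \<in> D" using z i by (intro D_rotate) auto
      then show ?thesis using F j by (auto simp: nice_def)
    qed
    then have "(\<lambda>\<zeta>. F (vupd (vupd z j \<zeta>) i (cis t * vupd z j \<zeta> $ i))) holomorphic_on ball 0 \<delta>" for t
      using False by (simp add: vupd_twist)
    then show ?thesis unfolding Av_eq using N by (auto intro!: holomorphic_intros)
  qed
next
  have "continuous_on D (\<lambda>z. F (vupd z i (cis t * z $ i)))" for t
  proof (rule continuous_on_compose2[of D F])
    show "continuous_on D F" using F by (simp add: nice_def)
    have "continuous_on D (\<lambda>z. if j = i then cis t * z $ i else z $ j)" for j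
      by (cases "j = i") (auto intro!: continuous_intros)
    then show "continuous_on D (\<lambda>z. vupd z i (cis t * z $ i))"
      unfolding vupd_def by (intro continuous_on_vec_lambda)
    show "(\<lambda>z. vupd z i (cis t * z $ i)) ` D \<subseteq> D" using i by (auto intro!: D_rotate)
  qed
  then show "continuous_on D (Av i N k F)" unfolding Av_eq[abs_def]
    using N by (intro continuous_intros) auto
next
  fix z assume z: "z \<in> D"
  have "cmod (\<Sum>j<N. cis (- (2 * pi * real j * real k / real N)) * F (vupd z i (cis (2 * pi * real j / real N) * z $ i))) \<le> (\<Sum>j<N. M)"
  proof (rule sum_norm_le)
    fix j
    have "vupd z i (cis (2 * pi * real j / real N) * z $ i) \<in> D" using z i by (intro D_rotate) auto
    then show "cmod (cis (- (2 * pi * real j * real k / real N)) * F (vupd z i (cis (2 * pi * real j / real N) * z $ i))) \<le> M"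
      using F by (simp add: norm_mult nice_def)
  qed
  then show "cmod (Av i N k F z) \<le> M" unfolding Av_eq using N by (simp add: norm_divide divide_le_eq mult.commute)
qed

lemma Av_approx:
  assumes F: "nice F" and i: "x $ i = 0" and z: "z \<in> D" and k: "k < N"
  shows "cmod (Av i N k F z - Tc i k F z) \<le> M * (cmod (z $ i) / \<delta>) ^ N / (1 - cmod (z $ i) / \<delta>)"
  unfolding Av_def Tc_def
proof (rule root_avg_approx)
  show "(\<lambda>\<zeta>. F (vupd z i \<zeta>)) holomorphic_on ball 0 \<delta>" using F z i by (auto simp: nice_def)
  show "cmod (F (vupd z i \<zeta>)) \<le> M" if "cmod \<zeta> < \<delta>" for \<zeta>
    using D_vupd[OF z i that] F by (auto simp: nice_def)
  show "cmod (z $ i) < \<delta>" using D_J[OF z i] .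
qed (rule k)

text \<open>Uniformity holds for \<open>cmod (z $ i) \<le> \<rho>\<close> with
  \<open>\<rho> < \<delta>\<close>, since the geometric tail blows up at the boundary. The index
  \<open>n + Suc k\<close> keeps \<open>k\<close> below the number of roots.\<close>

lemma Av_uniform_limit:
  assumes F: "nice F" and i: "x $ i = 0" and \<rho>: "0 \<le> \<rho>" "\<rho> < \<delta>"
  shows "uniform_limit {z\<in>D. cmod (z $ i) \<le> \<rho>} (\<lambda>n. Av i (n + Suc k) k F) (Tc i k F) sequentially"
proof (rule uniform_limitI)
  fix e :: real assume e: "e > 0"
  define q where "q = \<rho> / \<delta>"
  have q: "0 \<le> q" "q < 1" using \<rho> \<delta> by (auto simp: q_def)
  have M: "M \<ge> 0" using M_nonneg[OF F] .
  have "(\<lambda>n. M * q ^ (n + Suc k) / (1 - q)) \<longlonglongrightarrow> M * 0 / (1 - q)"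
    using q LIMSEQ_ignore_initial_segment[OF LIMSEQ_power_zero[of q], of "Suc k"]
    by (intro tendsto_intros) auto
  then have "eventually (\<lambda>n. M * q ^ (n + Suc k) / (1 - q) < e) sequentially"
    using e by (intro order_tendstoD(2)) auto
  then show "\<forall>\<^sub>F n in sequentially. \<forall>z\<in>{z\<in>D. cmod (z $ i) \<le> \<rho>}. dist (Av i (n + Suc k) k F z) (Tc i k F z) < e"
  proof eventually_elim
    case (elim n)
    show ?case
    proof
      fix z assume "z \<in> {z\<in>D. cmod (z $ i) \<le> \<rho>}"
      then have z: "z \<in> D" "cmod (z $ i) / \<delta> \<le> q" using \<delta> by (auto simp: q_def divide_right_mono)
      have "dist (Av i (n + Suc k) k F z) (Tc i k F z) \<le> M * (cmod (z $ i) / \<delta>) ^ (n + Suc k) / (1 - cmod (z $ i) / \<delta>)"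
        unfolding dist_norm by (rule Av_approx[OF F i z(1)]) simp
      also have "\<dots> \<le> M * q ^ (n + Suc k) / (1 - q)"
        using z q M \<delta> by (intro frac_le mult_left_mono power_mono mult_nonneg_nonneg) auto
      also note elim
      finally show "dist (Av i (n + Suc k) k F z) (Tc i k F z) < e" .
    qed
  qed
qed

lemma Av_tendsto:
  assumes F: "nice F" and i: "x $ i = 0" and z: "z \<in> D"
  shows "(\<lambda>n. Av i (n + Suc k) k F z) \<longlonglongrightarrow> Tc i k F z"
  using tendsto_uniform_limitI[OF Av_uniform_limit[OF F i, of "cmod (z $ i)" k]] z D_J[OF z i] by auto

text \<open>In the variable \<open>i\<close> the function is explicitly a monomial; in the other
  variables it is a locally uniform limit of averages, because moving them leaves
  \<open>z $ i\<close> fixed.\<close>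

lemma nice_Tc:
  assumes F: "nice F" and i: "x $ i = 0"
  shows "nice (Tc i k F)"
  unfolding nice_def
proof (intro conjI ballI)
  have nA: "nice (Av i (n + Suc k) k F)" for n by (rule nice_Av[OF F i]) simp
  then have cA: "continuous_on D (Av i (n + Suc k) k F)" and bA: "z \<in> D \<Longrightarrow> cmod (Av i (n + Suc k) k F z) \<le> M" for n z
    unfolding nice_def by blast+
  {
    fix z j assume z: "z \<in> D" and j: "j \<in> J"
    show "(\<lambda>\<zeta>. Tc i k F (vupd z j \<zeta>)) holomorphic_on ball 0 \<delta>"
    proof (cases "j = i")
      case True
      then show ?thesis by (auto simp: Tc_def intro!: holomorphic_intros)
    next
      case False
      show ?thesis
      proof (rule holomorphic_uniform_sequence)
        show "(\<lambda>\<zeta>. Av i (n + Suc k) k F (vupd z j \<zeta>)) holomorphic_on ball 0 \<delta>" for n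
          using nA[of n] z j unfolding nice_def by blast
        fix \<zeta> assume \<zeta>: "\<zeta> \<in> ball (0::complex) \<delta>"
        obtain d where d: "d > 0" "cball \<zeta> d \<subseteq> ball 0 \<delta>" using \<zeta> open_contains_cball open_ball by blast
        have "uniform_limit (cball \<zeta> d) (\<lambda>n \<zeta>. Av i (n + Suc k) k F (vupd z j \<zeta>)) (\<lambda>\<zeta>. Tc i k F (vupd z j \<zeta>)) sequentially"
        proof (rule uniform_limit_compose'[OF Av_uniform_limit[OF F i, of "cmod (z $ i)" k]])
          show "(\<lambda>\<zeta>. vupd z j \<zeta>) \<in> cball \<zeta> d \<rightarrow> {za \<in> D. cmod (za $ i) \<le> cmod (z $ i)}"
            using d False D_vupd[OF z] j by auto
        qed (use D_J[OF z i] in auto)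
        then show "\<exists>d>0. cball \<zeta> d \<subseteq> ball 0 \<delta> \<and> uniform_limit (cball \<zeta> d) (\<lambda>n \<zeta>. Av i (n + Suc k) k F (vupd z j \<zeta>)) (\<lambda>\<zeta>. Tc i k F (vupd z j \<zeta>)) sequentially"
          using d by blast
      qed simp
    qed
  }
  show "continuous_on D (Tc i k F)"
  proof (rule continuous_at_imp_continuous_on, rule ballI)
    fix z assume z: "z \<in> D"
    define \<rho> where "\<rho> = (cmod (z $ i) + \<delta>) / 2"
    have \<rho>: "cmod (z $ i) < \<rho>" "\<rho> < \<delta>" "0 \<le> \<rho>" using D_J[OF z i] \<delta> by (auto simp: \<rho>_def)
    let ?S = "D \<inter> {z. cmod (z $ i) < \<rho>}"
    have "open ?S" by (intro open_Int open_polybox open_Collect_less continuous_intros)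
    have "continuous_on ?S (Tc i k F)"
    proof (rule uniform_limit_theorem)
      show "\<forall>\<^sub>F n in sequentially. continuous_on ?S (Av i (n + Suc k) k F)"
        by (intro always_eventually allI continuous_on_subset[OF cA]) auto
      show "uniform_limit ?S (\<lambda>n. Av i (n + Suc k) k F) (Tc i k F) sequentially"
        by (rule uniform_limit_on_subset[OF Av_uniform_limit[OF F i \<rho>(3,2)]]) auto
    qed simp
    then show "isCont (Tc i k F) z"
      using \<open>open ?S\<close> z \<rho> by (simp add: continuous_on_eq_continuous_at)
  qed
  fix z assume z: "z \<in> D"
  show "cmod (Tc i k F z) \<le> M"
  proof (rule tendsto_upperbound)
    show "(\<lambda>n. cmod (Av i (n + Suc k) k F z)) \<longlonglongrightarrow> cmod (Tc i k F z)"
      by (intro tendsto_norm Av_tendsto F i z)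
    show "\<forall>\<^sub>F n in sequentially. cmod (Av i (n + Suc k) k F z) \<le> M"
      using bA[OF z] by simp
  qed simp
qed

lemma Tc_sums:
  assumes F: "nice F" and i: "x $ i = 0" and z: "z \<in> D"
  shows "(\<lambda>k. Tc i k F z) sums F z"
proof -
  have "(\<lambda>\<zeta>. F (vupd z i \<zeta>)) holomorphic_on ball 0 \<delta>" using F z i by (auto simp: nice_def)
  from taylor_sums[OF this D_J[OF z i]] show ?thesis by (simp add: Tc_def)
qed

lemma pure_Tc_same: "pure i k (Tc i k F)"
  by (simp add: pure_def Tc_def power_mult_distrib)

text \<open>Scaling the coordinate \<open>j\<close> commutes with rotating the coordinate
  \<open>i\<close>, so averages inherit purity, and so do their limits.\<close>

lemma pure_Tc_other:
  assumes F: "nice F" and i: "x $ i = 0" and j: "x $ j = 0" "j \<noteq> i" and p: "pure j l F"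
  shows "pure j l (Tc i k F)"
  unfolding pure_def
proof (intro ballI allI impI)
  fix z c assume z: "z \<in> D" and c: "cmod (c::complex) \<le> 1"
  have eq: "Av i N k F (vupd z j (c * z $ j)) = c ^ l * Av i N k F z" for N
  proof -
    have "F (vupd (vupd z j (c * z $ j)) i (cis t * vupd z j (c * z $ j) $ i)) = c ^ l * F (vupd z i (cis t * z $ i))" for t
    proof -
      define z' where "z' = vupd z i (cis t * z $ i)"
      have "z' \<in> D" unfolding z'_def using z i by (intro D_rotate) auto
      then have "F (vupd z' j (c * z' $ j)) = c ^ l * F z'" using p c unfolding pure_def by blast
      moreover have "vupd z' j (c * z' $ j) = vupd (vupd z j (c * z $ j)) i (cis t * vupd z j (c * z $ j) $ i)"
        using j by (simp add: z'_def vupd_twist[of i j])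
      ultimately show ?thesis by (simp add: z'_def)
    qed
    then have "Av i N k F (vupd z j (c * z $ j)) = (\<Sum>m<N. cis (- (2 * pi * real m * real k / real N)) *
        (c ^ l * F (vupd z i (cis (2 * pi * real m / real N) * z $ i)))) / of_nat N"
      by (simp only: Av_eq)
    then show ?thesis by (simp add: Av_eq sum_distrib_left mult_ac)
  qed
  have "(\<lambda>n. Av i (n + Suc k) k F (vupd z j (c * z $ j))) \<longlonglongrightarrow> Tc i k F (vupd z j (c * z $ j))"
    by (intro Av_tendsto F i D_rotate z j c)
  moreover have "(\<lambda>n. Av i (n + Suc k) k F (vupd z j (c * z $ j))) \<longlonglongrightarrow> c ^ l * Tc i k F z"
    unfolding eq by (intro tendsto_intros Av_tendsto F i z)
  ultimately show "Tc i k F (vupd z j (c * z $ j)) = c ^ l * Tc i k F z" by (rule LIMSEQ_unique)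
qed

lemma pure_scale:
  assumes p: "\<And>i. i \<in> S \<Longrightarrow> pure i (l i) F" and S: "finite S" "S \<subseteq> J" and z: "z \<in> D" and c: "\<And>i. i \<in> S \<Longrightarrow> cmod (c i) \<le> 1"
  shows "F (\<chi> i. if i \<in> S then c i * z $ i else z $ i) = (\<Prod>i\<in>S. c i ^ l i) * F z \<and>
    (\<chi> i. if i \<in> S then c i * z $ i else z $ i) \<in> D"
  using S(1,2) p c
proof (induction S)
  case (insert j S)
  let ?v = "\<chi> i. if i \<in> S then c i * z $ i else z $ i"
  have IH: "F ?v = (\<Prod>i\<in>S. c i ^ l i) * F z" "?v \<in> D" using insert by auto
  have v: "(\<chi> i. if i \<in> insert j S then c i * z $ i else z $ i) = vupd ?v j (c j * ?v $ j)"
    using insert.hyps by (auto simp: vec_eq_iff vupd_nth)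
  have cj: "cmod (c j) \<le> 1" and xj: "x $ j = 0" using insert.prems by auto
  have "F (vupd ?v j (c j * ?v $ j)) = c j ^ l j * F ?v"
    using insert.prems(2)[of j] IH(2) cj unfolding pure_def by blast
  moreover have "vupd ?v j (c j * ?v $ j) \<in> D" by (intro D_rotate IH xj cj)
  ultimately show ?case unfolding v using insert.hyps by (simp add: IH(1))
qed (use z in auto)

text \<open>Contract from the point whose coordinates in \<open>J\<close> all equal \<rho>, where
  the bound \<open>M\<close> applies, and let \<rho> tend to \<delta>.\<close>

lemma pure_bound:
  assumes F: "nice F" and p: "\<And>i. i \<in> J \<Longrightarrow> pure i (l i) F" and z: "z \<in> D"
  shows "cmod (F z) \<le> M * (\<Prod>i\<in>J. (cmod (z $ i) / \<delta>) ^ l i)"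
proof (rule tendsto_lowerbound)
  show "((\<lambda>\<rho>. M * (\<Prod>i\<in>J. (cmod (z $ i) / \<rho>) ^ l i)) \<longlongrightarrow> M * (\<Prod>i\<in>J. (cmod (z $ i) / \<delta>) ^ l i)) (at_left \<delta>)"
    using \<delta> by (intro tendsto_intros) auto
  define m where "m = Max (insert 0 ((\<lambda>i. cmod (z $ i)) ` J))"
  have m: "m \<ge> 0" "\<And>i. i \<in> J \<Longrightarrow> cmod (z $ i) \<le> m" unfolding m_def by (auto intro!: Max_ge)
  have "m < \<delta>" unfolding m_def using \<delta> D_J[OF z] by (subst Max_less_iff) auto
  then have "eventually (\<lambda>\<rho>. \<rho> \<in> {m<..<\<delta>}) (at_left \<delta>)" by (rule eventually_at_left_real)
  then show "\<forall>\<^sub>F \<rho> in at_left \<delta>. cmod (F z) \<le> M * (\<Prod>i\<in>J. (cmod (z $ i) / \<rho>) ^ l i)"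
  proof eventually_elim
    case (elim \<rho>)
    have \<rho>: "\<rho> > 0" "\<rho> < \<delta>" using elim m by auto
    define w where "w = (\<chi> i. if i \<in> J then complex_of_real \<rho> else z $ i)"
    have w: "w \<in> D" using z \<rho> by (auto simp: polybox_def w_def)
    have zw: "z = (\<chi> i. if i \<in> J then (z $ i / of_real \<rho>) * w $ i else w $ i)"
      using \<rho> by (auto simp: vec_eq_iff w_def)
    have le: "cmod (z $ i) \<le> \<rho>" if "i \<in> J" for i using m(2)[OF that] elim by auto
    have "F z = (\<Prod>i\<in>J. (z $ i / of_real \<rho>) ^ l i) * F w"
      by (subst zw, rule pure_scale[where S = J, THEN conjunct1])
         (use p w le \<rho> in \<open>auto simp: norm_divide divide_le_eq_1\<close>)
    then have "cmod (F z) = (\<Prod>i\<in>J. (cmod (z $ i) / \<rho>) ^ l i) * cmod (F w)"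
      using \<rho> by (simp add: norm_mult norm_power norm_divide flip: prod_norm)
    also have "\<dots> \<le> (\<Prod>i\<in>J. (cmod (z $ i) / \<rho>) ^ l i) * M"
      using F w \<rho> by (intro mult_left_mono prod_nonneg) (auto simp: nice_def)
    finally show ?case by (simp add: mult.commute)
  qed
qed simp

text \<open>\<open>Q\<close> is a torus invariant size condition on functions; \<open>A\<close> is the set of exponents of
  the homogeneous functions satisfying it.\<close>

theorem domination:
  assumes Q_Av: "\<And>F i N k. nice F \<Longrightarrow> Q F \<Longrightarrow> x $ i = 0 \<Longrightarrow> N > 0 \<Longrightarrow> Q (Av i N k F)"
    and Q_lim: "\<And>Fs F. (\<And>n. nice (Fs n)) \<Longrightarrow> (\<And>n. Q (Fs n)) \<Longrightarrow> nice F \<Longrightarrow> (\<And>z. z \<in> D \<Longrightarrow> (\<lambda>n::nat. Fs n z) \<longlonglongrightarrow> F z) \<Longrightarrow> Q F"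
    and Q_pure: "\<And>F l z. nice F \<Longrightarrow> Q F \<Longrightarrow> (\<And>i. i \<in> J \<Longrightarrow> pure i (l i) F) \<Longrightarrow> (\<And>i. i \<notin> J \<Longrightarrow> l i = 0) \<Longrightarrow> z \<in> D \<Longrightarrow> F z \<noteq> 0 \<Longrightarrow> l \<in> A"
    and F: "nice F" "Q F" and z: "z \<in> D" "\<And>i. i \<in> J \<Longrightarrow> cmod (z $ i) < \<delta> / 2"
    and t: "t \<ge> 0" "\<And>a. a \<in> A \<Longrightarrow> (\<Prod>i\<in>J. (2 * cmod (z $ i) / \<delta>) ^ a i) \<le> t"
  shows "cmod (F z) \<le> 2 ^ card J * M * t"
proof -
  \<comment> \<open>Induction on the set \<open>S\<close> of coordinates in which \<open>F\<close>
    is not yet homogeneous. Expanding in one of them costs a factor 2: the \<open>k\<close>-th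
    component at \<open>z\<close> is \<open>(1/2) ^ k\<close> times its value at the point with that
    coordinate doubled, and a geometric series is summed.\<close>
  have main: "cmod (F z) \<le> 2 ^ card S * M * t"
    if "finite S" "S \<subseteq> J" "nice F" "Q F" "\<And>i. i \<in> J - S \<Longrightarrow> pure i (l i) F" "z \<in> D" "\<And>i. i \<in> S \<Longrightarrow> cmod (z $ i) < \<delta> / 2"
      "\<And>a. a \<in> A \<Longrightarrow> (\<And>i. i \<in> J - S \<Longrightarrow> a i = l i) \<Longrightarrow> (\<Prod>i\<in>J. ((if i \<in> S then 2 else 1) * cmod (z $ i) / \<delta>) ^ a i) \<le> t"
    for S F l z
    using that
  proof (induction S arbitrary: F l z)
    case empty
    note F = empty(2,3) and z = empty(5)
    define l' where "l' i = (if i \<in> J then l i else 0)" for i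
    have M: "M \<ge> 0" using M_nonneg[OF F(1)] .
    show ?case
    proof (cases "F z = 0")
      case True
      then show ?thesis using M t(1) by simp
    next
      case False
      have pl: "pure i (l' i) F" if "i \<in> J" for i using empty(4)[of i] that by (simp add: l'_def)
      have "l' \<in> A" by (rule Q_pure[OF F pl _ z False]) (auto simp: l'_def)
      then have "(\<Prod>i\<in>J. ((if i \<in> {} then 2 else 1) * cmod (z $ i) / \<delta>) ^ l' i) \<le> t"
        by (rule empty(7)) (simp add: l'_def)
      then have "(\<Prod>i\<in>J. (cmod (z $ i) / \<delta>) ^ l' i) \<le> t" by simp
      then have "M * (\<Prod>i\<in>J. (cmod (z $ i) / \<delta>) ^ l' i) \<le> M * t" using M by (intro mult_left_mono)
      with pure_bound[OF F(1) pl z] show ?thesis by simp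
    qed
  next
    case (insert i S)
    note F = insert.prems(2,3)
    have i: "x $ i = 0" using insert.prems(1) by simp
    have M: "M \<ge> 0" using M_nonneg[OF F(1)] .
    define z' where "z' = vupd z i (2 * z $ i)"
    have z': "z' \<in> D" unfolding z'_def using insert.prems(6)[of i] i insert.prems(5) by (intro D_vupd) (auto simp: norm_mult)
    have zz': "z = vupd z' i ((1/2) * z' $ i)" by (simp add: z'_def)
    have QT: "Q (Tc i k F)" for k
    proof (rule Q_lim[of "\<lambda>n. Av i (n + Suc k) k F"])
      show "nice (Av i (n + Suc k) k F)" for n by (rule nice_Av[OF F(1) i]) simp
      show "Q (Av i (n + Suc k) k F)" for n by (rule Q_Av[OF F i]) simp
      show "nice (Tc i k F)" by (rule nice_Tc[OF F(1) i])
      show "(\<lambda>n. Av i (n + Suc k) k F z) \<longlonglongrightarrow> Tc i k F z" if "z \<in> D" for z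
        by (rule Av_tendsto[OF F(1) i that])
    qed
    have bound: "cmod (Tc i k F z) \<le> (1/2) ^ k * (2 ^ card S * M * t)" for k
    proof -
      have "cmod (1/2 :: complex) \<le> 1" by (simp add: norm_divide)
      then have "Tc i k F (vupd z' i ((1/2) * z' $ i)) = (1/2) ^ k * Tc i k F z'"
        using pure_Tc_same[of i k F] z' unfolding pure_def by blast
      then have "Tc i k F z = (1/2) ^ k * Tc i k F z'" unfolding zz'[symmetric] .
      then have "cmod (Tc i k F z) = (1/2) ^ k * cmod (Tc i k F z')" by (simp add: norm_mult norm_power norm_divide)
      also have "cmod (Tc i k F z') \<le> 2 ^ card S * M * t"
      proof (rule insert.IH[where l = "l(i := k)"])
        show "S \<subseteq> J" "nice (Tc i k F)" "Q (Tc i k F)" "z' \<in> D"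
          using insert.prems(1) nice_Tc[OF F(1) i] QT z' by auto
        show "pure j ((l(i := k)) j) (Tc i k F)" if j: "j \<in> J - S" for j
        proof (cases "j = i")
          case True
          then show ?thesis by (simp add: pure_Tc_same)
        next
          case False
          then show ?thesis using j insert.prems(4)[of j] by (auto intro!: pure_Tc_other F i)
        qed
        show "cmod (z' $ j) < \<delta> / 2" if "j \<in> S" for j
          using insert.prems(6)[of j] that insert.hyps by (auto simp: z'_def vupd_nth)
        fix a assume a: "a \<in> A" "\<And>j. j \<in> J - S \<Longrightarrow> a j = (l(i := k)) j"
        have "(\<Prod>j\<in>J. ((if j \<in> S then 2 else 1) * cmod (z' $ j) / \<delta>) ^ a j) = (\<Prod>j\<in>J. ((if j \<in> insert i S then 2 else 1) * cmod (z $ j) / \<delta>) ^ a j)"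
          using insert.hyps by (intro prod.cong) (auto simp: z'_def vupd_nth norm_mult)
        also have "\<dots> \<le> t"
        proof (rule insert.prems(7)[OF a(1)])
          fix j assume "j \<in> J - insert i S"
          then show "a j = l j" using a(2)[of j] by auto
        qed
        finally show "(\<Prod>j\<in>J. ((if j \<in> S then 2 else 1) * cmod (z' $ j) / \<delta>) ^ a j) \<le> t" .
      qed
      finally show ?thesis by (simp add: mult_left_mono)
    qed
    have "F z = (\<Sum>k. Tc i k F z)" using Tc_sums[OF F(1) i insert.prems(5)] by (simp add: sums_iff)
    also have "cmod \<dots> \<le> (\<Sum>k. (1/2) ^ k * (2 ^ card S * M * t))"
      by (rule norm_suminf_le[OF bound]) (intro summable_mult2 summable_geometric, simp)
    also have "\<dots> = 2 * (2 ^ card S * M * t)"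
      by (subst suminf_mult2[symmetric]) (auto simp: suminf_geometric)
    finally show ?case using insert.hyps by simp
  qed
  show ?thesis by (rule main[of J]) (use F z t in auto)
qed

end

subsection \<open>Multiplier ideals of toric functions\<close>

lemma nn_integral_lborel_translate:
  fixes h :: "'a::euclidean_space \<Rightarrow> ennreal"
  assumes [measurable]: "h \<in> borel_measurable borel"
  shows "(\<integral>\<^sup>+ x. h (c + x) \<partial>lborel) = (\<integral>\<^sup>+ x. h x \<partial>lborel)"
  by (subst (2) lborel_distr_plus[of c, symmetric], subst nn_integral_distr) auto

lemma nn_integral_lborel_reflect:
  fixes h :: "'a::euclidean_space \<Rightarrow> ennreal"
  assumes [measurable]: "h \<in> borel_measurable borel"
  shows "(\<integral>\<^sup>+ x. h (c - x) \<partial>lborel) = (\<integral>\<^sup>+ x. h x \<partial>lborel)"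
proof -
  have "lborel = distr lborel borel (\<lambda>x::'a. c - x)"
    using lborel_affine[of "-1" c] by (simp add: density_1)
  then have "(\<integral>\<^sup>+ x. h x \<partial>lborel) = (\<integral>\<^sup>+ x. h x \<partial>distr lborel borel (\<lambda>x::'a. c - x))" by simp
  then show ?thesis by (subst (asm) nn_integral_distr) auto
qed

text \<open>The image measure is translation invariant; by the usual Fubini argument it is then
  proportional to Lebesgue measure, and both agree on the unit ball.\<close>

lemma distr_lborel_isometry:
  fixes f :: "'a::euclidean_space \<Rightarrow> 'a"
  assumes lin: "linear f" and iso: "\<And>x. norm (f x) = norm x"
  shows "distr lborel borel f = lborel"
proof -
  have [measurable]: "f \<in> borel_measurable borel"
    using linear_continuous_on[OF linear_conv_bounded_linear[THEN iffD1, OF lin]]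
    by (rule borel_measurable_continuous_onI)
  have "inj f" using iso by (simp add: linear_injective_0[OF lin]) (metis norm_eq_zero)
  then have "surj f" using linear_injective_imp_surjective[OF lin] by blast
  define \<mu> where "\<mu> = distr lborel borel f"
  have [simp, measurable_cong]: "sets \<mu> = sets borel" by (simp add: \<mu>_def)
  have [simp]: "space \<mu> = UNIV" by (simp add: \<mu>_def)
  have ball: "emeasure \<mu> (ball 0 R) = emeasure lborel (ball (0::'a) R)" for R
  proof -
    have "f -` ball 0 R = ball 0 R" using iso by auto
    then show ?thesis by (simp add: \<mu>_def emeasure_distr)
  qed
  have trans: "(\<integral>\<^sup>+ x. h (c + x) \<partial>\<mu>) = (\<integral>\<^sup>+ x. h x \<partial>\<mu>)" if [measurable]: "h \<in> borel_measurable borel" for h :: "'a \<Rightarrow> ennreal" and c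
  proof -
    obtain c' where c': "c = f c'" using \<open>surj f\<close> by (metis surjD)
    have "(\<integral>\<^sup>+ x. h (c + x) \<partial>\<mu>) = (\<integral>\<^sup>+ x. h (f (c' + x)) \<partial>lborel)"
      unfolding \<mu>_def by (subst nn_integral_distr) (auto simp: c' linear_add[OF lin])
    also have "\<dots> = (\<integral>\<^sup>+ x. h (f x) \<partial>lborel)"
      by (rule nn_integral_lborel_translate) measurable
    also have "\<dots> = (\<integral>\<^sup>+ x. h x \<partial>\<mu>)" unfolding \<mu>_def by (subst nn_integral_distr) auto
    finally show ?thesis .
  qed
  have "sigma_finite_measure \<mu>"
  proof
    show "\<exists>A. countable A \<and> A \<subseteq> sets \<mu> \<and> \<Union> A = space \<mu> \<and> (\<forall>a\<in>A. emeasure \<mu> a \<noteq> \<infinity>)"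
    proof (intro exI[of _ "range (\<lambda>n::nat. ball 0 (real n))"] conjI ballI)
      show "\<Union> (range (\<lambda>n::nat. ball 0 (real n))) = space \<mu>"
        using real_arch_simple reals_Archimedean2 by auto
    qed (auto simp: ball emeasure_ball)
  qed
  then interpret \<mu>: sigma_finite_measure \<mu> .
  interpret pair_sigma_finite lborel \<mu> ..
  have eq: "emeasure \<mu> A * emeasure lborel B = emeasure lborel A * emeasure \<mu> B"
    if [measurable]: "A \<in> sets borel" "B \<in> sets borel" for A B
  proof -
    have "emeasure \<mu> A * emeasure lborel B = (\<integral>\<^sup>+ x. indicator A x * (\<integral>\<^sup>+ y. indicator B y \<partial>lborel) \<partial>\<mu>)"
      by (simp add: nn_integral_multc)
    also have "\<dots> = (\<integral>\<^sup>+ x. indicator A x * (\<integral>\<^sup>+ y. indicator B (x + y) \<partial>lborel) \<partial>\<mu>)"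
      by (subst nn_integral_lborel_translate) auto
    also have "\<dots> = (\<integral>\<^sup>+ x. (\<integral>\<^sup>+ y. indicator A x * indicator B (x + y) \<partial>lborel) \<partial>\<mu>)"
      by (subst nn_integral_cmult) auto
    also have "\<dots> = (\<integral>\<^sup>+ y. (\<integral>\<^sup>+ x. indicator A x * indicator B (x + y) \<partial>\<mu>) \<partial>lborel)"
      by (rule Fubini') measurable
    also have "\<dots> = (\<integral>\<^sup>+ y. (\<integral>\<^sup>+ x. indicator A (- y + x) * indicator B x \<partial>\<mu>) \<partial>lborel)"
    proof (rule nn_integral_cong)
      fix y :: 'a
      have "(\<integral>\<^sup>+ x. indicator A (- y + x) * indicator B ((- y + x) + y) \<partial>\<mu>) = (\<integral>\<^sup>+ x. indicator A x * indicator B (x + y) \<partial>\<mu>)"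
        by (rule trans) measurable
      then show "(\<integral>\<^sup>+ x. indicator A x * indicator B (x + y) \<partial>\<mu>) = (\<integral>\<^sup>+ x. indicator A (- y + x) * (indicator B x :: ennreal) \<partial>\<mu>)"
        by simp
    qed
    also have "\<dots> = (\<integral>\<^sup>+ x. (\<integral>\<^sup>+ y. indicator A (- y + x) * indicator B x \<partial>lborel) \<partial>\<mu>)"
      by (rule Fubini'[symmetric]) measurable
    also have "\<dots> = (\<integral>\<^sup>+ x. (\<integral>\<^sup>+ y. indicator A (x - y) \<partial>lborel) * indicator B x \<partial>\<mu>)"
      by (subst nn_integral_multc[symmetric]) auto
    also have "\<dots> = (\<integral>\<^sup>+ x. (\<integral>\<^sup>+ y. indicator A y \<partial>lborel) * indicator B x \<partial>\<mu>)"
      by (subst nn_integral_lborel_reflect) auto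
    also have "\<dots> = emeasure lborel A * emeasure \<mu> B"
      by (simp add: nn_integral_cmult)
    finally show ?thesis .
  qed
  have "emeasure \<mu> A = emeasure lborel A" if A: "A \<in> sets borel" for A
  proof -
    define v where "v = emeasure lborel (ball (0::'a) 1)"
    have "unit_ball_vol (real DIM('a)) \<noteq> 0"
      using unit_ball_vol_pos[of "real DIM('a)"] by linarith
    then have v: "v \<noteq> 0" "v \<noteq> \<infinity>" by (simp_all add: v_def emeasure_ball)
    have "emeasure \<mu> A * v = emeasure lborel A * v" using eq[OF A, of "ball 0 1"] by (simp add: ball v_def)
    then have "v * emeasure \<mu> A = v * emeasure lborel A" by (simp add: mult.commute)
    then show ?thesis using v by (simp add: ennreal_mult_cancel_left)
  qed
  then show ?thesis unfolding \<mu>_def[symmetric] by (intro measure_eqI) auto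
qed

lemma nn_integral_rotate_coord:
  fixes h :: "complex ^ 'n \<Rightarrow> ennreal"
  assumes [measurable]: "h \<in> borel_measurable borel" and c: "cmod c = 1"
  shows "(\<integral>\<^sup>+ z. h (vupd z i (c * z $ i)) \<partial>lborel) = (\<integral>\<^sup>+ z. h z \<partial>lborel)"
proof -
  let ?f = "\<lambda>z :: complex ^ 'n. vupd z i (c * z $ i)"
  have lin: "linear ?f"
    by (rule linearI) (auto simp: vec_eq_iff vupd_nth algebra_simps)
  have iso: "norm (?f z) = norm z" for z
    unfolding norm_vec_def by (intro arg_cong2[where f = L2_set] ext refl) (auto simp: vupd_nth norm_mult c)
  have [measurable]: "?f \<in> borel_measurable borel"
    using linear_continuous_on[OF linear_conv_bounded_linear[THEN iffD1, OF lin]]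
    by (rule borel_measurable_continuous_onI)
  have "(\<integral>\<^sup>+ z. h (?f z) \<partial>lborel) = (\<integral>\<^sup>+ z. h z \<partial>distr lborel borel ?f)"
    by (subst nn_integral_distr) auto
  then show ?thesis by (simp add: distr_lborel_isometry[OF lin iso])
qed

lemma measurable_weight [measurable]: "weight \<in> borel_measurable borel"
  unfolding weight_def[abs_def] by measurable

section \<open>Holomorphic functions of several variables\<close>

lemma holo_on_subset: "holo_on V f \<Longrightarrow> W \<subseteq> V \<Longrightarrow> holo_on W f"
  by (auto simp: holo_on_def)

lemma holo_on_const: "holo_on V (\<lambda>_. c)"
  unfolding holo_on_def by (auto intro!: exI[of _ "\<lambda>_. 0"])

lemma holo_on_nth: "holo_on V (\<lambda>z. z $ i)"
  unfolding holo_on_def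
  by (auto intro!: exI[of _ "\<lambda>z. z $ i"] bounded_linear_imp_has_derivative bounded_linear_vec_nth)

lemma holo_on_mult:
  assumes "holo_on V f" "holo_on V g" shows "holo_on V (\<lambda>z. f z * g z)"
  unfolding holo_on_def
proof
  fix z assume "z \<in> V"
  then obtain L K where L: "(f has_derivative L) (at z)" "\<forall>c v. L (c *s v) = c * L v"
    and K: "(g has_derivative K) (at z)" "\<forall>c v. K (c *s v) = c * K v"
    using assms unfolding holo_on_def by meson
  show "\<exists>L. ((\<lambda>z. f z * g z) has_derivative L) (at z) \<and> (\<forall>c v. L (c *s v) = c * L v)"
    using L K by (intro exI[of _ "\<lambda>h. f z * K h + L h * g z"] conjI has_derivative_mult) (auto simp: algebra_simps)
qed

lemma holo_on_power: "holo_on V f \<Longrightarrow> holo_on V (\<lambda>z. f z ^ k)"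
  by (induction k) (auto intro: holo_on_const holo_on_mult)

lemma holo_on_prod: "finite S \<Longrightarrow> (\<And>i. i \<in> S \<Longrightarrow> holo_on V (f i)) \<Longrightarrow> holo_on V (\<lambda>z. \<Prod>i\<in>S. f i z)"
  by (induction S rule: finite_induct) (auto intro: holo_on_const holo_on_mult)

lemma holo_on_mon: "holo_on V (mon a)"
  unfolding mon_def[abs_def] by (intro holo_on_prod holo_on_power holo_on_nth) simp

lemma holo_on_imp_continuous_on: "holo_on V f \<Longrightarrow> continuous_on V f"
  unfolding holo_on_def
  by (intro continuous_at_imp_continuous_on ballI) (metis has_derivative_continuous)

lemma (in reinhardt) holo_on_imp_nice:
  assumes f: "holo_on D f" and M: "\<And>z. z \<in> D \<Longrightarrow> cmod (f z) \<le> M"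
  shows "nice f"
  unfolding nice_def
proof (intro conjI ballI holo_on_imp_continuous_on f M)
  fix z i assume z: "z \<in> D" and i: "i \<in> J"
  have "(\<lambda>\<zeta>. f (vupd z i \<zeta>)) field_differentiable at \<zeta>" if \<zeta>: "\<zeta> \<in> ball 0 \<delta>" for \<zeta>
  proof -
    have "vupd z i \<zeta> \<in> D" using z i \<zeta> by (intro D_vupd) auto
    then obtain L where L: "(f has_derivative L) (at (vupd z i \<zeta>))" "\<forall>c v. L (c *s v) = c * L v"
      using f unfolding holo_on_def by blast
    define E :: "complex \<Rightarrow> complex ^ 'n" where "E w = (\<chi> j. if j = i then w else 0)" for w
    have "linear E" by (rule linearI) (auto simp: E_def vec_eq_iff)
    then have "bounded_linear E" by (rule linear_conv_bounded_linear[THEN iffD1])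
    then have "((\<lambda>w. vupd z i 0 + E w) has_derivative (\<lambda>w. 0 + E w)) (at \<zeta>)"
      by (intro has_derivative_add has_derivative_const bounded_linear_imp_has_derivative)
    moreover have "(\<lambda>w. vupd z i 0 + E w) = vupd z i"
      by (rule ext) (auto simp: E_def vec_eq_iff vupd_nth)
    ultimately have V: "(vupd z i has_derivative E) (at \<zeta>)" by simp
    have "((\<lambda>w. f (vupd z i w)) has_derivative (\<lambda>w. L (E w))) (at \<zeta>)"
      using diff_chain_at[OF V L(1)] by (simp add: comp_def)
    moreover have "E w = w *s axis i 1" for w :: complex
      by (auto simp: vec_eq_iff axis_def E_def)
    ultimately have "((\<lambda>w. f (vupd z i w)) has_derivative (\<lambda>w. w * L (axis i 1))) (at \<zeta>)"
      using L(2) by simp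
    then have "((\<lambda>w. f (vupd z i w)) has_field_derivative L (axis i 1)) (at \<zeta>)"
    proof -
      have "(\<lambda>w. w * L (axis i 1)) = (\<lambda>w. L (axis i 1) * w)" by (simp add: fun_eq_iff mult.commute)
      with \<open>((\<lambda>w. f (vupd z i w)) has_derivative (\<lambda>w. w * L (axis i 1))) (at \<zeta>)\<close>
      show ?thesis unfolding has_field_derivative_def by simp
    qed
    then show ?thesis unfolding field_differentiable_def by blast
  qed
  then show "(\<lambda>\<zeta>. f (vupd z i \<zeta>)) holomorphic_on ball 0 \<delta>"
    by (simp add: holomorphic_on_open field_differentiable_def)
qed

context toric_fun
begin

text \<open>Extended by \<infinity> outside the open polydisk, \<phi> still has open strict sublevel
  sets.\<close>

lemma measurable_weight_phi:
  assumes V: "open V" "V \<subseteq> polydisk r"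
  shows "(\<lambda>z. weight (\<phi> z) * indicator V z) \<in> borel_measurable borel"
proof -
  define \<psi> where "\<psi> z = (if z \<in> polydisk r then \<phi> z else \<infinity>)" for z
  have [measurable]: "\<psi> \<in> borel_measurable borel"
  proof (rule borel_measurableI_less)
    fix c
    have "open {z. \<psi> z < c}"
    proof (subst open_subopen, safe)
      fix z assume lt: "\<psi> z < c"
      have "eventually (\<lambda>w. \<psi> w < c) (nhds z)"
      proof (cases "z \<in> polydisk r")
        case True
        have "eventually (\<lambda>w. w \<in> polydisk r) (nhds z)" by (rule eventually_nhds_in_open[OF open_polydisk True])
        moreover have "eventually (\<lambda>w. \<phi> w < c) (nhds z)" using usc[OF True] lt True by (simp add: \<psi>_def)
        ultimately show ?thesis by eventually_elim (simp add: \<psi>_def)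
      qed (use lt in \<open>simp add: \<psi>_def\<close>)
      then show "\<exists>T. open T \<and> z \<in> T \<and> T \<subseteq> {z. \<psi> z < c}"
        unfolding eventually_nhds by auto
    qed
    then show "{z \<in> space borel. \<psi> z < c} \<in> sets borel" by simp
  qed
  have [measurable]: "V \<in> sets borel" using V by simp
  have "(\<lambda>z. weight (\<psi> z) * indicator V z) \<in> borel_measurable borel" by measurable
  also have "(\<lambda>z. weight (\<psi> z) * indicator V z) = (\<lambda>z. weight (\<phi> z) * indicator V z)"
    using V by (auto simp: \<psi>_def indicator_def fun_eq_iff)
  finally show ?thesis .
qed

lemma zero_in_polydisk: "0 \<in> polydisk r"
  using r by (simp add: polydisk_def)

text \<open>At the origin every coordinate vanishes, so nothing is shifted and the two integrability
  criteria meet.\<close>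

lemma in_mult_ideal_mon_iff:
  "in_mult_ideal (polydisk r) \<phi> 0 (mon a) \<longleftrightarrow> shifted_exp 0 a 0 \<in> interior NB"
proof
  assume "in_mult_ideal (polydisk r) \<phi> 0 (mon a)"
  then obtain V where "open V" "0 \<in> V" "V \<subseteq> polydisk r"
    "(\<integral>\<^sup>+ z. ennreal ((cmod (mon a z))\<^sup>2) * weight (\<phi> z) * indicator V z \<partial>lborel) < \<infinity>"
    unfolding in_mult_ideal_def by blast
  from integrable_imp_interior_NB[OF this] obtain k :: nat where "shifted_exp 0 a (real k) \<in> interior NB"
    by blast
  then show "shifted_exp 0 a 0 \<in> interior NB" by (simp add: shifted_exp_def)
next
  assume e: "shifted_exp 0 a 0 \<in> interior NB"
  show "in_mult_ideal (polydisk r) \<phi> 0 (mon a)"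
  proof (rule interior_NB_imp_integrable[OF zero_in_polydisk e order_refl])
    fix \<delta> assume \<delta>: "\<delta> > 0" "polybox 0 \<delta> \<subseteq> (polydisk r :: (complex ^ 'n) set)"
      and int: "\<And>\<delta>'. 0 < \<delta>' \<Longrightarrow> \<delta>' \<le> \<delta> \<Longrightarrow> (\<integral>\<^sup>+ z. ennreal ((cmod (mon a z))\<^sup>2) * weight (\<phi> z) * indicator (polybox 0 \<delta>') z \<partial>lborel) < \<infinity>"
    have z0: "0 \<in> polybox 0 \<delta>" using \<delta>(1) by (simp add: polybox_def)
    show "in_mult_ideal (polydisk r) \<phi> 0 (mon a)"
      unfolding in_mult_ideal_def
      by (intro exI[of _ "polybox 0 \<delta>"] conjI open_polybox holo_on_mon z0 \<delta>(2) int[OF \<delta>(1) order_refl])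
  qed
qed

lemma interior_NB_pos:
  assumes "x \<in> interior NB" shows "0 < x $ i"
proof -
  have "((\<lambda>s. x - s *\<^sub>R axis i 1) \<longlongrightarrow> x - 0 *\<^sub>R axis i 1) (at_right (0::real))" by (intro tendsto_intros)
  then have "eventually (\<lambda>s. x - s *\<^sub>R axis i 1 \<in> interior NB) (at_right (0::real))"
    by (rule topological_tendstoD) (use assms in auto)
  from eventually_happens[OF eventually_conj[OF this eventually_at_right_less]]
  obtain s :: real where s: "x - s *\<^sub>R axis i 1 \<in> interior NB" "s > 0" by auto
  then have "0 \<le> (x - s *\<^sub>R axis i 1) $ i" using interior_subset by (intro NB_nonneg) blast
  then show ?thesis using s by (simp add: axis_def)
qed

text \<open>Interior points have positive coordinates, so an interior lattice point has the form
  \<open>a + 1\<close> with an exponent \<open>a\<close>. The monomials in the stalk at the origin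
  thus know all interior lattice points.\<close>

lemma lattice_interior_iff:
  "x \<in> interior NB \<inter> nonneg_lattice \<longleftrightarrow> (\<exists>a. x = shifted_exp 0 a 0 \<and> in_mult_ideal (polydisk r) \<phi> 0 (mon a))"
proof
  assume x: "x \<in> interior NB \<inter> nonneg_lattice"
  define a where "a i = nat \<lfloor>x $ i\<rfloor> - 1" for i
  have "x $ i = real (a i) + 1" for i
  proof -
    have "x $ i \<in> \<nat>" using x by (auto simp: nonneg_lattice_def)
    then obtain n where n: "x $ i = real n" by (auto elim: Nats_cases)
    then have "n > 0" using interior_NB_pos[of x i] x by auto
    then show ?thesis using n by (simp add: a_def)
  qed
  then have "x = shifted_exp 0 a 0" by (simp add: shifted_exp_def vec_eq_iff)
  then show "\<exists>a. x = shifted_exp 0 a 0 \<and> in_mult_ideal (polydisk r) \<phi> 0 (mon a)"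
    using x in_mult_ideal_mon_iff by auto
next
  assume "\<exists>a. x = shifted_exp 0 a 0 \<and> in_mult_ideal (polydisk r) \<phi> 0 (mon a)"
  then obtain a where a: "x = shifted_exp 0 a 0" "shifted_exp 0 a 0 \<in> interior NB" using in_mult_ideal_mon_iff by auto
  have "real (a i) + 1 \<in> \<nat>" for i by (intro Nats_add) auto
  then show "x \<in> interior NB \<inter> nonneg_lattice"
    using a by (auto simp: nonneg_lattice_def shifted_exp_def)
qed

end

subsection \<open>Approximation from above\<close>

definition mon_max :: "('n::finite \<Rightarrow> nat) set \<Rightarrow> complex ^ 'n \<Rightarrow> real" where
  "mon_max B z = Max ((\<lambda>b. cmod (mon b z)) ` B)"

text \<open>The function \<open>H\<close> of the overview plus an additive constant
  \<open>C\<close>, through which both upper bounds and the shifts by \<open>m\<close> are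
  expressed.\<close>

definition log_mon_max :: "real \<Rightarrow> real \<Rightarrow> ('n::finite \<Rightarrow> nat) set \<Rightarrow> complex ^ 'n \<Rightarrow> ereal" where
  "log_mon_max \<kappa> C B z = ereal \<kappa> * eln (mon_max B z) + ereal C"

lemma cmod_mon: "cmod (mon b z) = (\<Prod>i\<in>UNIV. cmod (z $ i) ^ b i)"
  by (simp add: mon_def norm_power flip: prod_norm)

lemma cmod_mon_exp:
  assumes "\<And>i. b i \<noteq> 0 \<Longrightarrow> z $ i \<noteq> 0"
  shows "cmod (mon b z) = exp (\<Sum>i\<in>UNIV. real (b i) * ln (cmod (z $ i)))"
  unfolding cmod_mon exp_sum[OF finite]
proof (intro prod.cong refl)
  fix i
  show "cmod (z $ i) ^ b i = exp (real (b i) * ln (cmod (z $ i)))"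
    using assms[of i] by (cases "b i = 0") (auto simp: exp_of_nat_mult)
qed

lemma continuous_on_mon: "continuous_on S (mon a)"
  unfolding mon_def[abs_def] by (intro continuous_intros)

lemma affine_log_eln_less:
  assumes "\<kappa> > 0"
  shows "ereal \<kappa> * eln t + ereal C < ereal e \<longleftrightarrow> t < exp ((e - C) / \<kappa>)"
proof (cases "t \<le> 0")
  case True
  then have "t < exp ((e - C) / \<kappa>)" by (meson exp_gt_zero le_less_trans)
  then show ?thesis using True assms by (simp add: eln_def)
next
  case False
  then have "ereal \<kappa> * eln t + ereal C < ereal e \<longleftrightarrow> ln t < (e - C) / \<kappa>"
    using assms by (simp add: eln_def pos_less_divide_eq algebra_simps less_diff_eq)
  also have "\<dots> \<longleftrightarrow> t < exp ((e - C) / \<kappa>)" using False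
    by (metis exp_ln exp_less_cancel_iff linorder_not_le)
  finally show ?thesis .
qed

locale mon_set =
  fixes B :: "('n::finite \<Rightarrow> nat) set" and \<kappa> :: real
  assumes finB: "finite B" and neB: "B \<noteq> {}" and \<kappa>: "\<kappa> > 0"
begin

lemma mon_max_less_iff: "mon_max B z < e \<longleftrightarrow> (\<forall>b\<in>B. cmod (mon b z) < e)"
  unfolding mon_max_def using finB neB by (subst Max_less_iff) auto

lemma mon_le_max: "b \<in> B \<Longrightarrow> cmod (mon b z) \<le> mon_max B z"
  unfolding mon_max_def using finB by (intro Max_ge) auto

lemma mon_max_attained: obtains b where "b \<in> B" "mon_max B z = cmod (mon b z)"
proof -
  have "mon_max B z \<in> (\<lambda>b. cmod (mon b z)) ` B" unfolding mon_max_def using finB neB by (intro Max_in) auto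
  then show ?thesis using that by auto
qed

lemma mon_max_nonneg: "0 \<le> mon_max B z"
  by (rule mon_max_attained[of z]) simp

lemma mon_max_expv: "mon_max B (expv y) = exp (Max ((\<lambda>b. rvec b \<bullet> y) ` B))"
proof -
  have m: "cmod (mon b (expv y)) = exp (rvec b \<bullet> y)" for b
    by (subst cmod_mon_exp) (auto simp: inner_vec_def)
  have "exp (Max ((\<lambda>b. rvec b \<bullet> y) ` B)) = Max (exp ` ((\<lambda>b. rvec b \<bullet> y) ` B))"
    by (rule mono_Max_commute) (use finB neB in \<open>auto simp: mono_def\<close>)
  then show ?thesis by (simp add: mon_max_def m image_image)
qed

lemma log_mon_max_expv: "log_mon_max \<kappa> C B (expv y) = ereal (\<kappa> * Max ((\<lambda>b. rvec b \<bullet> y) ` B) + C)"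
  by (simp add: log_mon_max_def mon_max_expv eln_def not_le)

lemma log_mon_max_norm_cong: "(\<And>i. cmod (z $ i) = cmod (w $ i)) \<Longrightarrow> log_mon_max \<kappa> C B z = log_mon_max \<kappa> C B w"
  by (simp add: log_mon_max_def mon_max_def cmod_mon)

lemma log_mon_max_usc:
  assumes "log_mon_max \<kappa> C B z < c"
  shows "eventually (\<lambda>w. log_mon_max \<kappa> C B w < c) (nhds z)"
proof -
  obtain e where e: "log_mon_max \<kappa> C B z < ereal e" "ereal e < c" using ereal_dense2[OF assms] by blast
  define q where "q = exp ((e - C) / \<kappa>)"
  have iff: "log_mon_max \<kappa> C B w < ereal e \<longleftrightarrow> (\<forall>b\<in>B. cmod (mon b w) < q)" for w
    unfolding log_mon_max_def affine_log_eln_less[OF \<kappa>] q_def[symmetric] mon_max_less_iff ..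
  have "eventually (\<lambda>w. \<forall>b\<in>B. cmod (mon b w) < q) (nhds z)"
  proof (rule eventually_ball_finite[OF finB], rule ballI)
    fix b assume "b \<in> B"
    have "isCont (mon b) z" using continuous_on_mon[of UNIV b] by (simp add: continuous_on_eq_continuous_at)
    then have "(mon b \<longlongrightarrow> mon b z) (nhds z)" by (simp add: continuous_at tendsto_nhds_iff)
    then have "((\<lambda>w. cmod (mon b w)) \<longlongrightarrow> cmod (mon b z)) (nhds z)" by (rule tendsto_norm)
    then show "eventually (\<lambda>w. cmod (mon b w) < q) (nhds z)"
      using e(1) iff \<open>b \<in> B\<close> by (intro order_tendstoD(2)) auto
  qed
  then show ?thesis unfolding iff[symmetric] by eventually_elim (use e(2) in order)
qed

text \<open>Fix the monomial that attains the maximum at the centre \<open>a\<close>. The logarithm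
  of its modulus is a sum of terms \<open>ln (cmod (z $ i))\<close>, each with the sub-mean value
  property, and the maximum dominates it on the circle.\<close>

lemma log_mon_max_submean:
  "log_mon_max \<kappa> C B a \<le> ereal (1 / (2*pi)) * ereal_int_circle (\<lambda>t. log_mon_max \<kappa> C B (a + cis t *s v))"
proof (cases "mon_max B a = 0")
  case True
  then show ?thesis using \<kappa> by (simp add: log_mon_max_def eln_def)
next
  case False
  obtain b where b: "b \<in> B" "mon_max B a = cmod (mon b a)" by (rule mon_max_attained)
  have nz: "a $ i \<noteq> 0" if "b i \<noteq> 0" for i
    using False that unfolding b(2) by (auto simp: mon_def)
  define f where "f t = \<kappa> * (\<Sum>i\<in>UNIV. real (b i) * ln (cmod (a $ i + cis t * v $ i))) + C" for t
  have i1: "circle_integrable (\<lambda>t. real (b i) * ln (cmod (a $ i + cis t * v $ i)))" for i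
    using ln_circle_mean(1)[OF nz] by (cases "b i = 0") (auto intro!: set_integrable_mult_right circle_integrable_continuous)
  have i2: "2 * pi * (real (b i) * ln (cmod (a $ i))) \<le> circle_int (\<lambda>t. real (b i) * ln (cmod (a $ i + cis t * v $ i)))" for i
  proof (cases "b i = 0")
    case False
    have "real (b i) * (2 * pi * ln (cmod (a $ i))) \<le> real (b i) * circle_int (\<lambda>t. ln (cmod (a $ i + cis t * v $ i)))"
      by (intro mult_left_mono ln_circle_mean(2) nz False) simp
    then show ?thesis by (simp add: mult_ac)
  qed (simp add: set_lebesgue_integral_def)
  have s1: "circle_integrable (\<lambda>t. \<Sum>i\<in>UNIV. real (b i) * ln (cmod (a $ i + cis t * v $ i)))"
    using i1 unfolding set_integrable_def scaleR_sum_right by (intro Bochner_Integration.integrable_sum) auto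
  have s2: "circle_int (\<lambda>t. \<Sum>i\<in>UNIV. real (b i) * ln (cmod (a $ i + cis t * v $ i)))
      = (\<Sum>i\<in>UNIV. circle_int (\<lambda>t. real (b i) * ln (cmod (a $ i + cis t * v $ i))))"
    using i1 unfolding set_integrable_def set_lebesgue_integral_def scaleR_sum_right
    by (subst Bochner_Integration.integral_sum) auto
  have c1: "circle_integrable (\<lambda>t. C)" by (intro circle_integrable_continuous continuous_intros)
  have f1: "circle_integrable f" unfolding f_def
    by (intro set_integral_add(1) set_integrable_mult_right s1 c1)
  have "2 * pi * (\<kappa> * (\<Sum>i\<in>UNIV. real (b i) * ln (cmod (a $ i))) + C)
      = \<kappa> * (\<Sum>i\<in>UNIV. 2 * pi * (real (b i) * ln (cmod (a $ i)))) + 2 * pi * C"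
    by (simp add: sum_distrib_left algebra_simps)
  also have "\<dots> \<le> \<kappa> * (\<Sum>i\<in>UNIV. circle_int (\<lambda>t. real (b i) * ln (cmod (a $ i + cis t * v $ i)))) + 2 * pi * C"
    using \<kappa> i2 by (intro add_right_mono mult_left_mono sum_mono) auto
  also have "\<dots> = circle_int f"
  proof -
    have "circle_int (\<lambda>t. C) = 2 * pi * C" using set_borel_integral_eq_integral(2)[OF c1] by simp
    then show ?thesis unfolding f_def s2[symmetric]
      by (subst set_integral_add(2)[OF set_integrable_mult_right[OF s1] c1]) simp
  qed
  finally have le: "\<kappa> * (\<Sum>i\<in>UNIV. real (b i) * ln (cmod (a $ i))) + C \<le> circle_int f / (2 * pi)"
    by (simp add: field_simps)
  have "log_mon_max \<kappa> C B a = ereal (\<kappa> * (\<Sum>i\<in>UNIV. real (b i) * ln (cmod (a $ i))) + C)"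
    unfolding log_mon_max_def b(2) by (subst cmod_mon_exp[OF nz]) (auto simp: eln_def not_le)
  also have "\<dots> \<le> ereal (circle_int f / (2 * pi))" using le by simp
  also have "\<dots> = ereal (1 / (2*pi)) * ereal_int_circle (\<lambda>t. ereal (f t))"
    by (simp add: ereal_circle_int(1)[OF f1])
  also have "\<dots> \<le> ereal (1 / (2*pi)) * ereal_int_circle (\<lambda>t. log_mon_max \<kappa> C B (a + cis t *s v))"
  proof (intro ereal_mult_left_mono ereal_int_circle_mono)
    \<comment> \<open>At a zero of one of the factors \<open>f t\<close> has no relation to the
      monomial; there are only countably many such \<open>t\<close>.\<close>
    have "AE t in lborel. \<forall>i\<in>{i. b i \<noteq> 0}. a $ i + cis t * v $ i \<noteq> 0"
      by (intro AE_finite_allI AE_circle_nonzero) (use nz in auto)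
    then show "AE t in lborel. t \<in> {0..2*pi} \<longrightarrow> ereal (f t) \<le> log_mon_max \<kappa> C B (a + cis t *s v)"
    proof eventually_elim
      case (elim t)
      let ?z = "a + cis t *s v"
      have m: "cmod (mon b ?z) = exp (\<Sum>i\<in>UNIV. real (b i) * ln (cmod (a $ i + cis t * v $ i)))"
        by (subst cmod_mon_exp) (use elim in auto)
      have pos: "0 < mon_max B ?z" using mon_le_max[OF b(1), of ?z] unfolding m by (meson exp_gt_zero less_le_trans)
      have "(\<Sum>i\<in>UNIV. real (b i) * ln (cmod (a $ i + cis t * v $ i))) \<le> ln (mon_max B ?z)"
        using mon_le_max[OF b(1), of ?z] pos unfolding m by (simp add: ln_ge_iff)
      then have "f t \<le> \<kappa> * ln (mon_max B ?z) + C" unfolding f_def using \<kappa> by simp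
      then show ?case using pos by (simp add: log_mon_max_def eln_def)
    qed
  qed simp
  finally show ?thesis .
qed

text \<open>The sum \<open>S\<close> of the squared moduli lies between
  \<open>(mon_max B z)\<^sup>2\<close> and \<open>card B\<close> times it, so
  \<open>\<kappa> / 2 * ln (S z)\<close> differs from \<open>H\<close> by a bounded amount; the 2
  comes from the squares.\<close>

lemma analytic_sing_between:
  assumes \<psi>: "\<And>z. z \<in> V \<Longrightarrow> log_mon_max \<kappa> C1 B z \<le> \<psi> z" "\<And>z. z \<in> V \<Longrightarrow> \<psi> z \<le> log_mon_max \<kappa> C2 B z"
    and V: "open V"
  shows "analytic_sing_on V \<psi>"
proof -
  obtain bs where bs: "set bs = B" "distinct bs" using finite_distinct_list[OF finB] by blast
  define gs where "gs = map mon bs"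
  define S where "S z = (\<Sum>g\<leftarrow>gs. (cmod (g z))\<^sup>2)" for z
  have S: "S z = (\<Sum>b\<in>B. (cmod (mon b z))\<^sup>2)" for z
    unfolding S_def gs_def using bs by (simp add: comp_def sum_list_distinct_conv_sum_set)
  have S_ge: "(mon_max B z)\<^sup>2 \<le> S z" for z
  proof -
    obtain b where "b \<in> B" "mon_max B z = cmod (mon b z)" by (rule mon_max_attained)
    then show ?thesis unfolding S using finB by (metis (no_types, lifting) member_le_sum zero_le_power2)
  qed
  have S_le: "S z \<le> real (card B) * (mon_max B z)\<^sup>2" for z
  proof -
    have "S z \<le> (\<Sum>b\<in>B. (mon_max B z)\<^sup>2)" unfolding S by (intro sum_mono power_mono mon_le_max) auto
    then show ?thesis by simp
  qed
  \<comment> \<open>Where \<open>S\<close> vanishes both sides of the required identity are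
    -\<infinity>, and any bounded value of \<open>h\<close> serves.\<close>
  define h where "h z = (if S z = 0 then 0 else real_of_ereal (\<psi> z) - \<kappa> / 2 * ln (S z))" for z
  define K where "K = \<bar>C1\<bar> + \<bar>C2\<bar> + \<kappa> * ln (real (card B))"
  have cB: "1 \<le> real (card B)" using finB neB by (simp add: Suc_leI card_gt_0_iff)
  have S0: "S z = 0 \<longleftrightarrow> mon_max B z = 0" for z
    using S_ge[of z] S_le[of z] by (auto simp: dual_order.antisym)
  have main: "\<bar>h z\<bar> \<le> K \<and> \<psi> z = ereal (\<kappa> / 2) * eln (S z) + ereal (h z)" if z: "z \<in> V" for z
  proof (cases "S z = 0")
    case True
    then have "\<psi> z \<le> -\<infinity>" using \<psi>(2)[OF z] \<kappa> S0 by (simp add: log_mon_max_def eln_def)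
    then show ?thesis using True \<kappa> cB by (simp add: h_def K_def eln_def)
  next
    case False
    then have m: "mon_max B z > 0" using S0[of z] mon_max_nonneg[of z] by simp
    have Sp: "S z > 0" using S_ge[of z] m by (meson less_le_trans zero_less_power)
    have l1: "ereal (\<kappa> * ln (mon_max B z) + C1) \<le> \<psi> z" and l2: "\<psi> z \<le> ereal (\<kappa> * ln (mon_max B z) + C2)"
      using \<psi>[OF z] m by (auto simp: log_mon_max_def eln_def)
    then obtain p where p: "\<psi> z = ereal p" by (cases "\<psi> z") auto
    have "2 * ln (mon_max B z) = ln ((mon_max B z)\<^sup>2)" using m by (simp add: ln_realpow)
    also have "\<dots> \<le> ln (S z)" using S_ge m Sp by (intro ln_mono) auto
    finally have a1: "2 * ln (mon_max B z) \<le> ln (S z)" .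
    have "ln (S z) \<le> ln (real (card B) * (mon_max B z)\<^sup>2)" using S_le Sp by (intro ln_mono) auto
    also have "\<dots> = ln (real (card B)) + 2 * ln (mon_max B z)" using m cB by (simp add: ln_mult ln_realpow)
    finally have a2: "ln (S z) \<le> ln (real (card B)) + 2 * ln (mon_max B z)" .
    have b1: "\<kappa> / 2 * (2 * ln (mon_max B z)) \<le> \<kappa> / 2 * ln (S z)"
      using a1 \<kappa> by (intro mult_left_mono) auto
    have b2: "\<kappa> / 2 * ln (S z) \<le> \<kappa> / 2 * (ln (real (card B)) + 2 * ln (mon_max B z))"
      using a2 \<kappa> by (intro mult_left_mono) auto
    have b3: "0 \<le> \<kappa> * ln (real (card B))" using \<kappa> cB by simp
    have hz: "h z = p - \<kappa> / 2 * ln (S z)" using False by (simp add: h_def p)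
    have "\<bar>h z\<bar> \<le> K" using hz l1 l2 b1 b2 b3 unfolding p K_def by (simp add: distrib_left)
    then show ?thesis using Sp hz by (simp add: p eln_def)
  qed
  show ?thesis unfolding analytic_sing_on_def
  proof
    fix x assume x: "x \<in> V"
    show "\<exists>W c gs h K. open W \<and> x \<in> W \<and> W \<subseteq> V \<and> c \<ge> (0::real) \<and>
      (\<forall>g\<in>set gs. holo_on W g) \<and> (\<forall>z\<in>W. \<bar>h z\<bar> \<le> (K::real)) \<and>
      (\<forall>z\<in>W. \<psi> z = ereal c * eln (\<Sum>g\<leftarrow>gs. (cmod (g z))\<^sup>2) + ereal (h z))"
    proof (rule exI[of _ V], rule exI[of _ "\<kappa> / 2"], rule exI[of _ gs], rule exI[of _ h], rule exI[of _ K], intro conjI)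
      show "\<forall>z\<in>V. \<bar>h z\<bar> \<le> K" using main by blast
      show "\<forall>z\<in>V. \<psi> z = ereal (\<kappa> / 2) * eln (\<Sum>g\<leftarrow>gs. (cmod (g z))\<^sup>2) + ereal (h z)"
        unfolding S_def[symmetric] using main by blast
      show "\<forall>g\<in>set gs. holo_on V g" by (auto simp: gs_def holo_on_mon)
    qed (use V x \<kappa> in auto)
  qed
qed

end

locale toric_approx = toric_fun r \<phi> + mon_set B \<kappa>
  for r :: real and \<phi> :: "complex ^ 'n \<Rightarrow> ereal" and B :: "('n \<Rightarrow> nat) set" and \<kappa> :: real +
  fixes s :: real
  assumes s: "0 < s" "s < r" and NB_sub: "newton_body r \<phi> \<subseteq> (\<lambda>x. \<kappa> *\<^sub>R x) ` newton_poly B"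
begin

lemma polydisk_s: "polydisk s \<subseteq> polydisk r"
  using s by (auto simp: polydisk_def intro: less_trans)

definition L :: "real ^ 'n" where "L = (\<chi> i. ln s)"

text \<open>The value of \<open>G\<close> at the corner \<open>L\<close> of the smaller polydisk,
  finite because \<open>s < r\<close>, plus \<kappa> times the support function of \<open>B\<close>
  at \<open>- L\<close>: the constant that the estimate in \<open>phi_le_nonzero\<close>
  produces.\<close>

definition C0 :: real where "C0 = G L + \<kappa> * Max ((\<lambda>b. rvec b \<bullet> (- L)) ` B)"

text \<open>A subgradient at \<open>y = logv z\<close> is \<kappa> times a point \<open>p\<close> of
  the Newton polyhedron. Comparing \<open>G y\<close> with \<open>G L\<close> along it leaves the
  pairing of \<open>p\<close> with \<open>L - y\<close>, and this vector is nonnegative, so the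
  pairing is bounded below by its least value on \<open>B\<close>.\<close>

lemma phi_le_nonzero:
  assumes z: "z \<in> polydisk s" "\<And>i. z $ i \<noteq> 0"
  shows "\<phi> z \<le> log_mon_max \<kappa> C0 B z"
proof -
  define y where "y = logv z"
  have zr: "z \<in> polydisk r" using z polydisk_s by blast
  have yU: "y \<in> U" unfolding y_def by (rule logv_in_U[OF zr z(2)])
  have LU: "L \<in> U" using s by (simp add: L_def U_def)
  have yL: "y $ i \<le> L $ i" for i
    using z s unfolding y_def logv_def L_def by (auto simp: polydisk_def intro: less_imp_le)
  obtain x where x: "x \<in> NB" "\<And>z. z \<in> U \<Longrightarrow> G y + x \<bullet> (z - y) \<le> G z" using subgradient[OF yU] by blast
  then obtain p where p: "x = \<kappa> *\<^sub>R p" "p \<in> newton_poly B" using NB_sub by blast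
  define m where "m = Max ((\<lambda>b. rvec b \<bullet> y) ` B)"
  define k where "k = Max ((\<lambda>b. rvec b \<bullet> (- L)) ` B)"
  have "- (m + k) \<le> (L - y) \<bullet> p"
  proof (rule newton_poly_support[OF p(2)])
    fix b assume "b \<in> B"
    then have "rvec b \<bullet> y \<le> m" "rvec b \<bullet> (- L) \<le> k" unfolding m_def k_def using finB by (auto intro!: Max_ge)
    then show "- (m + k) \<le> (L - y) \<bullet> rvec b" by (simp add: inner_diff_left inner_diff_right inner_commute)
  qed (use yL in auto)
  then have "\<kappa> * (- (m + k)) \<le> \<kappa> * ((L - y) \<bullet> p)" using \<kappa> by (intro mult_left_mono) auto
  moreover have "G y + \<kappa> * ((L - y) \<bullet> p) \<le> G L" using x(2)[OF LU] by (simp add: p inner_commute)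
  ultimately have "G y \<le> \<kappa> * m + C0" by (simp add: C0_def k_def algebra_simps)
  moreover have "log_mon_max \<kappa> C0 B z = log_mon_max \<kappa> C0 B (expv y)"
    by (rule log_mon_max_norm_cong) (simp add: y_def logv_def z(2))
  ultimately show ?thesis unfolding phi_logv[OF zr z(2)] log_mon_max_expv y_def[symmetric] m_def by simp
qed

text \<open>Replace vanishing coordinates by a small positive \<open>e\<close>: \<phi> can only
  grow, by monotonicity, while the right side is upper semicontinuous.\<close>

lemma phi_le:
  assumes z: "z \<in> polydisk s"
  shows "\<phi> z \<le> log_mon_max \<kappa> C0 B z"
proof (rule ccontr)
  assume "\<not> ?thesis"
  then obtain c where c: "log_mon_max \<kappa> C0 B z < c" "c < \<phi> z" using dense not_le by metis
  define w where "w e = (\<chi> i. if z $ i = 0 then complex_of_real e else z $ i)" for e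
  have "((\<lambda>e. if z $ i = 0 then complex_of_real e else z $ i) \<longlongrightarrow> z $ i) (at_right 0)" for i
    by (cases "z $ i = 0") (auto intro!: tendsto_eq_intros)
  then have lim: "(w \<longlongrightarrow> z) (at_right 0)" unfolding w_def[abs_def]
    by (intro vec_tendstoI) simp
  have "eventually (\<lambda>e. w e \<in> polydisk s) (at_right 0)"
    by (rule topological_tendstoD[OF lim open_polydisk z])
  moreover have "eventually (\<lambda>e. log_mon_max \<kappa> C0 B (w e) < c) (at_right 0)"
    using log_mon_max_usc[OF c(1)] lim by (auto simp: filterlim_iff)
  ultimately have "eventually (\<lambda>e. w e \<in> polydisk s \<and> log_mon_max \<kappa> C0 B (w e) < c \<and> e > 0) (at_right 0)"
    using eventually_at_right_less[of "0::real"] by eventually_elim auto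
  from eventually_happens[OF this] obtain e :: real where e: "w e \<in> polydisk s" "log_mon_max \<kappa> C0 B (w e) < c" "e > 0"
    by auto
  have "\<phi> z \<le> \<phi> (w e)" using z e polydisk_s by (intro mono) (auto simp: w_def)
  also have "\<dots> \<le> log_mon_max \<kappa> C0 B (w e)" using e by (intro phi_le_nonzero) (auto simp: w_def)
  also have "\<dots> < c" by (rule e)
  finally show False using c by simp
qed

definition approx :: "nat \<Rightarrow> complex ^ 'n \<Rightarrow> ereal" where
  "approx m z = max (\<phi> z) (log_mon_max \<kappa> (C0 - real m) B z)"

lemma log_mon_max_mono: "C \<le> C' \<Longrightarrow> log_mon_max \<kappa> C B z \<le> log_mon_max \<kappa> C' B z"
  unfolding log_mon_max_def by (intro add_left_mono) simp

lemma toric_psh_approx: "toric_psh s (approx m)"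
  unfolding toric_psh_def
proof
  show "toric_on s (approx m)"
    unfolding toric_on_def
  proof (intro ballI allI)
    fix z :: "complex ^ 'n" and \<theta> :: "real ^ 'n" assume z: "z \<in> polydisk s"
    let ?w = "\<chi> i. cis (\<theta> $ i) * z $ i"
    have "\<phi> ?w = \<phi> z" using z polydisk_s by (intro toric_norm_eq) (auto simp: norm_mult)
    moreover have "log_mon_max \<kappa> C B ?w = log_mon_max \<kappa> C B z" for C by (rule log_mon_max_norm_cong) (simp add: norm_mult)
    ultimately show "approx m ?w = approx m z" by (simp add: approx_def)
  qed
  show "psh_on (polydisk s) (approx m)"
    unfolding psh_on_def
  proof (intro conjI ballI allI impI)
    fix z :: "complex ^ 'n" assume z: "z \<in> polydisk s"
    have "log_mon_max \<kappa> C B z < \<infinity>" for C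
      using \<kappa> by (auto simp: log_mon_max_def eln_def)
    moreover have "\<phi> z < \<infinity>" using z polydisk_s by (intro less_inf) auto
    ultimately show "approx m z < \<infinity>" unfolding approx_def max_less_iff_conj by blast
  next
    define y :: "real ^ 'n" where "y = (\<chi> i. ln (s / 2))"
    have "expv y \<in> polydisk s" using s by (simp add: polydisk_def y_def)
    moreover have "y \<in> U" using s by (simp add: U_def y_def)
    then have "\<phi> (expv y) \<noteq> -\<infinity>" using g_not_minf by (simp add: g_def assoc_convex_expv)
    then have "approx m (expv y) \<noteq> -\<infinity>" by (auto simp: approx_def max_def)
    ultimately show "\<exists>z\<in>polydisk s. approx m z \<noteq> -\<infinity>" by blast
  next
    fix z c assume z: "z \<in> polydisk s" and lt: "approx m z < c"
    have "eventually (\<lambda>w. \<phi> w < c) (nhds z)" using z lt polydisk_s by (intro usc) (auto simp: approx_def)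
    moreover have "eventually (\<lambda>w. log_mon_max \<kappa> (C0 - real m) B w < c) (nhds z)"
      using lt by (intro log_mon_max_usc) (auto simp: approx_def)
    ultimately have "eventually (\<lambda>w. approx m w < c) (nhds z)"
      by eventually_elim (simp add: approx_def)
    then show "eventually (\<lambda>w. approx m w < c) (at z within polydisk s)"
      by (auto simp: eventually_at_filter elim: eventually_mono)
  next
    fix a b :: "complex ^ 'n" assume d: "\<forall>\<zeta>::complex. norm \<zeta> \<le> 1 \<longrightarrow> a + \<zeta> *s b \<in> polydisk s"
    have le: "ereal (1 / (2*pi)) * ereal_int_circle (\<lambda>t. u (a + cis t *s b)) \<le> ereal (1 / (2*pi)) * ereal_int_circle (\<lambda>t. approx m (a + cis t *s b))"
      if "\<And>z. u z \<le> approx m z" for u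
      using that by (intro ereal_mult_left_mono ereal_int_circle_mono) auto
    have "\<phi> a \<le> ereal (1 / (2*pi)) * ereal_int_circle (\<lambda>t. \<phi> (a + cis t *s b))"
      using psh d polydisk_s unfolding psh_on_def by blast
    also have "\<dots> \<le> ereal (1 / (2*pi)) * ereal_int_circle (\<lambda>t. approx m (a + cis t *s b))"
      by (rule le) (simp add: approx_def)
    finally have 1: "\<phi> a \<le> ereal (1 / (2*pi)) * ereal_int_circle (\<lambda>t. approx m (a + cis t *s b))" .
    have "log_mon_max \<kappa> (C0 - real m) B a \<le> ereal (1 / (2*pi)) * ereal_int_circle (\<lambda>t. log_mon_max \<kappa> (C0 - real m) B (a + cis t *s b))"
      by (rule log_mon_max_submean)
    also have "\<dots> \<le> ereal (1 / (2*pi)) * ereal_int_circle (\<lambda>t. approx m (a + cis t *s b))"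
      by (rule le) (simp add: approx_def)
    finally show "approx m a \<le> ereal (1 / (2*pi)) * ereal_int_circle (\<lambda>t. approx m (a + cis t *s b))"
      using 1 unfolding approx_def[of m a] by simp
  qed
qed

lemma approx_le: "z \<in> polydisk s \<Longrightarrow> approx m z \<le> log_mon_max \<kappa> C0 B z"
  unfolding approx_def using phi_le log_mon_max_mono[of "C0 - real m" C0 z] by simp

lemma analytic_sing_approx: "analytic_sing_on (polydisk s) (approx m)"
  by (rule analytic_sing_between[where ?C1.0 = "C0 - real m", OF _ approx_le open_polydisk]) (auto simp: approx_def)

lemma approx_decreasing: "approx (Suc m) z \<le> approx m z"
  unfolding approx_def using log_mon_max_mono[of "C0 - real (Suc m)" "C0 - real m" z] by (auto simp: max_def intro: order_trans)

lemma approx_tendsto: "(\<lambda>m. approx m z) \<longlonglongrightarrow> \<phi> z"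
proof -
  have "(\<lambda>m. log_mon_max \<kappa> (C0 - real m) B z) \<longlonglongrightarrow> -\<infinity>"
  proof (cases "mon_max B z \<le> 0")
    case True
    have "ereal \<kappa> * -\<infinity> = -\<infinity>" using \<kappa> by simp
    then show ?thesis using True by (simp only: log_mon_max_def eln_def if_True) simp
  next
    case False
    have "((\<lambda>m. ereal (\<kappa> * ln (mon_max B z) + (C0 - real m))) \<longlongrightarrow> -\<infinity>) sequentially"
      unfolding tendsto_MInfty
    proof
      fix q
      obtain n :: nat where n: "\<kappa> * ln (mon_max B z) + C0 - q < real n" using reals_Archimedean2 by blast
      show "\<forall>\<^sub>F m in sequentially. ereal (\<kappa> * ln (mon_max B z) + (C0 - real m)) < ereal q"
        by (rule eventually_sequentiallyI[of n]) (use n in simp)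
    qed
    then show ?thesis using False by (simp add: log_mon_max_def eln_def)
  qed
  then have "(\<lambda>m. approx m z) \<longlonglongrightarrow> max (\<phi> z) (-\<infinity>)"
    unfolding approx_def by (intro tendsto_max tendsto_const)
  then show ?thesis by (simp add: max_def)
qed

text \<open>This inclusion confines the exponents of the homogeneous parts of functions square
  integrable against an approximant.\<close>

lemma NB_approx: "newton_body s (approx m) \<subseteq> (\<lambda>x. \<kappa> *\<^sub>R x) ` newton_poly B"
proof
  fix x assume "x \<in> newton_body s (approx m)"
  then obtain C where C: "\<And>y. (\<And>i. y $ i < ln s) \<Longrightarrow> ereal (x \<bullet> y) - approx m (expv y) \<le> ereal C"
    unfolding newton_body_def assoc_convex_expv by auto
  have "(1 / \<kappa>) *\<^sub>R x \<in> newton_poly B"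
  proof (rule newton_poly_dominated[OF finB neB \<kappa>])
    fix y :: "real ^ 'n" assume y: "\<And>i. y $ i < ln s"
    have "expv y \<in> polydisk s" using y s by (auto simp: polydisk_def) (metis exp_less_cancel_iff exp_ln)
    from approx_le[OF this, of m] C[OF y]
    show "x \<bullet> y \<le> \<kappa> * Max ((\<lambda>b. rvec b \<bullet> y) ` B) + (C0 + C)"
      unfolding log_mon_max_expv by (cases "approx m (expv y)") auto
  qed
  then show "x \<in> (\<lambda>x. \<kappa> *\<^sub>R x) ` newton_poly B"
    using \<kappa> by (intro image_eqI[of _ _ "(1 / \<kappa>) *\<^sub>R x"]) auto
qed

end

section \<open>Weighted square integrals of homogeneous parts\<close>

lemma sum_norm_squared_le:
  fixes f :: "'a \<Rightarrow> complex"
  assumes "finite S"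
  shows "(cmod (\<Sum>j\<in>S. f j))\<^sup>2 \<le> real (card S) * (\<Sum>j\<in>S. (cmod (f j))\<^sup>2)"
proof -
  have "(cmod (\<Sum>j\<in>S. f j))\<^sup>2 \<le> (\<Sum>j\<in>S. cmod (f j))\<^sup>2"
    by (intro power_mono norm_sum) auto
  also have "\<dots> = (\<Sum>j\<in>S. 1 * cmod (f j))\<^sup>2" by simp
  also have "\<dots> \<le> (\<Sum>j\<in>S. 1\<^sup>2) * (\<Sum>j\<in>S. (cmod (f j))\<^sup>2)" by (rule Cauchy_Schwarz_ineq_sum)
  finally show ?thesis by simp
qed

text \<open>The bound \<open>\<delta>_le\<close> keeps the coordinates outside \<open>J\<close> away
  from 0 on all of \<open>D\<close>, so that exponents at points of \<open>D\<close> can be related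
  to exponents at \<open>x\<close>.\<close>

locale toric_reinhardt = toric_fun r \<phi> + reinhardt x \<delta> M
  for r :: real and \<phi> :: "complex ^ 'n \<Rightarrow> ereal" and x :: "complex ^ 'n" and \<delta> M :: real +
  assumes D_sub: "polybox x \<delta> \<subseteq> polydisk r" and \<delta>_le: "\<And>i. x $ i \<noteq> 0 \<Longrightarrow> \<delta> \<le> cmod (x $ i)"
begin

definition sq_int :: "(complex ^ 'n \<Rightarrow> complex) \<Rightarrow> ennreal" where
  "sq_int F = (\<integral>\<^sup>+ z. ennreal ((cmod (F z))\<^sup>2) * (weight (\<phi> z) * indicator D z) \<partial>lborel)"

lemma measurable_weight_D [measurable]: "(\<lambda>z. weight (\<phi> z) * indicator D z) \<in> borel_measurable borel"
  by (rule measurable_weight_phi[OF open_polybox D_sub])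

lemma sq_int_measurable:
  assumes "continuous_on D F"
  shows "(\<lambda>z. ennreal ((cmod (F z))\<^sup>2) * (weight (\<phi> z) * indicator D z)) \<in> borel_measurable borel"
proof -
  have "D \<in> sets borel" by (simp add: open_polybox)
  from borel_measurable_continuous_on_indicator[OF this assms]
  have [measurable]: "(\<lambda>z. indicator D z *\<^sub>R F z) \<in> borel_measurable borel" .
  have "(\<lambda>z. ennreal ((cmod (indicator D z *\<^sub>R F z))\<^sup>2) * (weight (\<phi> z) * indicator D z)) \<in> borel_measurable borel"
    by measurable
  also have "(\<lambda>z. ennreal ((cmod (indicator D z *\<^sub>R F z))\<^sup>2) * (weight (\<phi> z) * indicator D z))
    = (\<lambda>z. ennreal ((cmod (F z))\<^sup>2) * (weight (\<phi> z) * indicator D z))"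
    by (auto simp: indicator_def)
  finally show ?thesis .
qed

text \<open>Cauchy-Schwarz bounds the squared average by the average of the squares at rotated
  points; each rotated integral equals the original one, since \<phi>, \<open>D\<close> and Lebesgue
  measure are rotation invariant.\<close>

lemma sq_int_Av:
  assumes F: "nice F" and i: "x $ i = 0" and N: "N > 0"
  shows "sq_int (Av i N k F) \<le> sq_int F"
proof -
  define rot where "rot j z = vupd z i (cis (2 * pi * real j / real N) * z $ i)" for j and z :: "complex ^ 'n"
  define h where "h z = ennreal ((cmod (F z))\<^sup>2) * (weight (\<phi> z) * indicator D z)" for z
  have hm [measurable]: "h \<in> borel_measurable borel"
    unfolding h_def using F by (intro sq_int_measurable) (simp add: nice_def)
  have rot_m [measurable]: "rot j \<in> borel_measurable borel" for j
  proof -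
    have "continuous_on UNIV (\<lambda>z. if l = i then cis (2 * pi * real j / real N) * z $ i else z $ l)" for l
      by (cases "l = i") (auto intro!: continuous_intros)
    then show ?thesis unfolding rot_def[abs_def] vupd_def
      by (intro borel_measurable_continuous_onI continuous_on_vec_lambda)
  qed
  have rotD: "rot j z \<in> D \<longleftrightarrow> z \<in> D" for j z
  proof -
    have "cmod (rot j z $ l - x $ l) = cmod (z $ l - x $ l)" for l
      using i by (cases "l = i") (auto simp: rot_def vupd_nth norm_mult)
    then show ?thesis by (simp add: polybox_def)
  qed
  have rotphi: "\<phi> (rot j z) = \<phi> z" if "z \<in> D" for j z
    using that D_sub by (intro toric_norm_eq) (auto simp: rot_def vupd_nth norm_mult)
  have pt: "ennreal ((cmod (Av i N k F z))\<^sup>2) * (weight (\<phi> z) * indicator D z) \<le> ennreal (1 / real N) * (\<Sum>j<N. h (rot j z))" for z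
  proof (cases "z \<in> D")
    case True
    let ?T = "\<Sum>j<N. cis (- (2 * pi * real j * real k / real N)) * F (rot j z)"
    have "(cmod ?T)\<^sup>2 \<le> real N * (\<Sum>j<N. (cmod (F (rot j z)))\<^sup>2)"
      using sum_norm_squared_le[of "{..<N}" "\<lambda>j. cis (- (2 * pi * real j * real k / real N)) * F (rot j z)"]
      by (simp add: norm_mult)
    then have "(cmod ?T)\<^sup>2 / (real N)\<^sup>2 \<le> real N * (\<Sum>j<N. (cmod (F (rot j z)))\<^sup>2) / (real N)\<^sup>2"
      by (rule divide_right_mono) simp
    also have "\<dots> = (1 / real N) * (\<Sum>j<N. (cmod (F (rot j z)))\<^sup>2)"
      using N by (simp add: power2_eq_square)
    finally have "(cmod (Av i N k F z))\<^sup>2 \<le> (1 / real N) * (\<Sum>j<N. (cmod (F (rot j z)))\<^sup>2)"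
      unfolding Av_eq rot_def by (simp add: norm_divide power_divide)
    then have "ennreal ((cmod (Av i N k F z))\<^sup>2) \<le> ennreal ((1 / real N) * (\<Sum>j<N. (cmod (F (rot j z)))\<^sup>2))"
      by (rule ennreal_leI)
    also have "\<dots> = ennreal (1 / real N) * (\<Sum>j<N. ennreal ((cmod (F (rot j z)))\<^sup>2))"
      by (subst sum_ennreal, simp, rule ennreal_mult) (auto intro!: sum_nonneg)
    finally have "ennreal ((cmod (Av i N k F z))\<^sup>2) * weight (\<phi> z) \<le> ennreal (1 / real N) * (\<Sum>j<N. ennreal ((cmod (F (rot j z)))\<^sup>2)) * weight (\<phi> z)"
      by (rule mult_right_mono) simp
    also have "\<dots> = ennreal (1 / real N) * (\<Sum>j<N. h (rot j z))"
      using True by (simp add: h_def rotD rotphi sum_distrib_right mult.assoc del: sum_ennreal)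
    finally show ?thesis using True by simp
  qed simp
  have "sq_int (Av i N k F) \<le> (\<integral>\<^sup>+ z. ennreal (1 / real N) * (\<Sum>j<N. h (rot j z)) \<partial>lborel)"
    unfolding sq_int_def by (intro nn_integral_mono pt)
  also have "\<dots> = ennreal (1 / real N) * (\<Sum>j<N. \<integral>\<^sup>+ z. h (rot j z) \<partial>lborel)"
    by (simp add: nn_integral_cmult nn_integral_sum)
  also have "(\<Sum>j<N. \<integral>\<^sup>+ z. h (rot j z) \<partial>lborel) = (\<Sum>j<N. sq_int F)"
    unfolding rot_def by (intro sum.cong refl, subst nn_integral_rotate_coord[OF hm]) (auto simp: sq_int_def h_def[abs_def])
  also have "ennreal (1 / real N) * (\<Sum>j<N. sq_int F) = sq_int F"
  proof -
    have "ennreal (1 / real N) * of_nat N = ennreal (1 / real N * real N)"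
      unfolding ennreal_of_nat_eq_real_of_nat by (rule ennreal_mult[symmetric]) auto
    then have "ennreal (1 / real N) * of_nat N = 1" using N by simp
    then show ?thesis by (simp add: mult.assoc[symmetric])
  qed
  finally show ?thesis .
qed

lemma sq_int_lim:
  assumes Fs: "\<And>n. nice (Fs n)" "\<And>n. sq_int (Fs n) \<le> K" and lim: "\<And>z. z \<in> D \<Longrightarrow> (\<lambda>n::nat. Fs n z) \<longlonglongrightarrow> F z"
  shows "sq_int F \<le> K"
proof -
  let ?h = "\<lambda>F z. ennreal ((cmod (F z))\<^sup>2) * (weight (\<phi> z) * indicator D z)"
  \<comment> \<open>Where \<open>F z = 0\<close> the left side is 0 even against an infinite weight,
    whereas continuity of the product would fail; that case is split off.\<close>
  have pt: "?h F z \<le> liminf (\<lambda>n. ?h (Fs n) z)" for z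
  proof (cases "z \<in> D \<and> F z \<noteq> 0")
    case True
    have "(\<lambda>n. ennreal ((cmod (Fs n z))\<^sup>2)) \<longlonglongrightarrow> ennreal ((cmod (F z))\<^sup>2)"
      using True by (intro tendsto_ennrealI tendsto_intros lim) auto
    then have "(\<lambda>n. ?h (Fs n) z) \<longlonglongrightarrow> ?h F z"
      using True by (intro tendsto_mult_ennreal tendsto_const) auto
    then show ?thesis by (simp add: lim_imp_Liminf)
  qed auto
  have "sq_int F \<le> (\<integral>\<^sup>+ z. liminf (\<lambda>n. ?h (Fs n) z) \<partial>lborel)"
    unfolding sq_int_def by (intro nn_integral_mono pt)
  also have "\<dots> \<le> liminf (\<lambda>n. sq_int (Fs n))"
    unfolding sq_int_def using Fs(1) by (intro nn_integral_liminf) (auto intro!: sq_int_measurable simp: nice_def)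
  also have "\<dots> \<le> liminf (\<lambda>n. K)"
    by (intro Liminf_mono always_eventually allI Fs)
  finally show ?thesis by (simp add: Liminf_const)
qed

text \<open>On a suitable open set a nonzero pure function is bounded below by a multiple of
  \<open>mon l\<close>: scaling its coordinates in \<open>J\<close> up to \<rho> lands near a point
  \<open>w\<close> with \<open>F w \<noteq> 0\<close>. So the monomial is square integrable there,
  and the criterion for monomials applies.\<close>

lemma pure_integrable_imp_interior:
  assumes F: "nice F" "sq_int F < \<infinity>" and p: "\<And>i. i \<in> J \<Longrightarrow> pure i (l i) F"
    and l: "\<And>i. i \<notin> J \<Longrightarrow> l i = 0" and z0: "z0 \<in> D" "F z0 \<noteq> 0"
  shows "\<exists>k::nat. shifted_exp x l (real k) \<in> interior NB"
proof -
  define m where "m = Max (insert 0 ((\<lambda>i. cmod (z0 $ i)) ` J))"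
  have m: "m \<ge> 0" "\<And>i. i \<in> J \<Longrightarrow> cmod (z0 $ i) \<le> m" unfolding m_def by (auto intro!: Max_ge)
  have "m < \<delta>" unfolding m_def using \<delta> D_J[OF z0(1)] by (subst Max_less_iff) auto
  define \<rho> where "\<rho> = (m + \<delta>) / 2"
  have \<rho>: "0 < \<rho>" "m \<le> \<rho>" "\<rho> < \<delta>" using m \<open>m < \<delta>\<close> by (auto simp: \<rho>_def)
  define up where "up z = (\<chi> i. if i \<in> J then complex_of_real \<rho> else z $ i)" for z :: "complex ^ 'n"
  have upD: "up z \<in> D" if "z \<in> D" for z using that \<rho> by (auto simp: polybox_def up_def)
  have F_up: "F z = (\<Prod>i\<in>J. (z $ i / of_real \<rho>) ^ l i) * F (up z)"
    if z: "up z \<in> D" "\<And>i. i \<in> J \<Longrightarrow> cmod (z $ i) \<le> \<rho>" for z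
  proof -
    have zw: "z = (\<chi> i. if i \<in> J then (z $ i / of_real \<rho>) * up z $ i else up z $ i)"
      using \<rho> by (auto simp: vec_eq_iff up_def)
    show ?thesis
      by (subst zw, rule pure_scale[where S = J, THEN conjunct1])
         (use p z \<rho> in \<open>auto simp: norm_divide divide_le_eq_1\<close>)
  qed
  define w where "w = up z0"
  have wD: "w \<in> D" unfolding w_def by (rule upD[OF z0(1)])
  have "F z0 = (\<Prod>i\<in>J. (z0 $ i / of_real \<rho>) ^ l i) * F w"
    unfolding w_def using m(2) \<rho> by (intro F_up upD z0) (auto intro: order_trans)
  then have Fw: "F w \<noteq> 0" using z0(2) by auto
  have "isCont F w" using F(1) wD open_polybox[of x \<delta>] by (auto simp: nice_def continuous_on_eq_continuous_at)
  then have "((\<lambda>z. cmod (F z)) \<longlongrightarrow> cmod (F w)) (nhds w)"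
    by (intro tendsto_norm) (simp add: continuous_at tendsto_nhds_iff)
  then have ev: "eventually (\<lambda>z. cmod (F w) / 2 < cmod (F z)) (nhds w)"
    using Fw by (intro order_tendstoD(1)) auto
  have "eventually (\<lambda>z. z \<in> D \<and> cmod (F w) / 2 < cmod (F z)) (nhds w)"
    using ev eventually_nhds_in_open[OF open_polybox wD] by eventually_elim auto
  then obtain W where W: "open W" "w \<in> W" "\<And>z. z \<in> W \<Longrightarrow> z \<in> D \<and> cmod (F w) / 2 < cmod (F z)"
    unfolding eventually_nhds by blast
  obtain \<eta> where \<eta>: "\<eta> > 0" "polybox w \<eta> \<subseteq> W" using polybox_subset_open[OF W(1,2)] by blast
  \<comment> \<open>\<open>F\<close> may vanish at every point whose coordinates outside
    \<open>J\<close> are those of \<open>x\<close>, so these are taken from \<open>z0\<close>. The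
    same coordinates vanish as for \<open>x\<close>, hence the shifted exponents agree.\<close>
  define x' where "x' = (\<chi> i. if i \<in> J then 0 else z0 $ i)"
  define e where "e i = (if i \<in> J then \<rho> else \<eta>)" for i
  define V where "V = {z. \<forall>i. cmod (z $ i - x' $ i) < e i}"
  have openV: "open V"
  proof -
    have "V = (\<Inter>i\<in>UNIV. {z. cmod (z $ i - x' $ i) < e i})" by (auto simp: V_def)
    also have "open \<dots>" by (intro open_INT finite ballI open_Collect_less continuous_intros)
    finally show ?thesis .
  qed
  have x'V: "x' \<in> V" using \<rho> \<eta> by (auto simp: V_def e_def)
  have upW: "up z \<in> polybox w \<eta>" if "z \<in> V" for z
    unfolding polybox_def
  proof safe
    fix i
    show "cmod (up z $ i - w $ i) < \<eta>"
      using that \<eta>(1) unfolding V_def by (cases "i \<in> J") (auto simp: w_def up_def x'_def e_def dest: spec[of _ i])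
  qed
  have VD: "V \<subseteq> D"
  proof
    fix z assume z: "z \<in> V"
    have "up z \<in> D" using upW[OF z] \<eta> W by blast
    show "z \<in> D" unfolding polybox_def
    proof safe
      fix i
      show "cmod (z $ i - x $ i) < \<delta>"
      proof (cases "i \<in> J")
        case True
        then show ?thesis using z \<rho> by (auto simp: V_def x'_def e_def dest!: spec[of _ i])
      next
        case False
        then show ?thesis using \<open>up z \<in> D\<close> by (auto simp: polybox_def up_def dest!: spec[of _ i])
      qed
    qed
  qed
  define c where "c = (cmod (F w) / 2) * (\<Prod>i\<in>J. (1 / \<rho>) ^ l i)"
  have c: "c > 0" using Fw \<rho> by (simp add: c_def prod_pos)
  have low: "c * cmod (mon l z) \<le> cmod (F z)" if z: "z \<in> V" for z
  proof -
    have le: "cmod (z $ i) \<le> \<rho>" if "i \<in> J" for i using z that by (auto simp: V_def x'_def e_def dest!: spec[of _ i])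
    have upD': "up z \<in> D" and up2: "cmod (F w) / 2 < cmod (F (up z))" using upW[OF z] \<eta> W by blast+
    have m: "cmod (mon l z) = (\<Prod>i\<in>J. cmod (z $ i) ^ l i)"
      unfolding cmod_mon by (rule prod.mono_neutral_right) (use l in auto)
    have "F z = (\<Prod>i\<in>J. (z $ i / of_real \<rho>) ^ l i) * F (up z)" by (rule F_up[OF upD' le])
    then have "cmod (F z) = cmod ((\<Prod>i\<in>J. (z $ i / of_real \<rho>) ^ l i) * F (up z))" by (rule arg_cong)
    also have "\<dots> = (\<Prod>i\<in>J. (cmod (z $ i) / \<rho>) ^ l i) * cmod (F (up z))"
      using \<rho> by (simp add: norm_mult norm_power norm_divide flip: prod_norm)
    also have "\<dots> = (\<Prod>i\<in>J. (1 / \<rho>) ^ l i) * cmod (mon l z) * cmod (F (up z))"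
      unfolding m prod.distrib[symmetric] by (simp add: power_divide)
    also have "\<dots> \<ge> (\<Prod>i\<in>J. (1 / \<rho>) ^ l i) * cmod (mon l z) * (cmod (F w) / 2)"
      using up2 \<rho> by (intro mult_left_mono mult_nonneg_nonneg prod_nonneg) auto
    finally show ?thesis by (simp add: c_def mult_ac)
  qed
  have "(\<integral>\<^sup>+ z. ennreal ((cmod (mon l z))\<^sup>2) * weight (\<phi> z) * indicator V z \<partial>lborel)
    \<le> (\<integral>\<^sup>+ z. ennreal (1 / c\<^sup>2) * (ennreal ((cmod (F z))\<^sup>2) * (weight (\<phi> z) * indicator D z)) \<partial>lborel)"
  proof (rule nn_integral_mono)
    fix z
    show "ennreal ((cmod (mon l z))\<^sup>2) * weight (\<phi> z) * indicator V z \<le> ennreal (1 / c\<^sup>2) * (ennreal ((cmod (F z))\<^sup>2) * (weight (\<phi> z) * indicator D z))"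
    proof (cases "z \<in> V")
      case True
      have "(c * cmod (mon l z))\<^sup>2 \<le> (cmod (F z))\<^sup>2" using low[OF True] c by (intro power_mono) auto
      then have "(cmod (mon l z))\<^sup>2 \<le> 1 / c\<^sup>2 * (cmod (F z))\<^sup>2" using c by (simp add: power_mult_distrib field_simps)
      then have "ennreal ((cmod (mon l z))\<^sup>2) \<le> ennreal (1 / c\<^sup>2) * ennreal ((cmod (F z))\<^sup>2)"
        by (simp add: ennreal_leI flip: ennreal_mult)
      then have "ennreal ((cmod (mon l z))\<^sup>2) * weight (\<phi> z) \<le> ennreal (1 / c\<^sup>2) * ennreal ((cmod (F z))\<^sup>2) * weight (\<phi> z)"
        by (rule mult_right_mono) simp
      then show ?thesis using True VD by (auto simp: mult.assoc)
    qed simp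
  qed
  also have "\<dots> = ennreal (1 / c\<^sup>2) * sq_int F"
    unfolding sq_int_def using F(1) by (intro nn_integral_cmult) (auto intro!: sq_int_measurable simp: nice_def)
  also have "\<dots> < \<infinity>" using F(2) by (simp add: ennreal_mult_less_top)
  finally obtain k :: nat where k: "shifted_exp x' l (real k) \<in> interior NB"
    using integrable_imp_interior_NB[OF openV x'V] VD D_sub by blast
  have "x' $ i = 0 \<longleftrightarrow> x $ i = 0" for i
  proof (cases "i \<in> J")
    case False
    have "cmod (z0 $ i - x $ i) < \<delta>" using z0(1) by (auto simp: polybox_def)
    then have "cmod (z0 $ i - x $ i) < cmod (x $ i)" using \<delta>_le[of i] False by auto
    then have "z0 $ i \<noteq> 0" by auto
    then show ?thesis using False by (simp add: x'_def)
  qed (simp add: x'_def)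
  then have "shifted_exp x' l (real k) = shifted_exp x l (real k)" by (simp add: shifted_exp_def vec_eq_iff)
  then show ?thesis using k by auto
qed

lemma integrable_imp_dominated:
  assumes F: "nice F" "sq_int F < \<infinity>"
    and A: "\<And>l k. shifted_exp x l (real (k::nat)) \<in> interior NB \<Longrightarrow> l \<in> A"
    and z: "z \<in> D" "\<And>i. i \<in> J \<Longrightarrow> cmod (z $ i) < \<delta> / 2"
    and t: "t \<ge> 0" "\<And>a. a \<in> A \<Longrightarrow> (\<Prod>i\<in>J. (2 * cmod (z $ i) / \<delta>) ^ a i) \<le> t"
  shows "cmod (F z) \<le> 2 ^ card J * M * t"
proof (rule domination[where Q = "\<lambda>G. sq_int G \<le> sq_int F" and A = A])
  show "sq_int (Av i N k G) \<le> sq_int F" if "nice G" "sq_int G \<le> sq_int F" "x $ i = 0" "N > 0" for G i N k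
    using sq_int_Av[OF that(1,3,4)] that(2) by (rule order_trans)
  show "sq_int G \<le> sq_int F" if "\<And>n. nice (Gs n)" "\<And>n. sq_int (Gs n) \<le> sq_int F" "nice G" "\<And>z. z \<in> D \<Longrightarrow> (\<lambda>n::nat. Gs n z) \<longlonglongrightarrow> G z" for Gs G
    using that(1,2,4) by (rule sq_int_lim)
  show "l \<in> A" if "nice G" "sq_int G \<le> sq_int F" "\<And>i. i \<in> J \<Longrightarrow> pure i (l i) G" "\<And>i. i \<notin> J \<Longrightarrow> l i = 0" "z \<in> D" "G z \<noteq> 0" for G l z
    using pure_integrable_imp_interior[OF that(1) le_less_trans[OF that(2) F(2)] that(3-6)] A by blast
qed (use F z t in auto)

end

subsection \<open>Toric functions with analytic singularities\<close>

lemma finite_bounded_exponents: "finite {a :: 'n::finite \<Rightarrow> nat. \<forall>i. a i \<le> N}"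
proof (rule finite_subset)
  show "{a :: 'n \<Rightarrow> nat. \<forall>i. a i \<le> N} \<subseteq> PiE UNIV (\<lambda>_. {..N})" by (auto simp: PiE_iff)
qed (rule finite_PiE, auto)

context toric_fun
begin

lemma logv_expv [simp]: "logv (expv y) = y"
  by (simp add: logv_def vec_eq_iff)

text \<open>Lowering all coordinates of \<open>y\<close> by a constant brings it below
  \<open>q\<close>; monotonicity of \<open>G\<close> makes this cost only a constant. Membership in
  the Newton body is thus decided near the origin of the polydisk.\<close>

lemma NB_extend:
  assumes v: "\<And>i. 0 \<le> v $ i" and le: "\<And>y. y \<in> U \<Longrightarrow> (\<And>i. y $ i < q) \<Longrightarrow> v \<bullet> y - G y \<le> C"
  shows "v \<in> NB"
proof -
  define K where "K = max 0 (ln r - q)"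
  define one :: "real ^ 'n" where "one = (\<chi> i. 1)"
  have "v \<bullet> y - G y \<le> C + K * (v \<bullet> one)" if y: "y \<in> U" for y
  proof -
    define y' where "y' = y - K *\<^sub>R one"
    have y': "y' \<in> U" "\<And>i. y' $ i < q" "\<And>i. y' $ i \<le> y $ i"
    proof -
      have y'i: "y' $ i = y $ i - K" for i by (simp add: y'_def one_def)
      have yi: "y $ i < ln r" for i using y by (simp add: U_def)
      show "y' $ i < q" for i using y'i[of i] yi[of i] by (simp add: K_def)
      show le: "y' $ i \<le> y $ i" for i using y'i[of i] by (simp add: K_def)
      show "y' \<in> U" unfolding U_def using le yi by (auto intro: le_less_trans)
    qed
    have "v \<bullet> y' - G y' \<le> C" using y' by (intro le) auto
    moreover have "G y' \<le> G y" using y' y by (intro G_mono) auto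
    moreover have "v \<bullet> y = v \<bullet> y' + K * (v \<bullet> one)" by (simp add: y'_def inner_diff_right)
    ultimately show ?thesis by linarith
  qed
  then show ?thesis unfolding NB_iff by blast
qed

text \<open>The bound of \<open>cmod (g z)\<close> by a multiple of \<open>exp (G / (2 * c))\<close>
  is torus invariant, so it passes to homogeneous parts and says that their exponents, scaled by
  \<open>2 * c\<close>, lie in the Newton body. Conversely, domination of the \<open>g\<close> by
  these monomials bounds \<open>G\<close> from above. The 2 comes from the squares in
  \<open>S\<close>.\<close>

lemma analytic_sing_newton_body:
  assumes an: "analytic_sing_on (polydisk r) \<phi>"
  obtains \<kappa> B where "\<kappa> > 0" "finite B" "B \<noteq> {}" "NB = (\<lambda>x. \<kappa> *\<^sub>R x) ` newton_poly B"
proof -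
  obtain V c0 gs0 h Bd where V: "open V" "0 \<in> V" "V \<subseteq> polydisk r" and c0: "c0 \<ge> (0::real)"
    and gs0: "\<forall>g\<in>set gs0. holo_on V g" and h: "\<forall>z\<in>V. \<bar>h z\<bar> \<le> (Bd::real)"
    and eq0: "\<forall>z\<in>V. \<phi> z = ereal c0 * eln (\<Sum>g\<leftarrow>gs0. (cmod (g z))\<^sup>2) + ereal (h z)"
    using an[unfolded analytic_sing_on_def, rule_format, OF zero_in_polydisk] by (elim exE conjE) (rule that)
  \<comment> \<open>A zero coefficient is replaced by 1 with the constant function 1, whose
    logarithm is 0, so that division by \<open>c\<close> is possible.\<close>
  obtain c gs where c: "c > 0" and gs: "\<And>g. g \<in> set gs \<Longrightarrow> holo_on V g"
    and eq: "\<And>z. z \<in> V \<Longrightarrow> \<phi> z = ereal c * eln (\<Sum>g\<leftarrow>gs. (cmod (g z))\<^sup>2) + ereal (h z)"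
  proof (cases "c0 = 0")
    case True
    show ?thesis
    proof (rule that[of 1 "[\<lambda>_. 1]"])
      show "holo_on V g" if "g \<in> set [\<lambda>_. 1]" for g using that by (simp add: holo_on_const)
      show "\<phi> z = ereal 1 * eln (\<Sum>g\<leftarrow>[\<lambda>_. 1]. (cmod (g z))\<^sup>2) + ereal (h z)" if "z \<in> V" for z
        using eq0 that True by (simp add: eln_def flip: zero_ereal_def)
    qed simp
  next
    case False
    then show ?thesis using that[of c0 gs0] c0 gs0 eq0 by auto
  qed
  define S where "S z = (\<Sum>g\<leftarrow>gs. (cmod (g z))\<^sup>2)" for z
  have g_S: "(cmod (g z))\<^sup>2 \<le> S z" if "g \<in> set gs" for g z
    unfolding S_def using that by (intro member_le_sum_list) auto
  define M where "M = (\<Sum>g\<in>set gs. cmod (g 0)) + 1"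
  have M: "M > 0" unfolding M_def by (intro add_nonneg_pos sum_nonneg) auto
  have "eventually (\<lambda>z. z \<in> V \<and> (\<forall>g\<in>set gs. cmod (g z) < M)) (nhds 0)"
  proof (intro eventually_conj eventually_ball_finite ballI)
    show "eventually (\<lambda>z. z \<in> V) (nhds 0)" using V by (intro eventually_nhds_in_open) auto
    fix g assume g: "g \<in> set gs"
    have "isCont g 0" using holo_on_imp_continuous_on[OF gs[OF g]] V by (auto simp: continuous_on_eq_continuous_at)
    then have "((\<lambda>z. cmod (g z)) \<longlongrightarrow> cmod (g 0)) (nhds 0)"
      by (intro tendsto_norm) (simp add: continuous_at tendsto_nhds_iff)
    moreover have "cmod (g 0) < M"
      using member_le_sum[OF g, of "\<lambda>g. cmod (g 0)"] by (simp add: M_def)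
    ultimately show "eventually (\<lambda>z. cmod (g z) < M) (nhds 0)" by (rule order_tendstoD(2))
  qed simp
  then obtain W where W: "open W" "0 \<in> W" "\<And>z. z \<in> W \<Longrightarrow> z \<in> V \<and> (\<forall>g\<in>set gs. cmod (g z) < M)"
    unfolding eventually_nhds by blast
  obtain \<delta> where \<delta>: "\<delta> > 0" "polybox 0 \<delta> \<subseteq> W" using polybox_subset_open[OF W(1,2)] by blast
  interpret R: reinhardt "0 :: complex ^ 'n" \<delta> M by standard (rule \<delta>)
  let ?D = "polybox (0 :: complex ^ 'n) \<delta>"
  have J: "{i. (0 :: complex ^ 'n) $ i = 0} = UNIV" by simp
  have DV: "z \<in> V" "z \<in> polydisk r" if "z \<in> ?D" for z
  proof -
    have "z \<in> W" using \<delta>(2) that by blast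
    from W(3)[OF this] show "z \<in> V" by (rule conjunct1)
    then show "z \<in> polydisk r" by (rule subsetD[OF V(3)])
  qed
  have nice_g: "R.nice g" if "g \<in> set gs" for g
  proof (rule R.holo_on_imp_nice)
    show "holo_on ?D g" by (rule holo_on_subset[OF gs[OF that]]) (rule subsetI, rule DV(1))
    fix z assume "z \<in> ?D"
    then have "z \<in> W" using \<delta>(2) by blast
    from W(3)[OF this] that have "cmod (g z) < M" by simp
    then show "cmod (g z) \<le> M" by simp
  qed
  have h_le: "\<bar>h z\<bar> \<le> Bd" if "z \<in> V" for z using h that by blast
  have S_G: "S z > 0 \<and> G (logv z) = c * ln (S z) + h z" if z: "z \<in> ?D" "\<And>i. z $ i \<noteq> 0" for z
  proof -
    have e: "ereal (G (logv z)) = ereal c * eln (S z) + ereal (h z)"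
      using phi_logv[OF DV(2)[OF z(1)] z(2)] eq[OF DV(1)[OF z(1)]] by (simp add: S_def)
    have Sp: "S z > 0"
    proof (rule ccontr)
      assume "\<not> S z > 0"
      then have "eln (S z) = -\<infinity>" by (simp add: eln_def)
      then show False using e c by simp
    qed
    then show ?thesis using e by (simp add: eln_def)
  qed
  \<comment> \<open>From \<open>(cmod (g z))\<^sup>2 \<le> S z = exp ((G - h) / c)\<close> and
    \<open>\<bar>h\<bar> \<le> Bd\<close>, after taking a square root.\<close>
  define K where "K = exp (Bd / (2 * c))"
  define Q where "Q F \<longleftrightarrow> (\<forall>z\<in>?D. (\<forall>i. z $ i \<noteq> 0) \<longrightarrow> cmod (F z) \<le> K * exp (G (logv z) / (2 * c)))"
    for F :: "complex ^ 'n \<Rightarrow> complex"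
  have Q_g: "Q g" if g: "g \<in> set gs" for g
    unfolding Q_def
  proof (intro ballI impI)
    fix z assume z: "z \<in> ?D" "\<forall>i. z $ i \<noteq> 0"
    then have SG: "S z > 0" "G (logv z) = c * ln (S z) + h z" using S_G[of z] by auto
    have "c * ln (S z) \<le> G (logv z) + Bd" using SG(2) h_le[OF DV(1)[OF z(1)]] by linarith
    then have l: "ln (S z) \<le> (G (logv z) + Bd) / c" using c by (simp add: pos_le_divide_eq mult.commute)
    have "(cmod (g z))\<^sup>2 \<le> exp (ln (S z))" using g_S[OF g, of z] SG(1) by simp
    also have "\<dots> \<le> exp ((G (logv z) + Bd) / c)" using l by simp
    also have "\<dots> = (K * exp (G (logv z) / (2 * c)))\<^sup>2"
      unfolding K_def by (simp add: power2_eq_square add_divide_distrib flip: exp_add)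
    finally show "cmod (g z) \<le> K * exp (G (logv z) / (2 * c))"
      by (rule power2_le_imp_le) (simp add: K_def)
  qed
  have Q_Av: "Q (R.Av i N k F)" if "R.nice F" "Q F" "(0 :: complex ^ 'n) $ i = 0" "N > 0" for F i N k
    unfolding Q_def
  proof (intro ballI impI)
    fix z assume z: "z \<in> ?D" "\<forall>i. z $ i \<noteq> 0"
    let ?E = "K * exp (G (logv z) / (2 * c))"
    have "cmod (\<Sum>j<N. cis (- (2 * pi * real j * real k / real N)) * F (vupd z i (cis (2 * pi * real j / real N) * z $ i))) \<le> (\<Sum>j<N. ?E)"
    proof (rule sum_norm_le)
      fix j
      define z' where "z' = vupd z i (cis (2 * pi * real j / real N) * z $ i)"
      have "z' \<in> ?D" unfolding z'_def using z(1) by (intro R.D_rotate) auto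
      moreover have "\<forall>i. z' $ i \<noteq> 0" using z(2) by (auto simp: z'_def vupd_nth)
      moreover have "logv z' = logv z" by (auto simp: z'_def logv_def vec_eq_iff vupd_nth norm_mult)
      ultimately have "cmod (F z') \<le> ?E" using that(2) unfolding Q_def by metis
      then show "cmod (cis (- (2 * pi * real j * real k / real N)) * F (vupd z i (cis (2 * pi * real j / real N) * z $ i))) \<le> ?E"
        by (simp add: norm_mult z'_def)
    qed
    then show "cmod (R.Av i N k F z) \<le> ?E"
      unfolding R.Av_eq using that(4) by (simp add: norm_divide divide_le_eq mult.commute)
  qed
  have Q_lim: "Q F" if "\<And>n. Q (Fs n)" "\<And>z. z \<in> ?D \<Longrightarrow> (\<lambda>n::nat. Fs n z) \<longlonglongrightarrow> F z" for Fs F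
    unfolding Q_def
  proof (intro ballI impI)
    fix z assume z: "z \<in> ?D" "\<forall>i. z $ i \<noteq> 0"
    show "cmod (F z) \<le> K * exp (G (logv z) / (2 * c))"
    proof (rule tendsto_upperbound)
      show "(\<lambda>n. cmod (Fs n z)) \<longlonglongrightarrow> cmod (F z)" by (intro tendsto_norm that z)
    qed (use that(1) z in \<open>auto simp: Q_def\<close>)
  qed
  define A where "A = {a. (2 * c) *\<^sub>R rvec a \<in> NB}"
  \<comment> \<open>On the polydisc of radius \<rho> a pure function that is not zero there is a
    nonzero multiple of \<open>mon l\<close>; taking logarithms in \<open>Q\<close> gives the linear
    inequality that defines the Newton body.\<close>
  have Q_pure: "l \<in> A" if F: "R.nice F" "Q F" and p: "\<And>i. R.pure i (l i) F" and z: "z \<in> ?D" "F z \<noteq> 0" for F l z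
  proof -
    define m where "m = Max (range (\<lambda>i. cmod (z $ i)))"
    have "m < \<delta>" unfolding m_def using z by (subst Max_less_iff) (auto simp: polybox_def)
    have mz: "cmod (z $ i) \<le> m" for i unfolding m_def by (intro Max_ge) auto
    have "0 \<le> m" using mz[of undefined] norm_ge_zero order_trans by blast
    define \<rho> where "\<rho> = (m + \<delta>) / 2"
    have \<rho>: "0 < \<rho>" "m \<le> \<rho>" "\<rho> < \<delta>" using \<open>0 \<le> m\<close> \<open>m < \<delta>\<close> \<delta> by (auto simp: \<rho>_def)
    define w :: "complex ^ 'n" where "w = (\<chi> i. of_real \<rho>)"
    have w: "w \<in> ?D" using \<rho> by (simp add: w_def polybox_def)
    have scale: "F v = (\<Prod>i\<in>UNIV. (v $ i / of_real \<rho>) ^ l i) * F w" if "\<And>i. cmod (v $ i) \<le> \<rho>" for v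
    proof -
      have v: "v = (\<chi> i. if i \<in> UNIV then (v $ i / of_real \<rho>) * w $ i else w $ i)"
        using \<rho> by (simp add: vec_eq_iff w_def)
      show ?thesis
        by (subst v, rule R.pure_scale[where S = UNIV, THEN conjunct1])
           (use p w that \<rho> in \<open>auto simp: norm_divide divide_le_eq_1\<close>)
    qed
    have "F z = (\<Prod>i\<in>UNIV. (z $ i / of_real \<rho>) ^ l i) * F w"
      using mz \<rho> by (intro scale) (auto intro: order_trans)
    then have Fw: "F w \<noteq> 0" using z(2) by auto
    define one :: "real ^ 'n" where "one = (\<chi> i. 1)"
    have "(2 * c) *\<^sub>R rvec l \<in> NB"
    proof (rule NB_extend[where q = "ln \<rho>"])
      show "0 \<le> ((2 * c) *\<^sub>R rvec l) $ i" for i using c by simp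
      fix y assume y: "y \<in> U" "\<And>i. y $ i < ln \<rho>"
      have ey: "exp (y $ i) < \<rho>" for i using y(2)[of i] \<rho> by (metis exp_less_cancel_iff exp_ln)
      have yD: "expv y \<in> ?D" using ey \<rho> by (auto simp: polybox_def intro: less_trans)
      have "F (expv y) = (\<Prod>i\<in>UNIV. (expv y $ i / of_real \<rho>) ^ l i) * F w"
        using ey by (intro scale) (auto intro: less_imp_le)
      then have "cmod (F (expv y)) = (\<Prod>i\<in>UNIV. (exp (y $ i) / \<rho>) ^ l i) * cmod (F w)"
        using \<rho> by (simp add: norm_mult norm_power norm_divide flip: prod_norm)
      also have "(\<Prod>i\<in>UNIV. (exp (y $ i) / \<rho>) ^ l i) = (\<Prod>i\<in>UNIV. exp (real (l i) * (y $ i - ln \<rho>)))"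
        using \<rho> by (intro prod.cong refl) (simp add: exp_of_nat_mult exp_diff)
      also have "\<dots> = exp (rvec l \<bullet> y - ln \<rho> * (rvec l \<bullet> one))"
        by (simp add: inner_vec_def one_def sum_distrib_left sum_subtractf algebra_simps flip: exp_sum)
      finally have "exp (rvec l \<bullet> y - ln \<rho> * (rvec l \<bullet> one)) * cmod (F w) \<le> K * exp (G y / (2 * c))"
        using F(2) yD unfolding Q_def by (metis (no_types, lifting) expv_nth exp_not_eq_zero logv_expv of_real_eq_0_iff)
      then have "ln (exp (rvec l \<bullet> y - ln \<rho> * (rvec l \<bullet> one)) * cmod (F w)) \<le> ln (K * exp (G y / (2 * c)))"
        using Fw by (intro ln_mono) (auto simp: K_def)
      then have "rvec l \<bullet> y - ln \<rho> * (rvec l \<bullet> one) + ln (cmod (F w)) \<le> Bd / (2 * c) + G y / (2 * c)"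
        using Fw by (simp add: ln_mult K_def)
      then have "(2 * c) * (rvec l \<bullet> y - ln \<rho> * (rvec l \<bullet> one) + ln (cmod (F w))) \<le> (2 * c) * (Bd / (2 * c) + G y / (2 * c))"
        using c by (intro mult_left_mono) auto
      also have "\<dots> = Bd + G y" using c by (simp add: field_simps)
      finally show "((2 * c) *\<^sub>R rvec l) \<bullet> y - G y \<le> Bd + 2 * c * (ln \<rho> * (rvec l \<bullet> one) - ln (cmod (F w)))"
        by (simp add: algebra_simps)
    qed
    then show ?thesis by (simp add: A_def)
  qed
  have A_up: "b \<in> A" if "a \<in> A" "a \<le> b" for a b
    using that c unfolding A_def by (auto intro: NB_up simp: le_fun_def mult_left_mono)
  have "\<exists>N. \<forall>a\<in>A. (\<lambda>i. min (a i) N) \<in> A"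
    by (rule upclosed_truncation[of A]) (blast intro: A_up)+
  then obtain N where N: "\<And>a. a \<in> A \<Longrightarrow> (\<lambda>i. min (a i) N) \<in> A" by blast
  \<comment> \<open>Truncating an exponent of \<open>A\<close> at \<open>N\<close> stays in
    \<open>A\<close> and enlarges the monomial where the rescaled coordinates are at most 1. So the
    finite set \<open>B\<close> dominates all of \<open>A\<close>.\<close>
  define B where "B = {a \<in> A. \<forall>i. a i \<le> N}"
  have finB: "finite B" unfolding B_def by (rule finite_subset[OF _ finite_bounded_exponents[of N]]) auto
  have trB: "(\<lambda>i. min (a i) N) \<in> B" if "a \<in> A" for a using N[OF that] by (simp add: B_def)
  have dom: "cmod (g z) \<le> 2 ^ CARD('n) * M * t"
    if "g \<in> set gs" "z \<in> ?D" "\<And>i. cmod (z $ i) < \<delta> / 2" "t \<ge> 0" "\<And>a. a \<in> A \<Longrightarrow> (\<Prod>i\<in>UNIV. (2 * cmod (z $ i) / \<delta>) ^ a i) \<le> t" for g z t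
  proof -
    have "cmod (g z) \<le> 2 ^ card {i. (0 :: complex ^ 'n) $ i = 0} * M * t"
    proof (rule R.domination[where Q = Q and A = A])
      show "Q (R.Av i N k F)" if "R.nice F" "Q F" "(0 :: complex ^ 'n) $ i = 0" "N > 0" for F i N k
        using that by (rule Q_Av)
      show "Q F" if "\<And>n. R.nice (Fs n)" "\<And>n. Q (Fs n)" "R.nice F" "\<And>z. z \<in> ?D \<Longrightarrow> (\<lambda>n::nat. Fs n z) \<longlonglongrightarrow> F z" for Fs F
        using that(2,4) by (rule Q_lim)
      show "l \<in> A" if "R.nice F" "Q F" "\<And>i. i \<in> {i. (0 :: complex ^ 'n) $ i = 0} \<Longrightarrow> R.pure i (l i) F"
          "\<And>i. i \<notin> {i. (0 :: complex ^ 'n) $ i = 0} \<Longrightarrow> l i = 0" "z \<in> ?D" "F z \<noteq> 0" for F l z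
        using that(1,2) that(3)[unfolded J, OF UNIV_I] that(5,6) by (rule Q_pure)
      show "R.nice g" "Q g" using nice_g Q_g that(1) by auto
      show "z \<in> ?D" "\<And>i. cmod (z $ i) < \<delta> / 2" "0 \<le> t" using that by auto
      show "(\<Prod>i\<in>{i. (0 :: complex ^ 'n) $ i = 0}. (2 * cmod (z $ i) / \<delta>) ^ a i) \<le> t" if "a \<in> A" for a
        unfolding J by (rule \<open>\<And>a. a \<in> A \<Longrightarrow> (\<Prod>i\<in>UNIV. (2 * cmod (z $ i) / \<delta>) ^ a i) \<le> t\<close>[OF that])
    qed
    then show ?thesis unfolding J by simp
  qed
  define q where "q = ln (\<delta> / 2)"
  have expD: "expv y \<in> ?D \<and> (\<forall>i. cmod (expv y $ i) < \<delta> / 2) \<and> y \<in> U" if y: "\<And>i. y $ i < q" for y :: "real ^ 'n"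
  proof -
    have e: "exp (y $ i) < \<delta> / 2" for i using y[of i] \<delta>(1) unfolding q_def by (metis exp_less_cancel_iff exp_ln half_gt_zero)
    have "expv y \<in> ?D" unfolding polybox_def
    proof safe
      fix i show "cmod (expv y $ i - 0 $ i) < \<delta>" using e[of i] \<delta>(1) by simp
    qed
    moreover from this have "logv (expv y) \<in> U" by (intro logv_in_U DV) auto
    ultimately show ?thesis using e by simp
  qed
  \<comment> \<open>Without exponents, domination with \<open>t = 0\<close> would make every
    \<open>g\<close> vanish and \<phi> equal to -\<infinity> at a point with nonzero
    coordinates.\<close>
  have neB: "B \<noteq> {}"
  proof
    assume "B = {}"
    then have "A = {}" using trB by auto
    define y :: "real ^ 'n" where "y = (\<chi> i. q - 1)"
    have y: "expv y \<in> ?D" "\<And>i. cmod (expv y $ i) < \<delta> / 2" using expD[of y] by (auto simp: y_def)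
    have "cmod (g (expv y)) \<le> 2 ^ CARD('n) * M * 0" if "g \<in> set gs" for g
      using y \<open>A = {}\<close> by (intro dom that) auto
    then have "S (expv y) = (\<Sum>g\<leftarrow>gs. 0)" unfolding S_def by (intro arg_cong[where f = sum_list] map_cong) auto
    then show False using S_G[OF y(1)] by simp
  qed
  \<comment> \<open>The cost of the rescaling by \<open>2 / \<delta>\<close> in the domination
    estimate, expressed in logarithmic coordinates.\<close>
  define K2 where "K2 = Max ((\<lambda>b. rvec b \<bullet> (\<chi> i. ln (2 / \<delta>))) ` B)"
  have G_le: "G y \<le> (2 * c) * Max ((\<lambda>b. rvec b \<bullet> y) ` B) + (c * ln (real (length gs) * (2 ^ CARD('n) * M)\<^sup>2) + 2 * c * K2 + Bd)"
    if y: "\<And>i. y $ i < q" for y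
  proof -
    define m where "m = Max ((\<lambda>b. rvec b \<bullet> y) ` B)"
    note yD = expD[OF y]
    have SG: "S (expv y) > 0" "G y = c * ln (S (expv y)) + h (expv y)" using S_G[of "expv y"] yD by auto
    have t: "(\<Prod>i\<in>UNIV. (2 * cmod (expv y $ i) / \<delta>) ^ a i) \<le> exp (m + K2)" if a: "a \<in> A" for a
    proof -
      let ?b = "\<lambda>i. min (a i) N"
      have "(\<Prod>i\<in>UNIV. (2 * cmod (expv y $ i) / \<delta>) ^ a i) \<le> (\<Prod>i\<in>UNIV. (2 * cmod (expv y $ i) / \<delta>) ^ ?b i)"
      proof (intro prod_mono conjI power_decreasing)
        fix i show "2 * cmod (expv y $ i) / \<delta> \<le> 1"
          using yD \<delta>(1) by (auto simp: divide_le_eq dest!: spec[of _ i])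
      qed (use \<delta>(1) in auto)
      also have "\<dots> = (\<Prod>i\<in>UNIV. exp (real (?b i) * (y $ i + ln (2 / \<delta>))))"
        using \<delta>(1) by (intro prod.cong refl) (simp add: exp_of_nat_mult exp_add mult.commute del: of_nat_min)
      also have "\<dots> = exp (rvec ?b \<bullet> y + rvec ?b \<bullet> (\<chi> i. ln (2 / \<delta>)))"
        by (simp add: inner_vec_def distrib_left sum.distrib flip: exp_sum)
      also have "\<dots> \<le> exp (m + K2)"
        unfolding m_def K2_def exp_le_cancel_iff using finB trB[OF a] by (intro add_mono Max_ge imageI finite_imageI)
      finally show ?thesis .
    qed
    have "S (expv y) \<le> (\<Sum>g\<leftarrow>gs. (2 ^ CARD('n) * M * exp (m + K2))\<^sup>2)"
      unfolding S_def using yD t by (intro sum_list_mono power_mono dom) auto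
    also have "\<dots> = (real (length gs) * (2 ^ CARD('n) * M)\<^sup>2) * (exp (m + K2))\<^sup>2"
      by (simp add: sum_list_triv power_mult_distrib)
    finally have S_le: "S (expv y) \<le> (real (length gs) * (2 ^ CARD('n) * M)\<^sup>2) * exp (2 * (m + K2))"
      unfolding exp_double .
    have len: "real (length gs) > 0" using SG(1) by (cases gs) (auto simp: S_def)
    have "ln (S (expv y)) \<le> ln ((real (length gs) * (2 ^ CARD('n) * M)\<^sup>2) * exp (2 * (m + K2)))"
      using S_le SG(1) by (intro ln_mono) auto
    also have "\<dots> = ln (real (length gs) * (2 ^ CARD('n) * M)\<^sup>2) + 2 * (m + K2)"
      using len M by (subst ln_mult) auto
    finally have "c * ln (S (expv y)) \<le> c * (ln (real (length gs) * (2 ^ CARD('n) * M)\<^sup>2) + 2 * (m + K2))"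
      using c by (intro mult_left_mono) auto
    moreover have "h (expv y) \<le> Bd" using h_le[OF DV(1)] yD by (meson abs_le_D1)
    ultimately show ?thesis unfolding SG(2) m_def[symmetric] by (simp add: algebra_simps)
  qed
  have "NB = (\<lambda>x. (2 * c) *\<^sub>R x) ` newton_poly B"
  proof (intro set_eqI iffI)
    fix x assume x: "x \<in> NB"
    then obtain C where C: "\<And>y. y \<in> U \<Longrightarrow> x \<bullet> y - G y \<le> C" unfolding NB_iff by blast
    have "(1 / (2 * c)) *\<^sub>R x \<in> newton_poly B"
    proof (rule newton_poly_dominated[OF finB neB])
      fix y :: "real ^ 'n" assume y: "\<And>i. y $ i < q"
      show "x \<bullet> y \<le> (2 * c) * Max ((\<lambda>b. rvec b \<bullet> y) ` B) + (c * ln (real (length gs) * (2 ^ CARD('n) * M)\<^sup>2) + 2 * c * K2 + Bd + C)"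
        using C[of y] expD[OF y] G_le[OF y] by auto
    qed (use c in auto)
    then show "x \<in> (\<lambda>x. (2 * c) *\<^sub>R x) ` newton_poly B"
      using c by (intro image_eqI[of _ _ "(1 / (2 * c)) *\<^sub>R x"]) auto
  next
    fix x assume "x \<in> (\<lambda>x. (2 * c) *\<^sub>R x) ` newton_poly B"
    then obtain p t where p: "x = (2 * c) *\<^sub>R p" "t \<in> convex hull (rvec ` B)" "\<forall>i. t $ i \<le> p $ i"
      by (auto simp: newton_poly_def)
    have "convex hull (rvec ` B) \<subseteq> {t. (2 * c) *\<^sub>R t \<in> NB}"
    proof (rule hull_minimal)
      show "rvec ` B \<subseteq> {t. (2 * c) *\<^sub>R t \<in> NB}" by (auto simp: B_def A_def)
      have "{t. (2 * c) *\<^sub>R t \<in> NB} = (\<lambda>t. (2 * c) *\<^sub>R t) -` NB" by auto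
      then show "convex {t. (2 * c) *\<^sub>R t \<in> NB}"
        by (simp add: convex_linear_vimage convex_NB linear_scaleR)
    qed
    then have "(2 * c) *\<^sub>R t \<in> NB" using p(2) by blast
    then show "x \<in> NB" by (rule NB_up) (use p c in auto)
  qed
  then show ?thesis using that[of "2 * c" B] c finB neB by simp
qed

end

section \<open>Comparison of the multiplier ideals at every point\<close>

context toric_approx
begin

text \<open>One inclusion is monotonicity of the weight. For the other, every exponent occurring in
  \<open>f\<close> has an integer shift interior to the polyhedron; such a shift is a lattice point,
  so \<open>lat\<close> moves it into the interior of the Newton body of \<phi>, where its monomial
  is square integrable.\<close>

lemma in_mult_ideal_approx_iff:
  assumes lat: "interior ((\<lambda>x. \<kappa> *\<^sub>R x) ` newton_poly B) \<inter> nonneg_lattice \<subseteq> interior NB"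
    and x: "x \<in> polydisk s"
  shows "in_mult_ideal (polydisk s) (approx m) x f \<longleftrightarrow> in_mult_ideal (polydisk r) \<phi> x f"
proof
  assume "in_mult_ideal (polydisk r) \<phi> x f"
  then obtain V where V: "open V" "x \<in> V" "V \<subseteq> polydisk r" "holo_on V f"
    "(\<integral>\<^sup>+ z. ennreal ((cmod (f z))\<^sup>2) * weight (\<phi> z) * indicator V z \<partial>lborel) < \<infinity>"
    unfolding in_mult_ideal_def by blast
  have "(\<integral>\<^sup>+ z. ennreal ((cmod (f z))\<^sup>2) * weight (approx m z) * indicator (V \<inter> polydisk s) z \<partial>lborel)
     \<le> (\<integral>\<^sup>+ z. ennreal ((cmod (f z))\<^sup>2) * weight (\<phi> z) * indicator V z \<partial>lborel)"
    by (intro nn_integral_mono mult_mono weight_antimono) (auto simp: approx_def indicator_def)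
  also note V(5)
  finally show "in_mult_ideal (polydisk s) (approx m) x f"
    unfolding in_mult_ideal_def using V x open_polydisk
    by (intro exI[of _ "V \<inter> polydisk s"] conjI) (auto intro: holo_on_subset open_Int)
next
  assume "in_mult_ideal (polydisk s) (approx m) x f"
  then obtain V where V: "open V" "x \<in> V" "V \<subseteq> polydisk s" "holo_on V f"
    "(\<integral>\<^sup>+ z. ennreal ((cmod (f z))\<^sup>2) * weight (approx m z) * indicator V z \<partial>lborel) < \<infinity>"
    unfolding in_mult_ideal_def by blast
  define M where "M = cmod (f x) + 1"
  have "isCont f x" using holo_on_imp_continuous_on[OF V(4)] V(1,2) by (auto simp: continuous_on_eq_continuous_at)
  then have "((\<lambda>z. cmod (f z)) \<longlongrightarrow> cmod (f x)) (nhds x)"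
    by (intro tendsto_norm) (simp add: continuous_at tendsto_nhds_iff)
  then have "eventually (\<lambda>z. cmod (f z) < M) (nhds x)" by (rule order_tendstoD(2)) (simp add: M_def)
  then have "eventually (\<lambda>z. z \<in> V \<and> cmod (f z) < M) (nhds x)"
    using eventually_nhds_in_open[OF V(1,2)] by eventually_elim auto
  then obtain W where W: "open W" "x \<in> W" "\<forall>z\<in>W. z \<in> V \<and> cmod (f z) < M"
    unfolding eventually_nhds by blast
  obtain \<delta>1 where \<delta>1: "\<delta>1 > 0" "polybox x \<delta>1 \<subseteq> W" using polybox_subset_open[OF W(1,2)] by blast
  define \<delta> where "\<delta> = Min (insert \<delta>1 ((\<lambda>i. cmod (x $ i)) ` {i. x $ i \<noteq> 0}))"
  have \<delta>: "\<delta> > 0" unfolding \<delta>_def using \<delta>1 by (subst Min_gr_iff) auto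
  have \<delta>_le1: "\<delta> \<le> \<delta>1" unfolding \<delta>_def by (intro Min_le) auto
  have \<delta>_le: "\<delta> \<le> cmod (x $ i)" if "x $ i \<noteq> 0" for i unfolding \<delta>_def using that by (intro Min_le) auto
  have "polybox x \<delta> \<subseteq> polybox x \<delta>1" using \<delta>_le1 by (auto simp: polybox_def intro: less_le_trans)
  then have DV: "polybox x \<delta> \<subseteq> V" and DM: "\<And>z. z \<in> polybox x \<delta> \<Longrightarrow> cmod (f z) \<le> M"
    using \<delta>1(2) W(3) by (auto intro: less_imp_le)
  interpret T: toric_reinhardt s "approx m" x \<delta> M
    by unfold_locales (use s(1) toric_psh_approx \<delta> DV V(3) \<delta>_le in auto)
  have nice_f: "T.nice f" by (rule T.holo_on_imp_nice[OF holo_on_subset[OF V(4) DV] DM])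
  have "T.sq_int f \<le> (\<integral>\<^sup>+ z. ennreal ((cmod (f z))\<^sup>2) * weight (approx m z) * indicator V z \<partial>lborel)"
    unfolding T.sq_int_def using DV by (intro nn_integral_mono) (auto simp: indicator_def mult.assoc)
  also note V(5)
  finally have fin_f: "T.sq_int f < \<infinity>" .
  define J where "J = {i. x $ i = 0}"
  \<comment> \<open>Defined by the Newton body of \<phi>; exponents found with the body of
    \<open>approx m\<close> are transferred here by the hypothesis on lattice points.\<close>
  define A where "A = {l. \<exists>k::nat. shifted_exp x l (real k) \<in> interior NB}"
  have A_imp: "l \<in> A" if "shifted_exp x l (real k) \<in> interior (newton_body s (approx m))" for l and k :: nat
  proof -
    have "shifted_exp x l (real k) \<in> interior ((\<lambda>x. \<kappa> *\<^sub>R x) ` newton_poly B)"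
      using that interior_mono[OF NB_approx] by blast
    moreover have "real (l i) + 1 + real k \<in> \<nat>" "real (l i) + 1 \<in> \<nat>" for i
      by (intro Nats_add; simp)+
    then have "shifted_exp x l (real k) \<in> nonneg_lattice"
      by (simp add: nonneg_lattice_def shifted_exp_def)
    ultimately show ?thesis unfolding A_def using lat by blast
  qed
  have A_up: "b \<in> A" if ab: "a \<in> A" "a \<le> b" for a b
  proof -
    obtain k :: nat where k: "shifted_exp x a (real k) \<in> interior NB" using ab(1) by (auto simp: A_def)
    have "shifted_exp x b (real k) \<in> interior NB"
      by (rule interior_upclosed[OF NB_up k]) (use ab(2) in \<open>auto simp: shifted_exp_def le_fun_def\<close>)
    then show ?thesis by (auto simp: A_def)
  qed
  have "\<exists>N. \<forall>a\<in>A. (\<lambda>i. min (a i) N) \<in> A"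
    by (rule upclosed_truncation[of A]) (blast intro: A_up)+
  then obtain N where N: "\<And>a. a \<in> A \<Longrightarrow> (\<lambda>i. min (a i) N) \<in> A" by blast
  define E where "E = {a \<in> A. \<forall>i. a i \<le> N}"
  have finE: "finite E" unfolding E_def by (rule finite_subset[OF _ finite_bounded_exponents[of N]]) auto
  \<comment> \<open>Domination sees the coordinates in \<open>J\<close> only, so the monomials are
    stripped of the others before they are integrated.\<close>
  define on_J where "on_J b i = (if i \<in> J then b i else (0::nat))" for b :: "'n \<Rightarrow> nat" and i
  define C where "C b = 2 ^ card J * M * (\<Prod>i\<in>J. (2 / \<delta>) ^ b i)" for b :: "'n \<Rightarrow> nat"
  have mon_J: "cmod (mon (on_J b) z) = (\<Prod>i\<in>J. cmod (z $ i) ^ b i)" for b z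
  proof -
    have "cmod (mon (on_J b) z) = (\<Prod>i\<in>J. cmod (z $ i) ^ on_J b i)"
      unfolding cmod_mon by (rule prod.mono_neutral_right) (auto simp: on_J_def)
    then show ?thesis by (simp add: on_J_def)
  qed
  have f_le: "cmod (f z) \<le> (\<Sum>b\<in>E. C b * cmod (mon (on_J b) z))"
    if z: "z \<in> polybox x \<delta>" "\<And>i. i \<in> J \<Longrightarrow> cmod (z $ i) < \<delta> / 2" for z
  proof -
    define t where "t = (\<Sum>b\<in>E. \<Prod>i\<in>J. (2 * cmod (z $ i) / \<delta>) ^ b i)"
    have nn: "0 \<le> (\<Prod>i\<in>J. (2 * cmod (z $ i) / \<delta>) ^ b i)" for b using \<delta> by (intro prod_nonneg) auto
    have t: "(\<Prod>i\<in>J. (2 * cmod (z $ i) / \<delta>) ^ a i) \<le> t" if a: "a \<in> A" for a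
    proof -
      let ?b = "\<lambda>i. min (a i) N"
      have "(\<Prod>i\<in>J. (2 * cmod (z $ i) / \<delta>) ^ a i) \<le> (\<Prod>i\<in>J. (2 * cmod (z $ i) / \<delta>) ^ ?b i)"
      proof (intro prod_mono conjI power_decreasing)
        fix i assume "i \<in> J"
        then show "2 * cmod (z $ i) / \<delta> \<le> 1" using z(2)[of i] \<delta> by (simp add: divide_le_eq)
      qed (use \<delta> in auto)
      also have "\<dots> \<le> t" unfolding t_def
        by (rule member_le_sum[of ?b E "\<lambda>b. \<Prod>i\<in>J. (2 * cmod (z $ i) / \<delta>) ^ b i"])
           (use N[OF a] finE nn in \<open>auto simp: E_def\<close>)
      finally show ?thesis .
    qed
    have t0: "t \<ge> 0" unfolding t_def by (intro sum_nonneg nn)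
    have "cmod (f z) \<le> 2 ^ card J * M * t"
      unfolding J_def
    proof (rule T.integrable_imp_dominated[where A = A])
      show "l \<in> A" if "shifted_exp x l (real k) \<in> interior (newton_body s (approx m))" for l and k :: nat
        using that by (rule A_imp)
    qed (use nice_f fin_f z t t0 in \<open>auto simp: J_def\<close>)
    also have "\<dots> = (\<Sum>b\<in>E. C b * cmod (mon (on_J b) z))"
      unfolding t_def sum_distrib_left
      by (intro sum.cong refl) (simp add: C_def mon_J power_divide power_mult_distrib prod.distrib prod_dividef)
    finally show ?thesis .
  qed
  have xr: "x \<in> polydisk r" using x polydisk_s by blast
  define I where "I b \<epsilon> = (\<integral>\<^sup>+ z. ennreal ((cmod (mon (on_J b) z))\<^sup>2) * weight (\<phi> z) * indicator (polybox x \<epsilon>) z \<partial>lborel)" for b \<epsilon>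
  define R where "R b \<delta>0 \<longleftrightarrow> 0 < \<delta>0 \<and> (\<forall>\<epsilon>. 0 < \<epsilon> \<longrightarrow> \<epsilon> \<le> \<delta>0 \<longrightarrow> I b \<epsilon> < \<infinity>)" for b \<delta>0
  have "\<forall>b\<in>E. \<exists>\<delta>0. R b \<delta>0"
  proof
    fix b assume b: "b \<in> E"
    obtain k :: nat where k: "shifted_exp x b (real k) \<in> interior NB" using b by (auto simp: E_def A_def)
    have bN: "real (b i) \<le> real N" for i using b by (simp add: E_def)
    \<comment> \<open>Stripping lowers the entries outside \<open>J\<close> by at most
      \<open>N\<close>, and raising the shift from \<open>k\<close> to \<open>k + N\<close> makes up
      for it.\<close>
    have e: "shifted_exp x (on_J b) (real (k + N)) \<in> interior NB"
      by (rule interior_upclosed[OF NB_up k]) (use bN in \<open>auto simp: shifted_exp_def on_J_def J_def\<close>)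
    show "\<exists>\<delta>0. R b \<delta>0"
    proof (rule interior_NB_imp_integrable[OF xr e of_nat_0_le_iff])
      fix \<delta>0 :: real
      assume "0 < \<delta>0" "\<And>\<epsilon>. 0 < \<epsilon> \<Longrightarrow> \<epsilon> \<le> \<delta>0 \<Longrightarrow> (\<integral>\<^sup>+ z. ennreal ((cmod (mon (on_J b) z))\<^sup>2) * weight (\<phi> z) * indicator (polybox x \<epsilon>) z \<partial>lborel) < \<infinity>"
      then have "R b \<delta>0" by (simp add: R_def I_def)
      then show "\<exists>\<delta>0. R b \<delta>0" ..
    qed
  qed
  from bchoice[OF this] obtain \<delta>b where R: "\<forall>b\<in>E. R b (\<delta>b b)" ..
  have \<delta>b: "\<delta>b b > 0" "\<And>\<epsilon>. 0 < \<epsilon> \<Longrightarrow> \<epsilon> \<le> \<delta>b b \<Longrightarrow> I b \<epsilon> < \<infinity>" if "b \<in> E" for b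
    using R that by (auto simp: R_def)
  \<comment> \<open>One radius for all exponents in \<open>E\<close>, and at most
    \<open>\<delta> / 2\<close> as the domination estimate demands.\<close>
  define \<delta>' where "\<delta>' = Min (insert (\<delta> / 2) (\<delta>b ` E))"
  have \<delta>': "\<delta>' > 0" unfolding \<delta>'_def using \<delta> \<delta>b(1) finE by (subst Min_gr_iff) auto
  have \<delta>'_le: "\<delta>' \<le> \<delta> / 2" "\<And>b. b \<in> E \<Longrightarrow> \<delta>' \<le> \<delta>b b"
    unfolding \<delta>'_def using finE by (rule_tac Min_le; simp)+
  let ?D' = "polybox x \<delta>'"
  have D'D: "z \<in> polybox x \<delta>" "\<And>i. i \<in> J \<Longrightarrow> cmod (z $ i) < \<delta> / 2" if "z \<in> ?D'" for z
  proof -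
    have lt: "cmod (z $ i - x $ i) < \<delta> / 2" for i
    proof -
      have "cmod (z $ i - x $ i) < \<delta>'" using that by (simp add: polybox_def)
      then show ?thesis using \<delta>'_le(1) by linarith
    qed
    show "z \<in> polybox x \<delta>" unfolding polybox_def
    proof safe
      fix i show "cmod (z $ i - x $ i) < \<delta>" using lt[of i] \<delta> by linarith
    qed
    show "cmod (z $ i) < \<delta> / 2" if "i \<in> J" for i using lt[of i] that by (simp add: J_def)
  qed
  have D'V: "?D' \<subseteq> V" using D'D(1) DV by blast
  then have D'r: "?D' \<subseteq> polydisk r" using V(3) polydisk_s by blast
  define H where "H b z = ennreal ((cmod (mon (on_J b) z))\<^sup>2) * (weight (\<phi> z) * indicator ?D' z)" for b z
  have H_meas [measurable]: "H b \<in> borel_measurable borel" for b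
  proof -
    have [measurable]: "mon (on_J b) \<in> borel_measurable borel"
      by (rule borel_measurable_continuous_onI) (rule continuous_on_mon)
    have [measurable]: "(\<lambda>z. weight (\<phi> z) * indicator ?D' z) \<in> borel_measurable borel"
      by (rule measurable_weight_phi[OF open_polybox D'r])
    show ?thesis unfolding H_def[abs_def] by measurable
  qed
  have M: "M \<ge> 0" by (simp add: M_def)
  have C_nn: "C b \<ge> 0" for b unfolding C_def using M \<delta> by (intro mult_nonneg_nonneg prod_nonneg) auto
  have "(\<integral>\<^sup>+ z. ennreal ((cmod (f z))\<^sup>2) * weight (\<phi> z) * indicator ?D' z \<partial>lborel)
    \<le> (\<integral>\<^sup>+ z. (\<Sum>b\<in>E. ennreal (real (card E) * (C b)\<^sup>2) * H b z) \<partial>lborel)"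
  proof (rule nn_integral_mono)
    fix z
    show "ennreal ((cmod (f z))\<^sup>2) * weight (\<phi> z) * indicator ?D' z \<le> (\<Sum>b\<in>E. ennreal (real (card E) * (C b)\<^sup>2) * H b z)"
    proof (cases "z \<in> ?D'")
      case True
      have "(cmod (f z))\<^sup>2 \<le> (\<Sum>b\<in>E. 1 * (C b * cmod (mon (on_J b) z)))\<^sup>2"
        using f_le[OF D'D(1)[OF True] D'D(2)[OF True]] by (intro power_mono) auto
      also have "\<dots> \<le> (\<Sum>b\<in>E. 1\<^sup>2) * (\<Sum>b\<in>E. (C b * cmod (mon (on_J b) z))\<^sup>2)"
        by (rule Cauchy_Schwarz_ineq_sum)
      also have "\<dots> = (\<Sum>b\<in>E. (real (card E) * (C b)\<^sup>2) * (cmod (mon (on_J b) z))\<^sup>2)"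
        by (simp add: sum_distrib_left power_mult_distrib mult.assoc)
      finally have "ennreal ((cmod (f z))\<^sup>2) \<le> (\<Sum>b\<in>E. ennreal (real (card E) * (C b)\<^sup>2) * ennreal ((cmod (mon (on_J b) z))\<^sup>2))"
        by (subst ennreal_mult[symmetric], simp, simp, subst sum_ennreal, simp, rule ennreal_leI)
      then have "ennreal ((cmod (f z))\<^sup>2) * weight (\<phi> z) \<le> (\<Sum>b\<in>E. ennreal (real (card E) * (C b)\<^sup>2) * ennreal ((cmod (mon (on_J b) z))\<^sup>2)) * weight (\<phi> z)"
        by (rule mult_right_mono) simp
      then show ?thesis using True by (simp add: H_def sum_distrib_right mult.assoc)
    qed simp
  qed
  also have "\<dots> = (\<Sum>b\<in>E. ennreal (real (card E) * (C b)\<^sup>2) * (\<integral>\<^sup>+ z. H b z \<partial>lborel))"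
    by (simp add: nn_integral_sum nn_integral_cmult)
  also have "\<dots> < \<infinity>"
  proof -
    have "(\<integral>\<^sup>+ z. H b z \<partial>lborel) < \<infinity>" if "b \<in> E" for b
      using \<delta>b(2)[OF that \<delta>' \<delta>'_le(2)[OF that]] by (simp add: H_def I_def mult.assoc)
    then have "ennreal (real (card E) * (C b)\<^sup>2) * (\<integral>\<^sup>+ z. H b z \<partial>lborel) < \<infinity>" if "b \<in> E" for b
      using that by (simp add: ennreal_mult_less_top)
    then show ?thesis using finE by simp
  qed
  finally have fin: "(\<integral>\<^sup>+ z. ennreal ((cmod (f z))\<^sup>2) * weight (\<phi> z) * indicator ?D' z \<partial>lborel) < \<infinity>" .
  have xD': "x \<in> ?D'" using \<delta>' by (simp add: polybox_def)
  show "in_mult_ideal (polydisk r) \<phi> x f"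
    unfolding in_mult_ideal_def
    by (intro exI[of _ ?D'] conjI open_polybox xD' D'r holo_on_subset[OF V(4) D'V] fin)
qed

end

theorem theorem1p2:
  fixes r :: real and \<phi> :: "complex ^ 'n \<Rightarrow> ereal"
  assumes "r > 0" and "toric_psh r \<phi>"
  shows "(\<exists>s. 0 < s \<and> s \<le> r \<and> (\<exists>\<phi>s :: nat \<Rightarrow> complex ^ 'n \<Rightarrow> ereal.
             (\<forall>m. toric_psh s (\<phi>s m) \<and> analytic_sing_on (polydisk s) (\<phi>s m)) \<and>
             (\<forall>m. \<forall>z\<in>polydisk s. \<phi>s (Suc m) z \<le> \<phi>s m z) \<and>
             (\<forall>z\<in>polydisk s. (\<lambda>m. \<phi>s m z) \<longlonglongrightarrow> \<phi> z) \<and>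
             (\<forall>m. \<forall>x\<in>polydisk s. \<forall>f.
                in_mult_ideal (polydisk s) (\<phi>s m) x f \<longleftrightarrow> in_mult_ideal (polydisk r) \<phi> x f)))
     \<longleftrightarrow>
     (\<exists>P :: (real ^ 'n) set. polyhedron P \<and> P \<subseteq> nonneg_orthant \<and>
        (\<exists>c>0. rational_polyhedron ((\<lambda>x. (2 / c) *\<^sub>R x) ` P)) \<and>
        newton_body r \<phi> \<subseteq> P \<and>
        {p + q | p q. p \<in> P \<and> q \<in> nonneg_orthant} \<subseteq> P \<and>
        interior P \<inter> nonneg_lattice = interior (newton_body r \<phi>) \<inter> nonneg_lattice)"
    (is "(\<exists>s. 0 < s \<and> s \<le> r \<and> (\<exists>\<phi>s. ?nice s \<phi>s)) \<longleftrightarrow> (\<exists>P. ?poly P)")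
proof
  interpret \<phi>: toric_fun r \<phi> by standard (use assms in auto)
  assume "\<exists>s. 0 < s \<and> s \<le> r \<and> (\<exists>\<phi>s. ?nice s \<phi>s)"
  then obtain s \<phi>s where s: "0 < s" "s \<le> r" and nice: "?nice s \<phi>s" by blast
  define \<psi> where "\<psi> = \<phi>s 0"
  have \<psi>: "toric_psh s \<psi>" "analytic_sing_on (polydisk s) \<psi>" using nice by (auto simp: \<psi>_def)
  interpret \<psi>: toric_fun s \<psi> by standard (use s \<psi> in auto)
  define P where "P = newton_body s \<psi>"
  obtain \<kappa> B where B: "\<kappa> > 0" "finite B" "B \<noteq> {}" "P = (\<lambda>x. \<kappa> *\<^sub>R x) ` newton_poly B"
    using \<psi>.analytic_sing_newton_body[OF \<psi>(2)] unfolding P_def by blast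
  have le: "\<phi> z \<le> \<psi> z" if "z \<in> polydisk s" for z
  proof -
    have "decseq (\<lambda>m. \<phi>s m z)" using nice that by (intro decseq_SucI) blast
    then show ?thesis using nice that unfolding \<psi>_def by (intro decseq_ge) auto
  qed
  have "polyhedron P"
  proof -
    have "bij (\<lambda>x :: real ^ 'n. \<kappa> *\<^sub>R x)"
      by (rule bijI, use B(1) in \<open>simp add: inj_on_def\<close>) (rule surjI[of _ "\<lambda>x. (1 / \<kappa>) *\<^sub>R x"], use B(1) in simp)
    then show ?thesis
      using rational_polyhedron_newton_poly[OF B(2,3)] unfolding B(4)
      by (subst polyhedron_linear_image_eq) (auto simp: rational_polyhedron_imp_polyhedron linear_scaleR)
  qed
  moreover have "P \<subseteq> nonneg_orthant" unfolding P_def nonneg_orthant_def using \<psi>.NB_nonneg by blast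
  moreover have "\<exists>c>0. rational_polyhedron ((\<lambda>x. (2 / c) *\<^sub>R x) ` P)"
  proof (intro exI conjI)
    \<comment> \<open>The choice \<open>c = 2 * \<kappa>\<close> undoes the factor \<kappa> and
      leaves the polyhedron spanned by integer exponents.\<close>
    show "2 * \<kappa> > 0" using B(1) by simp
    have "(\<lambda>x. (2 / (2 * \<kappa>)) *\<^sub>R x) ` P = newton_poly B" using B(1) by (simp add: B(4) image_image)
    then show "rational_polyhedron ((\<lambda>x. (2 / (2 * \<kappa>)) *\<^sub>R x) ` P)"
      using rational_polyhedron_newton_poly[OF B(2,3)] by simp
  qed
  moreover have "newton_body r \<phi> \<subseteq> P"
  proof
    fix x assume "x \<in> newton_body r \<phi>"
    then obtain C where C: "\<And>y. (\<And>i. y $ i < ln r) \<Longrightarrow> ereal (x \<bullet> y) - assoc_convex \<phi> y \<le> ereal C"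
      unfolding newton_body_def by auto
    \<comment> \<open>Two relaxations in the same direction: fewer points \<open>y\<close>, and a
      larger function.\<close>
    have "ereal (x \<bullet> y) - assoc_convex \<psi> y \<le> ereal C" if y: "\<forall>i. y $ i < ln s" for y
    proof -
      have "y $ i < ln r" for i using y s by (auto intro: less_le_trans)
      then have "ereal (x \<bullet> y) - assoc_convex \<phi> y \<le> ereal C" by (rule C)
      moreover have "expv y \<in> polydisk s" using y by (intro \<psi>.expv_in) (simp add: \<psi>.U_def)
      then have "assoc_convex \<phi> y \<le> assoc_convex \<psi> y" unfolding assoc_convex_expv by (rule le)
      then have "ereal (x \<bullet> y) - assoc_convex \<psi> y \<le> ereal (x \<bullet> y) - assoc_convex \<phi> y" by (intro ereal_minus_mono) auto
      ultimately show ?thesis by (rule order_trans[rotated])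
    qed
    then show "x \<in> P" unfolding P_def newton_body_def by blast
  qed
  moreover have "{p + q | p q. p \<in> P \<and> q \<in> nonneg_orthant} \<subseteq> P"
    unfolding P_def by (auto simp: nonneg_orthant_def intro: \<psi>.NB_up)
  moreover have "interior P \<inter> nonneg_lattice = interior (newton_body r \<phi>) \<inter> nonneg_lattice"
  proof -
    \<comment> \<open>The stalks at the origin suffice, since monomials there detect the interior
      lattice points of either body.\<close>
    have "in_mult_ideal (polydisk s) \<psi> 0 f \<longleftrightarrow> in_mult_ideal (polydisk r) \<phi> 0 f" for f
      using nice \<psi>.zero_in_polydisk unfolding \<psi>_def by blast
    then show ?thesis unfolding P_def using \<psi>.lattice_interior_iff \<phi>.lattice_interior_iff by blast
  qed
  ultimately have "?poly P" by blast
  then show "\<exists>P. ?poly P" ..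
next
  interpret \<phi>: toric_fun r \<phi> by standard (use assms in auto)
  assume "\<exists>P. ?poly P"
  then obtain P c where P: "P \<subseteq> nonneg_orthant" "newton_body r \<phi> \<subseteq> P"
      "{p + q | p q. p \<in> P \<and> q \<in> nonneg_orthant} \<subseteq> P"
      "interior P \<inter> nonneg_lattice = interior (newton_body r \<phi>) \<inter> nonneg_lattice"
    and c: "c > 0" "rational_polyhedron ((\<lambda>x. (2 / c) *\<^sub>R x) ` P)" by blast
  let ?Q = "(\<lambda>x. (2 / c) *\<^sub>R x) ` P"
  have Q_nn: "?Q \<subseteq> nonneg_orthant" using P(1) c(1) by (auto simp: nonneg_orthant_def)
  have "P \<noteq> {}" using P(2) \<phi>.NB_nonempty by blast
  then have Q_ne: "?Q \<noteq> {}" by simp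
  have Q_up: "y \<in> ?Q" if xy: "x \<in> ?Q" "\<And>i. x $ i \<le> y $ i" for x y
  proof -
    obtain p where p: "p \<in> P" "x = (2 / c) *\<^sub>R p" using xy(1) by blast
    define q where "q = (c / 2) *\<^sub>R (y - x)"
    have "q \<in> nonneg_orthant" using xy(2) c(1) by (simp add: q_def nonneg_orthant_def)
    then have "p + q \<in> P" using p P(3) by blast
    moreover have "y = (2 / c) *\<^sub>R (p + q)" using c(1) by (simp add: q_def p(2) scaleR_add_right)
    ultimately show ?thesis by blast
  qed
  obtain d :: real and B where d: "0 < d" "finite B" "B \<noteq> {}" "?Q = (\<lambda>x. (1 / d) *\<^sub>R x) ` newton_poly B"
    by (rule rational_polyhedron_eq_newton_poly[OF c(2) Q_nn Q_ne Q_up])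
  define \<kappa> where "\<kappa> = c / (2 * d)"
  have "P = (\<lambda>x. (c / 2) *\<^sub>R x) ` ?Q" using c(1) by (simp add: image_image)
  also have "\<dots> = (\<lambda>x. \<kappa> *\<^sub>R x) ` newton_poly B" unfolding d(4) by (simp add: image_image \<kappa>_def)
  finally have P_eq: "P = (\<lambda>x. \<kappa> *\<^sub>R x) ` newton_poly B" .
  \<comment> \<open>Any radius strictly between 0 and \<open>r\<close> serves. On
    \<open>polydisk r\<close> itself \<phi> may be unbounded above near the boundary, where
    \<open>H\<close> stays bounded above.\<close>
  interpret A: toric_approx r \<phi> B \<kappa> "r / 2"
    by unfold_locales (use assms d c P(2) P_eq in \<open>auto simp: \<kappa>_def\<close>)
  have "?nice (r / 2) A.approx"
    using A.toric_psh_approx A.analytic_sing_approx A.approx_decreasing A.approx_tendsto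
      A.in_mult_ideal_approx_iff[folded P_eq] P(4) by blast
  then show "\<exists>s. 0 < s \<and> s \<le> r \<and> (\<exists>\<phi>s. ?nice s \<phi>s)"
    using assms(1) by (intro exI[of _ "r / 2"] conjI exI[of _ A.approx]) auto
qed

end
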